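(* The following statements are equivalent: 1. $A$ is a regular algebra. 2. $\mathfrak{D}(A)$ is a simple algebra. 3. $A$ is a simple $\mathfrak{D}(A)$-module.
   Context: $K$ is a field of characteristic zero (not necessarily algebraically closed), $P_n=K[x_1,\ldots,x_n]$, $I=\sum_{i=1}^m P_nf_i$ is a prime but not maximal ideal of $P_n$ with generators $f_1,\ldots,f_m$, and $A=P_n/I$, a domain with field of fractions $Q$. The image of $p\in P_n$ in $A$ is written $\overline{p}$. $\overline{J}=\left(\overline{\partial f_i/\partial x_j}\right)\in M_{m,n}(A)$ is the Jacobi matrix and $r$ is its rank over $Q$. Modules are left modules. For tuples $\mathbf{i}=(i_1,\ldots,i_r)$ of indices in $\{1,\ldots,m\}$ and $\mathbf{j}=(j_1,\ldots,j_r)$ of indices in $\{1,\ldots,n\}$, $\Delta(\mathbf{i};j_1,\ldots,j_r)=\det(\overline{J}_{i_\nu,j_\mu})_{\nu,\mu=1,\ldots,r}$. A strictly increasing $\mathbf{i}$ (resp. $\mathbf{j}$) is non-singular if $\Delta(\mathbf{i},\mathbf{j}')\ne0$ for some $\mathbf{j}'$ (resp. $\Delta(\mathbf{i}',\mathbf{j})\neq0$ for some $\mathbf{i}'$); $\mathbf{I}_r$ (resp. $\mathbf{J}_r$) is the set of non-singular strictly increasing $r$-tuples $\mathbf{i}$ (resp. $\mathbf{j}$). $\mathbf{J}_{r+1}$ is the set of strictly increasing $(r+1)$-tuples of indices in $\{1,\ldots,n\}$ such that deleting some element leaves an element of $\mathbf{J}_r$. For $\mathbf{i}\in\mathbf{I}_r$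 and $\mathbf{j}=(j_1,\ldots,j_{r+1})\in\mathbf{J}_{r+1}$, $\partial_{\mathbf{i},\mathbf{j}}=\sum_{k=1}^{r+1}(-1)^{r+1+k}\Delta(\mathbf{i};j_1,\ldots,\widehat{j_k},\ldots,j_{r+1})\,\partial/\partial x_{j_k}$ (hat means omitted), i.e. the well-defined $K$-derivation of $A$ sending $x_{j_k}$ to $(-1)^{r+1+k}\Delta(\mathbf{i};j_1,\ldots,\widehat{j_k},\ldots,j_{r+1})$ and $x_l$ to $0$ for $l\notin\{j_1,\ldots,j_{r+1}\}$. The $A$-module of natural derivations is $\mathrm{der}_K(A)=\sum_{\mathbf{i}\in\mathbf{I}_r,\mathbf{j}\in\mathbf{J}_{r+1}}A\,\partial_{\mathbf{i},\mathbf{j}}\subseteq\mathrm{Der}_K(A)$. The algebra of natural differential operators $\mathfrak{D}(A)$ is the subalgebra of $\mathrm{End}_K(A)$ (equivalently, of the ring $\mathcal{D}(A)$ of $K$-linear differential operators on $A$) generated by $A$ (acting by multiplication) and $\mathrm{der}_K(A)$; $A$ is naturally a left $\mathfrak{D}(A)$-module. *)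

theory Defs
  imports
    "HOL-Library.Poly_Mapping"
    "HOL-Library.Extended_Nat"
    "HOL-Combinatorics.Permutations"
    "HOL-Algebra.Algebra"
begin

section \<open>Localization and regular rings\<close>

text \<open>
  \<open>loc_frac R S a s\<close> is the fraction \<open>a/s\<close>: the class of \<open>(a, s)\<close> under
  \<open>(a, s) ~ (b, t)\<close> iff \<open>u (a t - b s) = 0\<close> for some \<open>u \<in> S\<close>. It is meant for a
  multiplicative subset \<open>S\<close> of a commutative ring \<open>R\<close>. As for cosets in
  \<^const>\<open>FactRing\<close>, the operations on classes are unions over representatives.
\<close>

definition loc_frac :: "('a, 'b) ring_scheme \<Rightarrow> 'a set \<Rightarrow> 'a \<Rightarrow> 'a \<Rightarrow> ('a \<times> 'a) set" where
  "loc_frac R S a s =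
     {(b, t). b \<in> carrier R \<and> t \<in> S \<and>
        (\<exists>u\<in>S. u \<otimes>\<^bsub>R\<^esub> (a \<otimes>\<^bsub>R\<^esub> t) = u \<otimes>\<^bsub>R\<^esub> (b \<otimes>\<^bsub>R\<^esub> s))}"

definition localization :: "('a, 'b) ring_scheme \<Rightarrow> 'a set \<Rightarrow> ('a \<times> 'a) set ring" where
  "localization R S =
     \<lparr>carrier = {loc_frac R S a s | a s. a \<in> carrier R \<and> s \<in> S},
      monoid.mult = (\<lambda>U V. \<Union>x\<in>U. \<Union>y\<in>V.
                loc_frac R S (fst x \<otimes>\<^bsub>R\<^esub> fst y) (snd x \<otimes>\<^bsub>R\<^esub> snd y)),
      one = loc_frac R S \<one>\<^bsub>R\<^esub> \<one>\<^bsub>R\<^esub>,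
      ring.zero = loc_frac R S \<zero>\<^bsub>R\<^esub> \<one>\<^bsub>R\<^esub>,
      add = (\<lambda>U V. \<Union>x\<in>U. \<Union>y\<in>V.
               loc_frac R S (fst x \<otimes>\<^bsub>R\<^esub> snd y \<oplus>\<^bsub>R\<^esub> fst y \<otimes>\<^bsub>R\<^esub> snd x) (snd x \<otimes>\<^bsub>R\<^esub> snd y))\<rparr>"

definition fraction_field :: "('a, 'b) ring_scheme \<Rightarrow> ('a \<times> 'a) set ring" where
  "fraction_field R = localization R (carrier R - {\<zero>\<^bsub>R\<^esub>})"

definition to_fraction_field :: "('a, 'b) ring_scheme \<Rightarrow> 'a \<Rightarrow> ('a \<times> 'a) set" where
  "to_fraction_field R a = loc_frac R (carrier R - {\<zero>\<^bsub>R\<^esub>}) a \<one>\<^bsub>R\<^esub>"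

definition krull_dim :: "('a, 'b) ring_scheme \<Rightarrow> enat" where
  "krull_dim R =
     Sup {enat k | k. \<exists>p :: nat \<Rightarrow> 'a set.
            (\<forall>i\<le>k. primeideal (p i) R) \<and> (\<forall>i<k. p i \<subset> p (Suc i))}"

definition regular_local_ring :: "('a, 'b) ring_scheme \<Rightarrow> bool" where
  "regular_local_ring R \<longleftrightarrow>
     cring R \<and> noetherian_ring R \<and>
     (\<exists>M. maximalideal M R \<and> (\<forall>M'. maximalideal M' R \<longrightarrow> M' = M) \<and>
          (\<exists>S \<subseteq> carrier R. finite S \<and> M = Idl\<^bsub>R\<^esub> S \<and> enat (card S) = krull_dim R))"

definition regular_ring :: "('a, 'b) ring_scheme \<Rightarrow> bool" where
  "regular_ring R \<longleftrightarrow>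
     cring R \<and> noetherian_ring R \<and>
     (\<forall>p. primeideal p R \<longrightarrow> regular_local_ring (localization R (carrier R - p)))"


section \<open>Simple rings and simple modules\<close>

definition simple_ring :: "('a, 'b) ring_scheme \<Rightarrow> bool" where
  "simple_ring R \<longleftrightarrow>
     ring R \<and> carrier R \<noteq> {\<zero>\<^bsub>R\<^esub>} \<and>
     (\<forall>I. ideal I R \<longrightarrow> I = {\<zero>\<^bsub>R\<^esub>} \<or> I = carrier R)"

text \<open>
  The library locale \<^locale>\<open>module\<close> demands a commutative ring; \<^locale>\<open>submodule\<close> does not.
\<close>

locale left_module = R?: ring R + M?: abelian_group M
  for R :: "('a, 'c) ring_scheme" and M :: "('a, 'b, 'd) module_scheme" (structure) +
  assumes smult_closed:
      "\<lbrakk>a \<in> carrier R; x \<in> carrier M\<rbrakk> \<Longrightarrow> a \<odot>\<^bsub>M\<^esub> x \<in> carrier M"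
    and smult_l_distr:
      "\<lbrakk>a \<in> carrier R; b \<in> carrier R; x \<in> carrier M\<rbrakk> \<Longrightarrow>
       (a \<oplus>\<^bsub>R\<^esub> b) \<odot>\<^bsub>M\<^esub> x = a \<odot>\<^bsub>M\<^esub> x \<oplus>\<^bsub>M\<^esub> b \<odot>\<^bsub>M\<^esub> x"
    and smult_r_distr:
      "\<lbrakk>a \<in> carrier R; x \<in> carrier M; y \<in> carrier M\<rbrakk> \<Longrightarrow>
       a \<odot>\<^bsub>M\<^esub> (x \<oplus>\<^bsub>M\<^esub> y) = a \<odot>\<^bsub>M\<^esub> x \<oplus>\<^bsub>M\<^esub> a \<odot>\<^bsub>M\<^esub> y"
    and smult_assoc:
      "\<lbrakk>a \<in> carrier R; b \<in> carrier R; x \<in> carrier M\<rbrakk> \<Longrightarrow>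
       (a \<otimes>\<^bsub>R\<^esub> b) \<odot>\<^bsub>M\<^esub> x = a \<odot>\<^bsub>M\<^esub> (b \<odot>\<^bsub>M\<^esub> x)"
    and smult_one:
      "x \<in> carrier M \<Longrightarrow> \<one>\<^bsub>R\<^esub> \<odot>\<^bsub>M\<^esub> x = x"

definition simple_left_module ::
    "('a, 'c) ring_scheme \<Rightarrow> ('a, 'b, 'd) module_scheme \<Rightarrow> bool" where
  "simple_left_module R M \<longleftrightarrow>
     left_module R M \<and> carrier M \<noteq> {\<zero>\<^bsub>M\<^esub>} \<and>
     (\<forall>N. submodule N R M \<longrightarrow> N = {\<zero>\<^bsub>M\<^esub>} \<or> N = carrier M)"


section \<open>Linear endomorphisms and derivations\<close>

text \<open>
  A commutative algebra over a field is a ring \<open>A\<close> with the set \<open>K\<close> of its scalars,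
  a subfield of \<open>A\<close>. Endomorphisms are extensional functions on \<open>carrier A\<close>; a scalar
  \<open>c \<in> K\<close> acts on an endomorphism by composition with \<open>mult_op A c\<close>.
\<close>

definition End_alg :: "'a set \<Rightarrow> ('a, 'b) ring_scheme \<Rightarrow> ('a \<Rightarrow> 'a) ring" where
  "End_alg K A =
     \<lparr>carrier = {\<phi> \<in> carrier A \<rightarrow>\<^sub>E carrier A.
        (\<forall>a\<in>carrier A. \<forall>b\<in>carrier A. \<phi> (a \<oplus>\<^bsub>A\<^esub> b) = \<phi> a \<oplus>\<^bsub>A\<^esub> \<phi> b) \<and>
        (\<forall>c\<in>K. \<forall>a\<in>carrier A. \<phi> (c \<otimes>\<^bsub>A\<^esub> a) = c \<otimes>\<^bsub>A\<^esub> \<phi> a)},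
      monoid.mult = (\<lambda>\<phi> \<psi>. compose (carrier A) \<phi> \<psi>),
      one = (\<lambda>a\<in>carrier A. a),
      ring.zero = (\<lambda>a\<in>carrier A. \<zero>\<^bsub>A\<^esub>),
      add = (\<lambda>\<phi> \<psi>. \<lambda>a\<in>carrier A. \<phi> a \<oplus>\<^bsub>A\<^esub> \<psi> a)\<rparr>"

definition Der :: "'a set \<Rightarrow> ('a, 'b) ring_scheme \<Rightarrow> ('a \<Rightarrow> 'a) set" where
  "Der K A =
     {\<delta> \<in> carrier (End_alg K A). \<forall>a\<in>carrier A. \<forall>b\<in>carrier A.
        \<delta> (a \<otimes>\<^bsub>A\<^esub> b) = \<delta> a \<otimes>\<^bsub>A\<^esub> b \<oplus>\<^bsub>A\<^esub> a \<otimes>\<^bsub>A\<^esub> \<delta> b}"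

definition mult_op :: "('a, 'b) ring_scheme \<Rightarrow> 'a \<Rightarrow> 'a \<Rightarrow> 'a" where
  "mult_op A a = (\<lambda>b\<in>carrier A. a \<otimes>\<^bsub>A\<^esub> b)"

definition generated_subalgebra ::
    "'a set \<Rightarrow> ('a, 'b) ring_scheme \<Rightarrow> ('a \<Rightarrow> 'a) set \<Rightarrow> ('a \<Rightarrow> 'a) set" where
  "generated_subalgebra K A S =
     \<Inter>{B. subring B (End_alg K A) \<and>
           (\<forall>c\<in>K. \<forall>\<phi>\<in>B. mult_op A c \<otimes>\<^bsub>End_alg K A\<^esub> \<phi> \<in> B) \<and> S \<subseteq> B}"


section \<open>Matrices over a commutative ring\<close>

text \<open>
  The rank over a field \<open>F\<close> of the matrix with entries \<open>M i j\<close>, \<open>i < m\<close>, \<open>j < n\<close>: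
  the maximal number of linearly independent rows.
\<close>

definition matrix_rank ::
    "('a, 'b) ring_scheme \<Rightarrow> nat \<Rightarrow> nat \<Rightarrow> (nat \<Rightarrow> nat \<Rightarrow> 'a) \<Rightarrow> nat" where
  "matrix_rank F m n M =
     Max {card S | S. S \<subseteq> {..<m} \<and>
       (\<forall>c \<in> S \<rightarrow> carrier F.
          (\<forall>j<n. (\<Oplus>\<^bsub>F\<^esub>i\<in>S. c i \<otimes>\<^bsub>F\<^esub> M i j) = \<zero>\<^bsub>F\<^esub>) \<longrightarrow> (\<forall>i\<in>S. c i = \<zero>\<^bsub>F\<^esub>))}"

definition ring_det ::
    "('a, 'b) ring_scheme \<Rightarrow> nat \<Rightarrow> (nat \<Rightarrow> nat \<Rightarrow> 'a) \<Rightarrow> 'a" where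
  "ring_det R k M =
     (\<Oplus>\<^bsub>R\<^esub>\<sigma>\<in>{\<sigma>. \<sigma> permutes {..<k}}. add_pow R (sign \<sigma>) (\<Otimes>\<^bsub>R\<^esub>\<nu>\<in>{..<k}. M \<nu> (\<sigma> \<nu>)))"


section \<open>Polynomial rings\<close>

text \<open>
  A monomial maps each variable index to its exponent. The polynomial ring in \<open>n\<close>
  variables consists of the polynomials all of whose variables have index \<open>< n\<close>;
  rows, columns and variables are numbered from \<open>0\<close>.
\<close>

type_synonym 'k mpoly = "(nat \<Rightarrow>\<^sub>0 nat) \<Rightarrow>\<^sub>0 'k"

definition mpoly_ring :: "nat \<Rightarrow> 'k::comm_ring_1 mpoly ring" where
  "mpoly_ring n =
     \<lparr>carrier = {p. \<forall>t\<in>Poly_Mapping.keys p. Poly_Mapping.keys t \<subseteq> {..<n}},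
      monoid.mult = (*), one = 1, ring.zero = 0, add = (+)\<rparr>"

definition mpoly_const :: "'k::comm_ring_1 \<Rightarrow> 'k mpoly" where
  "mpoly_const c = Poly_Mapping.single 0 c"

definition mpoly_var :: "nat \<Rightarrow> 'k::comm_ring_1 mpoly" where
  "mpoly_var j = Poly_Mapping.single (Poly_Mapping.single j 1) 1"

definition pderiv_mpoly :: "nat \<Rightarrow> 'k::comm_ring_1 mpoly \<Rightarrow> 'k mpoly" where
  "pderiv_mpoly j p =
     (\<Sum>t\<in>Poly_Mapping.keys p.
        Poly_Mapping.single (t - Poly_Mapping.single j 1)
          (of_nat (Poly_Mapping.lookup t j) * Poly_Mapping.lookup p t))"


section \<open>Natural differential operators on an affine domain\<close>

definition rel_ideal :: "nat \<Rightarrow> nat \<Rightarrow> (nat \<Rightarrow> 'k::comm_ring_1 mpoly) \<Rightarrow> 'k mpoly set" where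
  "rel_ideal n m f = Idl\<^bsub>mpoly_ring n\<^esub> (f ` {..<m})"

definition coord_ring ::
    "nat \<Rightarrow> nat \<Rightarrow> (nat \<Rightarrow> 'k::comm_ring_1 mpoly) \<Rightarrow> 'k mpoly set ring" where
  "coord_ring n m f = mpoly_ring n Quot rel_ideal n m f"

definition image_in_A ::
    "nat \<Rightarrow> nat \<Rightarrow> (nat \<Rightarrow> 'k::comm_ring_1 mpoly) \<Rightarrow> 'k mpoly \<Rightarrow> 'k mpoly set" where
  "image_in_A n m f p = rel_ideal n m f +>\<^bsub>mpoly_ring n\<^esub> p"

definition scalars ::
    "nat \<Rightarrow> nat \<Rightarrow> (nat \<Rightarrow> 'k::comm_ring_1 mpoly) \<Rightarrow> 'k mpoly set set" where
  "scalars n m f = range (\<lambda>c. image_in_A n m f (mpoly_const c))"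

definition jacobi ::
    "nat \<Rightarrow> nat \<Rightarrow> (nat \<Rightarrow> 'k::comm_ring_1 mpoly) \<Rightarrow> nat \<Rightarrow> nat \<Rightarrow> 'k mpoly set" where
  "jacobi n m f i j = image_in_A n m f (pderiv_mpoly j (f i))"

definition jacobi_rank :: "nat \<Rightarrow> nat \<Rightarrow> (nat \<Rightarrow> 'k::comm_ring_1 mpoly) \<Rightarrow> nat" where
  "jacobi_rank n m f =
     matrix_rank (fraction_field (coord_ring n m f)) m n
       (\<lambda>i j. to_fraction_field (coord_ring n m f) (jacobi n m f i j))"

text \<open>
  \<open>jacobi_minor n m f ii jj\<close> is \<open>\<Delta>(ii; jj)\<close>; the index lists are not required to be
  increasing.
\<close>

definition jacobi_minor ::
    "nat \<Rightarrow> nat \<Rightarrow> (nat \<Rightarrow> 'k::comm_ring_1 mpoly) \<Rightarrow> nat list \<Rightarrow> nat list \<Rightarrow> 'k mpoly set" where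
  "jacobi_minor n m f ii jj =
     ring_det (coord_ring n m f) (length ii) (\<lambda>\<nu> \<mu>. jacobi n m f (ii ! \<nu>) (jj ! \<mu>))"

definition tuples :: "nat \<Rightarrow> nat \<Rightarrow> nat list set" where
  "tuples r n = {jj. length jj = r \<and> set jj \<subseteq> {..<n}}"

definition inc_tuples :: "nat \<Rightarrow> nat \<Rightarrow> nat list set" where
  "inc_tuples r n = {jj \<in> tuples r n. sorted_wrt (<) jj}"

definition nonsing_rows :: "nat \<Rightarrow> nat \<Rightarrow> (nat \<Rightarrow> 'k::comm_ring_1 mpoly) \<Rightarrow> nat list set" where
  "nonsing_rows n m f =
     {ii \<in> inc_tuples (jacobi_rank n m f) m.
        \<exists>jj \<in> tuples (jacobi_rank n m f) n.
          jacobi_minor n m f ii jj \<noteq> \<zero>\<^bsub>coord_ring n m f\<^esub>}"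

definition nonsing_cols :: "nat \<Rightarrow> nat \<Rightarrow> (nat \<Rightarrow> 'k::comm_ring_1 mpoly) \<Rightarrow> nat list set" where
  "nonsing_cols n m f =
     {jj \<in> inc_tuples (jacobi_rank n m f) n.
        \<exists>ii \<in> tuples (jacobi_rank n m f) m.
          jacobi_minor n m f ii jj \<noteq> \<zero>\<^bsub>coord_ring n m f\<^esub>}"

definition omit_nth :: "nat \<Rightarrow> 'a list \<Rightarrow> 'a list" where
  "omit_nth k xs = take k xs @ drop (Suc k) xs"

definition nonsing_cols_Suc ::
    "nat \<Rightarrow> nat \<Rightarrow> (nat \<Rightarrow> 'k::comm_ring_1 mpoly) \<Rightarrow> nat list set" where
  "nonsing_cols_Suc n m f =
     {jj \<in> inc_tuples (Suc (jacobi_rank n m f)) n.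
        \<exists>k < length jj. omit_nth k jj \<in> nonsing_cols n m f}"

text \<open>
  The entry called \<open>j\<^sub>k\<close>, \<open>1 \<le> k \<le> r + 1\<close>, in the mathematical notation is \<open>jj ! (k - 1)\<close>.
\<close>

definition natural_derivation ::
    "nat \<Rightarrow> nat \<Rightarrow> (nat \<Rightarrow> 'k::comm_ring_1 mpoly) \<Rightarrow> nat list \<Rightarrow> nat list \<Rightarrow>
     'k mpoly set \<Rightarrow> 'k mpoly set" where
  "natural_derivation n m f ii jj =
     (THE \<delta>. \<delta> \<in> Der (scalars n m f) (coord_ring n m f) \<and>
        (\<forall>k\<in>{1..jacobi_rank n m f + 1}.
           \<delta> (image_in_A n m f (mpoly_var (jj ! (k - 1)))) =
             add_pow (coord_ring n m f) ((-1 :: int) ^ (jacobi_rank n m f + 1 + k))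
               (jacobi_minor n m f ii (omit_nth (k - 1) jj))) \<and>
        (\<forall>l<n. l \<notin> set jj \<longrightarrow>
           \<delta> (image_in_A n m f (mpoly_var l)) = \<zero>\<^bsub>coord_ring n m f\<^esub>))"

definition natural_derivations ::
    "nat \<Rightarrow> nat \<Rightarrow> (nat \<Rightarrow> 'k::comm_ring_1 mpoly) \<Rightarrow> ('k mpoly set \<Rightarrow> 'k mpoly set) set" where
  "natural_derivations n m f =
     (let A = coord_ring n m f; E = End_alg (scalars n m f) A;
          T = nonsing_rows n m f \<times> nonsing_cols_Suc n m f
      in {(\<Oplus>\<^bsub>E\<^esub>x\<in>T. mult_op A (a x) \<otimes>\<^bsub>E\<^esub> natural_derivation n m f (fst x) (snd x)) | a.
            a \<in> T \<rightarrow> carrier A})"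

definition natural_diff_ops ::
    "nat \<Rightarrow> nat \<Rightarrow> (nat \<Rightarrow> 'k::comm_ring_1 mpoly) \<Rightarrow> ('k mpoly set \<Rightarrow> 'k mpoly set) ring" where
  "natural_diff_ops n m f =
     (let A = coord_ring n m f; K = scalars n m f
      in (End_alg K A)\<lparr>carrier := generated_subalgebra K A
            (mult_op A ` carrier A \<union> natural_derivations n m f)\<rparr>)"

definition coord_module ::
    "nat \<Rightarrow> nat \<Rightarrow> (nat \<Rightarrow> 'k::comm_ring_1 mpoly) \<Rightarrow>
     ('k mpoly set \<Rightarrow> 'k mpoly set, 'k mpoly set) module" where
  "coord_module n m f =
     (let A = coord_ring n m f
      in \<lparr>carrier = carrier A, monoid.mult = monoid.mult A, one = one A,
          ring.zero = ring.zero A, add = add A, smult = (\<lambda>\<phi> a. \<phi> a)\<rparr>)"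

end

theory Submission imports Defs "Jordan_Normal_Form.Determinant"
begin

text \<open>In characteristic zero the gradients of the elements of a prime \<open>P\<close> have rank modulo \<open>P\<close> equal to
  the codimension of \<open>P\<close>. Hence, for \<open>P \<supseteq> I\<close>, the localization of \<open>A\<close> at \<open>P\<close> is regular iff some
  \<open>r \<times> r\<close> minor of the Jacobi matrix lies outside \<open>P\<close>.

  Commutators with elements of \<open>A\<close> lower the order of an operator, so a nonzero two-sided ideal of \<open>\<DD>(A)\<close>
  meets \<open>A\<close>; therefore (2) and (3) both say that no proper nonzero ideal of \<open>A\<close> is stable under the
  natural derivations. The natural derivations have values in the ideal of maximal minors, which is thus
  stable: if there are no such ideals, it is \<open>A\<close>, and \<open>A\<close> is regular. Conversely, a proper nonzero
  stable ideal is contained in a stable prime \<open>Q \<supset> I\<close>, because the largest stable ideal inside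
  a prime is prime in characteristic zero. If some \<open>r \<times> r\<close> minor lay outside \<open>Q\<close>, then, the codimension of \<open>Q\<close> being larger
  than \<open>r\<close>, some \<open>p \<in> Q\<close> would have a gradient independent modulo \<open>Q\<close> of the \<open>r\<close> rows of that minor;
  the resulting \<open>(r + 1) \<times> (r + 1)\<close> minor is the value at \<open>p\<close> of a natural derivation, so it would lie
  both inside and outside \<open>Q\<close>.\<close>

section \<open>Polynomials\<close>

text \<open>The obstacle is the Krull dimension of a localization, a supremum over chains of primes
  on which the codimension gives only an upper bound: \<open>codim n P\<close> is \<open>n\<close>
  minus the largest number of variables algebraically independent modulo P, and it grows strictly
  along inclusions, so chains between I and P have length at most \<open>codim n P - r\<close>. From
  regularity to a minor this bound is enough, because few generators of the maximal ideal already
  force r rows of the Jacobi matrix to be independent modulo P. From a minor to regularity a lower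
  bound is required as well; there the minor supplies derivations that separate a system of
  parameters one by one, and primes stable under them form a chain of the right length. As K may
  fail to be algebraically closed, ranks are taken over the fraction field of the polynomials modulo
  P and not at points; denominators are cleared, so that every statement is one about membership in
  P. In characteristic zero a positive integer lies in no proper ideal: hence minimal equations have
  derivatives outside P, and binomial coefficients can be cancelled modulo P.\<close>

lemma mpoly_sum_single:
  fixes p :: "'a \<Rightarrow>\<^sub>0 'b::comm_monoid_add"
  shows "p = (\<Sum>t\<in>Poly_Mapping.keys p. Poly_Mapping.single t (Poly_Mapping.lookup p t))"
proof (rule poly_mapping_eqI)
  fix k
  show "Poly_Mapping.lookup p k = Poly_Mapping.lookup (\<Sum>t\<in>Poly_Mapping.keys p. Poly_Mapping.single t (Poly_Mapping.lookup p t)) k"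
    by (cases "k \<in> Poly_Mapping.keys p")
      (auto simp: lookup_sum lookup_single when_def in_keys_iff sum.delta' intro!: sum.neutral)
qed

lemma mpoly_induct [case_names single add]:
  fixes p :: "'a \<Rightarrow>\<^sub>0 'b::comm_monoid_add"
  assumes "\<And>t c. Q (Poly_Mapping.single t c)" and "\<And>p q. Q p \<Longrightarrow> Q q \<Longrightarrow> Q (p + q)"
  shows "Q p"
proof -
  have "Q (\<Sum>t\<in>T. Poly_Mapping.single t (Poly_Mapping.lookup p t))" if "finite T" for T
    using that
  proof (induction T)
    case empty
    then show ?case using assms(1)[of undefined 0] by simp
  next
    case (insert x T)
    then show ?case by (simp add: assms)
  qed
  then show ?thesis using mpoly_sum_single[of p] finite_keys by metis
qed

lemma keys_add_nat: "Poly_Mapping.keys (s + t :: nat \<Rightarrow>\<^sub>0 nat) = Poly_Mapping.keys s \<union> Poly_Mapping.keys t"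
  by (auto simp: in_keys_iff lookup_add)

text \<open>Partial derivatives and the retraction \<open>retr\<close> are both given monomial by
  monomial; this common form yields their additivity and their values on monomials at once.\<close>

definition monom_extend :: "('a \<Rightarrow> 'b \<Rightarrow> 'c::comm_monoid_add) \<Rightarrow> ('a \<Rightarrow>\<^sub>0 'b::comm_monoid_add) \<Rightarrow> 'c" where
  "monom_extend g p = (\<Sum>t\<in>Poly_Mapping.keys p. g t (Poly_Mapping.lookup p t))"

lemma monom_extend_superset:
  assumes "\<And>t. g t 0 = 0" "finite T" "Poly_Mapping.keys p \<subseteq> T"
  shows "monom_extend g p = (\<Sum>t\<in>T. g t (Poly_Mapping.lookup p t))"
  unfolding monom_extend_def
  by (rule sum.mono_neutral_left) (use assms in \<open>auto simp: in_keys_iff\<close>)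

lemma monom_extend_add:
  assumes "\<And>t. g t 0 = 0" "\<And>t a b. g t (a + b) = g t a + g t b"
  shows "monom_extend g (p + q) = monom_extend g p + monom_extend g q"
proof -
  let ?T = "Poly_Mapping.keys p \<union> Poly_Mapping.keys q"
  have "monom_extend g (p + q) = (\<Sum>t\<in>?T. g t (Poly_Mapping.lookup (p + q) t))"
    by (rule monom_extend_superset) (use assms Poly_Mapping.keys_add[of p q] in auto)
  also have "\<dots> = (\<Sum>t\<in>?T. g t (Poly_Mapping.lookup p t)) + (\<Sum>t\<in>?T. g t (Poly_Mapping.lookup q t))"
    by (simp add: lookup_add assms sum.distrib)
  also have "(\<Sum>t\<in>?T. g t (Poly_Mapping.lookup p t)) = monom_extend g p"
    by (rule monom_extend_superset[symmetric]) (use assms in auto)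
  also have "(\<Sum>t\<in>?T. g t (Poly_Mapping.lookup q t)) = monom_extend g q"
    by (rule monom_extend_superset[symmetric]) (use assms in auto)
  finally show ?thesis .
qed

lemma monom_extend_single:
  assumes "\<And>t. g t 0 = 0"
  shows "monom_extend g (Poly_Mapping.single t c) = g t c"
  by (cases "c = 0") (auto simp: monom_extend_def assms)

section \<open>Partial derivatives as derivations\<close>

lemma pderiv_mpoly_eq: "pderiv_mpoly j =
   monom_extend (\<lambda>t c. Poly_Mapping.single (t - Poly_Mapping.single j 1) (of_nat (Poly_Mapping.lookup t j) * c))"
  by (simp add: fun_eq_iff pderiv_mpoly_def monom_extend_def)

lemma pd_add: "pderiv_mpoly j (p + q) = pderiv_mpoly j p + pderiv_mpoly j q"
  unfolding pderiv_mpoly_eq by (rule monom_extend_add) (auto simp: single_add algebra_simps)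

lemma pd_single: "pderiv_mpoly j (Poly_Mapping.single t c) =
    Poly_Mapping.single (t - Poly_Mapping.single j 1) (of_nat (Poly_Mapping.lookup t j) * c)"
  unfolding pderiv_mpoly_eq by (rule monom_extend_single) auto

lemma pd_mult: "pderiv_mpoly j (p * q) = pderiv_mpoly j p * q + p * pderiv_mpoly j q"
proof (induction p rule: mpoly_induct)
  case (single s a)
  show ?case
  proof (induction q rule: mpoly_induct)
    case (single t b)
    \<comment> \<open>Exponents are subtracted with truncation at 0, so each identity asks for a
      nonzero exponent at \<open>j\<close>; when that exponent is 0, the corresponding term carries
      the factor 0.\<close>
    have 1: "s - Poly_Mapping.single j 1 + t = s + t - Poly_Mapping.single j 1" if "Poly_Mapping.lookup s j \<noteq> 0"
      by (rule poly_mapping_eqI) (use that in \<open>auto simp: lookup_add lookup_minus lookup_single when_def\<close>)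
    have 2: "s + (t - Poly_Mapping.single j 1) = s + t - Poly_Mapping.single j 1" if "Poly_Mapping.lookup t j \<noteq> 0"
      by (rule poly_mapping_eqI) (use that in \<open>auto simp: lookup_add lookup_minus lookup_single when_def\<close>)
    show ?case
      using 1 2
      by (cases "Poly_Mapping.lookup s j = 0"; cases "Poly_Mapping.lookup t j = 0")
        (auto simp: mult_single pd_single lookup_add single_add algebra_simps)
  next
    case (add p q)
    then show ?case by (simp add: algebra_simps pd_add)
  qed
next
  case (add p q)
  then show ?case by (simp add: algebra_simps pd_add)
qed

lemma pd_const [simp]: "pderiv_mpoly j (mpoly_const c) = 0"
  by (simp add: mpoly_const_def pd_single)

lemma pd_var: "pderiv_mpoly j (mpoly_var l) = (if l = j then 1 else 0)"
  by (auto simp: mpoly_var_def pd_single lookup_single when_def)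

lemma mpoly_const_0 [simp]: "mpoly_const 0 = 0" by (simp add: mpoly_const_def)
lemma mpoly_const_1 [simp]: "mpoly_const 1 = 1" by (simp add: mpoly_const_def)
lemma mpoly_const_mult: "mpoly_const (a * b) = mpoly_const a * mpoly_const b"
  by (simp add: mpoly_const_def mult_single)
lemma mpoly_const_uminus: "mpoly_const (- a) = - mpoly_const a"
  by (simp add: mpoly_const_def single_uminus)
lemma mpoly_const_of_nat: "mpoly_const (of_nat k) = of_nat k"
  by (simp add: mpoly_const_def)

text \<open>An arbitrary set of variables is allowed because the variables outside a transcendence
  basis are adjoined one at a time, and the inductions compare polynomials in successive
  sets.\<close>

definition polys_in :: "nat set \<Rightarrow> 'k::comm_ring_1 mpoly set" where
  "polys_in U = {p. \<forall>t\<in>Poly_Mapping.keys p. Poly_Mapping.keys t \<subseteq> U}"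

lemma carrier_mpoly_ring: "carrier (mpoly_ring n) = polys_in {..<n}"
  by (simp add: mpoly_ring_def polys_in_def)

lemma polys_in_zero [simp]: "0 \<in> polys_in U"
  by (simp add: polys_in_def)

lemma polys_in_const [simp]: "mpoly_const c \<in> polys_in U"
  by (auto simp: polys_in_def mpoly_const_def split: if_splits)

lemma polys_in_one [simp]: "1 \<in> polys_in U"
  using polys_in_const[of 1] by simp

lemma polys_in_single: "Poly_Mapping.keys t \<subseteq> U \<Longrightarrow> Poly_Mapping.single t c \<in> polys_in U"
  by (auto simp: polys_in_def split: if_splits)

lemma polys_in_var: "k \<in> U \<Longrightarrow> mpoly_var k \<in> polys_in U"
  unfolding mpoly_var_def by (rule polys_in_single) simp

lemma polys_in_add: "p \<in> polys_in U \<Longrightarrow> q \<in> polys_in U \<Longrightarrow> p + q \<in> polys_in U"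
  using Poly_Mapping.keys_add[of p q] by (auto simp: polys_in_def)

lemma polys_in_mult:
  assumes "p \<in> polys_in U" "q \<in> polys_in U" shows "p * q \<in> polys_in U"
  unfolding polys_in_def
proof (intro CollectI ballI)
  fix t assume "t \<in> Poly_Mapping.keys (p * q)"
  then obtain a b where "t = a + b" "a \<in> Poly_Mapping.keys p" "b \<in> Poly_Mapping.keys q"
    using keys_mult[of p q] by auto
  then show "Poly_Mapping.keys t \<subseteq> U" using assms by (auto simp: keys_add_nat polys_in_def)
qed

lemma polys_in_uminus: "p \<in> polys_in U \<Longrightarrow> - p \<in> polys_in U"
  using polys_in_mult[OF polys_in_const[of "-1"], of p U] by (simp add: mpoly_const_uminus)

lemma polys_in_diff: "p \<in> polys_in U \<Longrightarrow> q \<in> polys_in U \<Longrightarrow> p - q \<in> polys_in U"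
  using polys_in_add[of p U "- q"] polys_in_uminus[of q U] by simp

lemma polys_in_mono: "U \<subseteq> V \<Longrightarrow> polys_in U \<subseteq> polys_in V"
  by (auto simp: polys_in_def)

lemma polys_in_sum: "(\<And>i. i \<in> T \<Longrightarrow> p i \<in> polys_in U) \<Longrightarrow> sum p T \<in> polys_in U"
  by (induction T rule: infinite_finite_induct) (auto intro: polys_in_add)

lemma polys_in_empty: "p \<in> polys_in {} \<Longrightarrow> \<exists>c. p = mpoly_const c"
proof -
  assume a: "p \<in> polys_in {}"
  then have "Poly_Mapping.keys p \<subseteq> {0}"
    by (auto simp: polys_in_def)
  then have "p = Poly_Mapping.single 0 (Poly_Mapping.lookup p 0)"
    by (intro poly_mapping_eqI) (auto simp: lookup_single when_def in_keys_iff)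
  then show ?thesis unfolding mpoly_const_def by blast
qed

lemma mpoly_var_power: "mpoly_var k ^ e = Poly_Mapping.single (Poly_Mapping.single k e) 1"
  by (induction e) (auto simp: mpoly_var_def mult_single simp flip: single_add)

text \<open>Polynomials over a subset of a ring stay polynomials over the whole ring with restricted
  coefficients, so that the theory of univariate polynomials applies as it stands.\<close>

definition polys_over :: "'a::zero set \<Rightarrow> 'a poly set" where
  "polys_over B = {q. \<forall>i. coeff q i \<in> B}"

text \<open>Splitting off the power of the variable \<open>k\<close> from each monomial reads a
  polynomial as a univariate one in that variable. This turns statements about many variables into
  inductions that adjoin one variable at each stage.\<close>

lemma polys_in_insert_eq_poly:
  assumes "p \<in> polys_in (insert k U)"
  shows "\<exists>q \<in> polys_over (polys_in U). p = poly q (mpoly_var k)"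
proof -
  have *: "\<exists>q \<in> polys_over (polys_in U). Poly_Mapping.single t c = poly q (mpoly_var k)"
    if "Poly_Mapping.keys t \<subseteq> insert k U" for t and c :: 'a
  proof -
    define s where "s = t - Poly_Mapping.single k (Poly_Mapping.lookup t k)"
    have ks: "Poly_Mapping.keys s \<subseteq> U"
      using that by (auto simp: s_def in_keys_iff lookup_minus lookup_single when_def subset_eq split: if_splits)
    have ts: "t = s + Poly_Mapping.single k (Poly_Mapping.lookup t k)"
      by (rule poly_mapping_eqI) (auto simp: s_def lookup_add lookup_minus lookup_single when_def)
    have "Poly_Mapping.single t c = poly (monom (Poly_Mapping.single s c) (Poly_Mapping.lookup t k)) (mpoly_var k)"
      by (subst ts) (simp add: poly_monom mpoly_var_power mult_single)
    moreover have "monom (Poly_Mapping.single s c) (Poly_Mapping.lookup t k) \<in> polys_over (polys_in U)"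
      using polys_in_single[OF ks, of c] by (auto simp: polys_over_def)
    ultimately show ?thesis by blast
  qed
  have "\<exists>q \<in> polys_over (polys_in U). (\<Sum>t\<in>T. Poly_Mapping.single t (Poly_Mapping.lookup p t)) = poly q (mpoly_var k)"
    if "finite T" "T \<subseteq> Poly_Mapping.keys p" for T
    using that
  proof (induction T)
    case empty
    show ?case by (rule bexI[of _ 0]) (auto simp: polys_over_def)
  next
    case (insert x T)
    obtain q where q: "q \<in> polys_over (polys_in U)"
      "(\<Sum>t\<in>T. Poly_Mapping.single t (Poly_Mapping.lookup p t)) = poly q (mpoly_var k)"
      using insert by auto
    obtain q' where q': "q' \<in> polys_over (polys_in U)"
      "Poly_Mapping.single x (Poly_Mapping.lookup p x) = poly q' (mpoly_var k)"
      using *[of x "Poly_Mapping.lookup p x"] insert assms by (auto simp: polys_in_def)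
    show ?case
      by (rule bexI[of _ "q' + q"]) (use q q' insert in \<open>auto simp: polys_over_def polys_in_add\<close>)
  qed
  from this[OF finite_keys subset_refl] show ?thesis using mpoly_sum_single[of p] by metis
qed

lemma poly_in_subring:
  assumes "0 \<in> B" "\<And>x y. x \<in> B \<Longrightarrow> y \<in> B \<Longrightarrow> x + y \<in> B" "\<And>x y. x \<in> B \<Longrightarrow> y \<in> B \<Longrightarrow> x * y \<in> B"
    and "q \<in> polys_over B" "x \<in> B"
  shows "poly q x \<in> B"
  using assms(4)
proof (induction q)
  case 0
  then show ?case using assms by simp
next
  case (pCons a q)
  have "a \<in> B" using pCons(3)  by (auto simp: polys_over_def dest: spec[of _ 0])
  moreover have "q \<in> polys_over B"
    using pCons(3) by (auto simp: polys_over_def dest: spec[of _ "Suc _"])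
  ultimately show ?case using pCons assms by auto
qed

lemma polys_over_mono: "A \<subseteq> B \<Longrightarrow> polys_over A \<subseteq> polys_over B"
  by (auto simp: polys_over_def)

lemma poly_var_in_polys_in:
  assumes "q \<in> polys_over (polys_in U)"
  shows "poly q (mpoly_var k) \<in> polys_in (insert k U)"
proof (rule poly_in_subring)
  show "q \<in> polys_over (polys_in (insert k U))"
    using assms polys_over_mono[OF polys_in_mono[of U "insert k U"]] by auto
qed (auto intro: polys_in_add polys_in_mult polys_in_var)

text \<open>An induction on the set of variables: the polynomials with the property are closed under
  sums and products and contain the new variable and, by induction, the coefficients. It serves to
  show that a derivation of A is determined by its values on the variables.\<close>

lemma polys_in_induct [consumes 2, case_names const var add mult]:
  fixes p :: "'k::comm_ring_1 mpoly"
  assumes "p \<in> polys_in U" "finite U" "\<And>c. Q (mpoly_const c)" "\<And>k. k \<in> U \<Longrightarrow> Q (mpoly_var k)"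
    "\<And>p q. Q p \<Longrightarrow> Q q \<Longrightarrow> p \<in> polys_in U \<Longrightarrow> q \<in> polys_in U \<Longrightarrow> Q (p + q)"
    "\<And>p q. Q p \<Longrightarrow> Q q \<Longrightarrow> p \<in> polys_in U \<Longrightarrow> q \<in> polys_in U \<Longrightarrow> Q (p * q)"
  shows "Q p"
proof -
  have "\<forall>p \<in> polys_in V. Q p" if "V \<subseteq> U" for V
    using finite_subset[OF that assms(2)] that
  proof (induction V)
    case empty
    then show ?case using polys_in_empty assms(3) by blast
  next
    case (insert k V)
    show ?case
    proof
      fix p :: "'k mpoly" assume "p \<in> polys_in (insert k V)"
      then obtain q where q: "q \<in> polys_over (polys_in V)" "p = poly q (mpoly_var k)"
        using polys_in_insert_eq_poly by blast
      have kU: "k \<in> U" "V \<subseteq> U" using insert by auto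
      let ?B = "{p \<in> polys_in U. Q p}"
      have "poly q (mpoly_var k) \<in> ?B"
      proof (rule poly_in_subring)
        show "q \<in> polys_over ?B"
          using q(1) insert polys_in_mono[OF kU(2)] by (auto simp: polys_over_def)
        show "0 \<in> ?B" using assms(3)[of 0] by simp
      qed (use assms kU in \<open>auto intro: polys_in_add polys_in_mult polys_in_var\<close>)
      then show "Q p" using q by auto
    qed
  qed
  then show ?thesis using assms(1) by auto
qed

lemma pd_polys_in_eq_0:
  assumes "p \<in> polys_in U" "j \<notin> U"
  shows "pderiv_mpoly j p = 0"
proof -
  have "Poly_Mapping.lookup t j = 0" if "t \<in> Poly_Mapping.keys p" for t
    using that assms unfolding polys_in_def by (metis (mono_tags, lifting) in_keys_iff mem_Collect_eq subsetD)
  then show ?thesis unfolding pderiv_mpoly_def by (intro sum.neutral) simp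
qed

lemma pd_zero [simp]: "pderiv_mpoly j 0 = 0" using pd_const[of j 0] by simp
lemma pd_one [simp]: "pderiv_mpoly j 1 = 0" using pd_const[of j 1] by simp

lemma pd_sum: "pderiv_mpoly j (sum p T) = (\<Sum>i\<in>T. pderiv_mpoly j (p i))"
  by (induction T rule: infinite_finite_induct) (auto simp: pd_add)

lemma pd_uminus: "pderiv_mpoly j (- p) = - pderiv_mpoly j p"
  using pd_add[of j p "- p"] by (simp add: eq_neg_iff_add_eq_0 add.commute)

lemma pd_diff: "pderiv_mpoly j (p - q) = pderiv_mpoly j p - pderiv_mpoly j q"
  using pd_add[of j p "- q"] by (simp add: pd_uminus)

lemma pd_poly_var:
  fixes q :: "'k::field_char_0 mpoly poly"
  assumes "q \<in> polys_over (polys_in U)" "k \<notin> U"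
  shows "pderiv_mpoly k (poly q (mpoly_var k)) = poly (pderiv q) (mpoly_var k)"
  using assms(1)
proof (induction q)
  case (pCons a q)
  have "a \<in> polys_in U" using pCons(3)  by (auto simp: polys_over_def dest: spec[of _ 0])
  moreover have "q \<in> polys_over (polys_in U)"
    using pCons(3) by (auto simp: polys_over_def dest: spec[of _ "Suc _"])
  ultimately show ?case using pCons assms(2)
    by (simp add: pd_add pd_mult pd_var pd_polys_in_eq_0 pderiv_pCons)
qed simp

text \<open>The retraction onto the polynomials in the first \<open>n\<close> variables, with kernel generated by the
  other variables. Ideals of the polynomial ring in \<open>n\<close> variables correspond to ideals of the whole
  type that contain this kernel; working with the latter avoids carrier conditions.\<close>

definition retr :: "nat \<Rightarrow> 'k::comm_ring_1 mpoly \<Rightarrow> 'k mpoly" where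
  "retr n = monom_extend (\<lambda>t c. if Poly_Mapping.keys t \<subseteq> {..<n} then Poly_Mapping.single t c else 0)"

lemma retr_add: "retr n (p + q) = retr n p + retr n q"
  unfolding retr_def by (rule monom_extend_add) (auto simp: single_add)

lemma retr_single: "retr n (Poly_Mapping.single t c) =
   (if Poly_Mapping.keys t \<subseteq> {..<n} then Poly_Mapping.single t c else 0)"
  unfolding retr_def by (rule monom_extend_single) auto

lemma retr_mult: "retr n (p * q) = retr n p * retr n q"
proof (induction p rule: mpoly_induct)
  case (single s a)
  show ?case
  proof (induction q rule: mpoly_induct)
    case (single t b)
    show ?case by (simp add: mult_single retr_single keys_add_nat)
  next
    case (add p q)
    then show ?case by (simp add: algebra_simps retr_add)
  qed
next
  case (add p q)
  then show ?case by (simp add: algebra_simps retr_add)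
qed

lemma retr_in: "retr n p \<in> polys_in {..<n}"
  unfolding retr_def monom_extend_def by (intro polys_in_sum) (auto intro: polys_in_single)

lemma retr_id: "p \<in> polys_in {..<n} \<Longrightarrow> retr n p = p"
  by (subst (2) mpoly_sum_single) (auto simp: retr_def monom_extend_def polys_in_def intro!: sum.cong)

lemma retr_pd: "l < n \<Longrightarrow> retr n (pderiv_mpoly l p) = pderiv_mpoly l (retr n p)"
proof (induction p rule: mpoly_induct)
  case (single t c)
  have "Poly_Mapping.keys t \<subseteq> insert l (Poly_Mapping.keys (t - Poly_Mapping.single l 1))"
    "Poly_Mapping.keys (t - Poly_Mapping.single l 1) \<subseteq> Poly_Mapping.keys t"
    by (auto simp: in_keys_iff lookup_minus lookup_single when_def split: if_splits)
  then have "Poly_Mapping.keys (t - Poly_Mapping.single l 1) \<subseteq> {..<n} \<longleftrightarrow> Poly_Mapping.keys t \<subseteq> {..<n}"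
    using single by auto
  then show ?case by (simp add: retr_single pd_single)
next
  case (add p q)
  then show ?case by (simp add: retr_add pd_add)
qed

lemma retr_zero [simp]: "retr n 0 = 0" and retr_one [simp]: "retr n 1 = 1"
  and retr_const [simp]: "retr n (mpoly_const c) = mpoly_const c"
  by (simp_all add: retr_id)

lemma retr_uminus: "retr n (- p) = - retr n p"
  using retr_add[of n p "- p"] by (simp add: eq_neg_iff_add_eq_0 add.commute)

lemma retr_diff: "retr n (p - q) = retr n p - retr n q"
  using retr_add[of n p "- q"] by (simp add: retr_uminus)

lemma retr_sum: "retr n (sum p T) = (\<Sum>i\<in>T. retr n (p i))"
  by (induction T rule: infinite_finite_induct) (auto simp: retr_add)

lemma retr_retr [simp]: "retr n (retr n p) = retr n p"
  by (simp add: retr_id retr_in)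

section \<open>Ideals of a commutative ring type\<close>

definition is_ideal :: "'a::comm_ring_1 set \<Rightarrow> bool" where
  "is_ideal J \<longleftrightarrow> 0 \<in> J \<and> (\<forall>x\<in>J. \<forall>y\<in>J. x + y \<in> J) \<and> (\<forall>a. \<forall>x\<in>J. a * x \<in> J)"

definition is_prime :: "'a::comm_ring_1 set \<Rightarrow> bool" where
  "is_prime P \<longleftrightarrow> is_ideal P \<and> 1 \<notin> P \<and> (\<forall>x y. x * y \<in> P \<longrightarrow> x \<in> P \<or> y \<in> P)"

lemma is_prime_is_ideal: "is_prime P \<Longrightarrow> is_ideal P"
  by (simp add: is_prime_def)

lemma ideal_0: "is_ideal J \<Longrightarrow> 0 \<in> J"
  and ideal_add: "is_ideal J \<Longrightarrow> x \<in> J \<Longrightarrow> y \<in> J \<Longrightarrow> x + y \<in> J"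
  and ideal_mult: "is_ideal J \<Longrightarrow> x \<in> J \<Longrightarrow> a * x \<in> J"
  by (auto simp: is_ideal_def)

lemma ideal_mult2: "is_ideal J \<Longrightarrow> x \<in> J \<Longrightarrow> x * a \<in> J"
  using ideal_mult[of J x a] by (simp add: mult.commute)

lemma ideal_uminus: "is_ideal J \<Longrightarrow> x \<in> J \<Longrightarrow> - x \<in> J"
  using ideal_mult[of J x "-1"] by simp

lemma ideal_diff: "is_ideal J \<Longrightarrow> x \<in> J \<Longrightarrow> y \<in> J \<Longrightarrow> x - y \<in> J"
  using ideal_add[of J x "- y"] ideal_uminus[of J y] by simp

lemma ideal_sum: "is_ideal J \<Longrightarrow> (\<And>i. i \<in> S \<Longrightarrow> f i \<in> J) \<Longrightarrow> sum f S \<in> J"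
  by (induction S rule: infinite_finite_induct) (auto intro: ideal_0 ideal_add)

lemma ideal_cong: "is_ideal J \<Longrightarrow> x - y \<in> J \<Longrightarrow> x \<in> J \<longleftrightarrow> y \<in> J"
  using ideal_add[of J "x - y" y] ideal_diff[of J x "x - y"] by auto

lemma prime_mult: "is_prime P \<Longrightarrow> x * y \<in> P \<longleftrightarrow> x \<in> P \<or> y \<in> P"
  by (auto simp: is_prime_def intro: ideal_mult ideal_mult2)

lemma prime_1: "is_prime P \<Longrightarrow> 1 \<notin> P"
  by (simp add: is_prime_def)

lemma prime_power: "is_prime P \<Longrightarrow> x ^ k \<in> P \<Longrightarrow> x \<in> P"
  by (induction k) (auto simp: prime_mult prime_1)

lemma prime_prod: "is_prime P \<Longrightarrow> finite S \<Longrightarrow> (\<Prod>i\<in>S. f i) \<in> P \<longleftrightarrow> (\<exists>i\<in>S. f i \<in> P)"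
  by (rotate_tac, induction S rule: finite_induct) (auto simp: prime_mult prime_1)

text \<open>The constant \<open>1 / of_nat k\<close> is an inverse, so a prime containing
  \<open>of_nat k\<close> would contain 1.\<close>

lemma prime_of_nat:
  fixes P :: "'k::field_char_0 mpoly set"
  assumes "is_prime P" "k > 0"
  shows "of_nat k \<notin> P"
proof
  assume "of_nat k \<in> P"
  then have "mpoly_const (1 / of_nat k) * of_nat k \<in> P"
    using assms is_prime_is_ideal ideal_mult by blast
  moreover have "mpoly_const (1 / of_nat k :: 'k) * of_nat k = 1"
    using assms(2) by (simp flip: mpoly_const_of_nat mpoly_const_mult)
  ultimately show False using prime_1 assms(1) by auto
qed

section \<open>Linear algebra modulo a prime ideal\<close>

text \<open>Linear independence of \<open>v 0, \<dots>, v (k - 1)\<close> over the field of fractions of the ring modulo \<open>P\<close>,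
  where only the coordinates in \<open>J\<close> are considered; denominators are cleared throughout.\<close>

definition indep_mod :: "'a::comm_ring_1 set \<Rightarrow> nat set \<Rightarrow> nat \<Rightarrow> (nat \<Rightarrow> nat \<Rightarrow> 'a) \<Rightarrow> bool" where
  "indep_mod P J k v \<longleftrightarrow> (\<forall>a. (\<forall>l\<in>J. (\<Sum>i<k. a i * v i l) \<in> P) \<longrightarrow> (\<forall>i<k. a i \<in> P))"

definition in_span_mod :: "'a::comm_ring_1 set \<Rightarrow> nat set \<Rightarrow> nat \<Rightarrow> (nat \<Rightarrow> nat \<Rightarrow> 'a) \<Rightarrow> (nat \<Rightarrow> 'a) \<Rightarrow> bool" where
  "in_span_mod P J k v u \<longleftrightarrow> (\<exists>c b. c \<notin> P \<and> (\<forall>l\<in>J. c * u l - (\<Sum>i<k. b i * v i l) \<in> P))"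

text \<open>Gaussian elimination, one equation at a time: over a field, fewer equations than
  unknowns leave a nontrivial solution. Divisions are replaced by multiplications with pivots
  outside P.\<close>

lemma homogeneous_system_solvable_mod:
  fixes v :: "'i \<Rightarrow> 'j \<Rightarrow> 'a::comm_ring_1"
  assumes P: "is_prime P"
  shows "finite J \<Longrightarrow> finite S \<Longrightarrow> card J < card S \<Longrightarrow>
    \<exists>a. (\<forall>l\<in>J. (\<Sum>i\<in>S. a i * v i l) \<in> P) \<and> (\<exists>i\<in>S. a i \<notin> P)"
proof (induction J arbitrary: S v rule: finite_induct)
  case empty
  then obtain s where "s \<in> S" by fastforce
  then show ?case using prime_1[OF P] by (intro exI[of _ "\<lambda>_. 1"]) auto
next
  case (insert l J)
  note id = is_prime_is_ideal[OF P]
  show ?case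
  proof (cases "\<forall>i\<in>S. v i l \<in> P")
    case True
    obtain a where a: "\<forall>l\<in>J. (\<Sum>i\<in>S. a i * v i l) \<in> P" "\<exists>i\<in>S. a i \<notin> P"
      using insert.IH[of S v] insert by fastforce
    have "(\<Sum>i\<in>S. a i * v i l) \<in> P"
      by (rule ideal_sum[OF id]) (use True in \<open>auto intro: ideal_mult[OF id]\<close>)
    then show ?thesis using a by auto
  next
    case False
    then obtain s where s: "s \<in> S" "v s l \<notin> P" by auto
    define S' where "S' = S - {s}"
    \<comment> \<open>A multiple of the pivot vector \<open>v s\<close> is subtracted from each
      scaled vector so that the \<open>l\<close>-th coordinate vanishes identically.\<close>
    define v' where "v' = (\<lambda>i j. v s l * v i j - v i l * v s j)"
    have S': "finite S'" "card J < card S'" "s \<notin> S'" "S = insert s S'"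
      using insert s by (auto simp: S'_def)
    obtain a' where a': "\<forall>l\<in>J. (\<Sum>i\<in>S'. a' i * v' i l) \<in> P" "\<exists>i\<in>S'. a' i \<notin> P"
      using insert.IH[of S' v'] S' by auto
    \<comment> \<open>The solution of the reduced system is scaled by the pivot, and the coefficient
      of \<open>s\<close> is the one that cancels the \<open>l\<close>-th equation.\<close>
    define a where "a = (\<lambda>i. if i = s then - (\<Sum>i\<in>S'. a' i * v i l) else v s l * a' i)"
    have sum_a: "(\<Sum>i\<in>S. a i * v i j) = (\<Sum>i\<in>S'. a' i * v' i j)" for j
    proof -
      have "(\<Sum>i\<in>S. a i * v i j) = a s * v s j + (\<Sum>i\<in>S'. a i * v i j)"
        using S' by simp
      also have "(\<Sum>i\<in>S'. a i * v i j) = (\<Sum>i\<in>S'. v s l * a' i * v i j)"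
        by (rule sum.cong) (use S' in \<open>auto simp: a_def\<close>)
      also have "a s * v s j = (\<Sum>i\<in>S'. - (a' i * v i l * v s j))"
        by (simp add: a_def sum_distrib_right sum_negf)
      also have "\<dots> + (\<Sum>i\<in>S'. v s l * a' i * v i j) = (\<Sum>i\<in>S'. a' i * v' i j)"
        by (simp add: v'_def algebra_simps flip: sum.distrib)
      finally show ?thesis .
    qed
    have "v' i l = 0" for i by (simp add: v'_def)
    then have "\<forall>j\<in>insert l J. (\<Sum>i\<in>S. a i * v i j) \<in> P"
      unfolding sum_a using a' ideal_0[OF id] by auto
    moreover obtain i where "i \<in> S'" "a' i \<notin> P" using a' by auto
    then have "a i \<notin> P" "i \<in> S" using s S' by (auto simp: a_def prime_mult[OF P])
    ultimately show ?thesis by blast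
  qed
qed

text \<open>If \<open>k\<close> exceeded the number of spanning vectors, the rows of the coefficient
  matrix \<open>b\<close> would satisfy a nontrivial relation \<open>a\<close>, and the products
  \<open>a i * c i\<close> would be a relation between the \<open>v i\<close>, nontrivial because no
  \<open>c i\<close> lies in P.\<close>

lemma indep_mod_le_card_of_spanned:
  fixes w :: "'i \<Rightarrow> nat \<Rightarrow> 'a::comm_ring_1"
  assumes P: "is_prime P" and ind: "indep_mod P J k v" and fin: "finite N"
    and sp: "\<And>i. i < k \<Longrightarrow> \<exists>c b. c \<notin> P \<and> (\<forall>l\<in>J. c * v i l - (\<Sum>x\<in>N. b x * w x l) \<in> P)"
  shows "k \<le> card N"
proof (rule ccontr)
  assume "\<not> k \<le> card N"
  note id = is_prime_is_ideal[OF P]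
  obtain c b where cb: "\<And>i. i < k \<Longrightarrow> c i \<notin> P"
    "\<And>i l. i < k \<Longrightarrow> l \<in> J \<Longrightarrow> c i * v i l - (\<Sum>x\<in>N. b i x * w x l) \<in> P"
    using sp by metis
  obtain a where a: "\<forall>x\<in>N. (\<Sum>i<k. a i * b i x) \<in> P" "\<exists>i<k. a i \<notin> P"
    using homogeneous_system_solvable_mod[OF P fin, of "{..<k}" b] \<open>\<not> k \<le> card N\<close> by auto
  have "(\<Sum>i<k. a i * c i * v i l) \<in> P" if l: "l \<in> J" for l
  proof -
    have "(\<Sum>i<k. a i * (c i * v i l - (\<Sum>x\<in>N. b i x * w x l))) \<in> P"
      by (rule ideal_sum[OF id]) (use cb l in \<open>auto intro: ideal_mult[OF id]\<close>)
    moreover have "(\<Sum>i<k. a i * (\<Sum>x\<in>N. b i x * w x l)) = (\<Sum>x\<in>N. (\<Sum>i<k. a i * b i x) * w x l)"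
      by (simp add: sum_distrib_left sum_distrib_right mult.assoc) (rule sum.swap)
    moreover have "(\<Sum>x\<in>N. (\<Sum>i<k. a i * b i x) * w x l) \<in> P"
      by (rule ideal_sum[OF id]) (use a in \<open>auto intro: ideal_mult2[OF id]\<close>)
    moreover have "(\<Sum>i<k. a i * c i * v i l) = (\<Sum>i<k. a i * (c i * v i l - (\<Sum>x\<in>N. b i x * w x l)))
        + (\<Sum>i<k. a i * (\<Sum>x\<in>N. b i x * w x l))"
      unfolding sum.distrib[symmetric] by (rule sum.cong) (simp_all add: right_diff_distrib mult.assoc)
    ultimately show ?thesis
      using ideal_add[OF id] by simp
  qed
  then have "\<forall>i<k. a i * c i \<in> P"
    using ind[unfolded indep_mod_def, THEN spec, of "\<lambda>i. a i * c i"] by simp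
  then show False using a cb(1) by (auto simp: prime_mult[OF P])
qed

lemma indep_mod_mono:
  assumes "is_prime P" "indep_mod P J k v" "k' \<le> k"
  shows "indep_mod P J k' v"
  unfolding indep_mod_def
proof (intro allI impI)
  fix a i assume a: "\<forall>l\<in>J. (\<Sum>i<k'. a i * v i l) \<in> P" and i: "i < k'"
  have "(\<Sum>i<k. (if i < k' then a i else 0) * v i l) = (\<Sum>i<k'. a i * v i l)" for l
    by (rule sum.mono_neutral_cong_right) (use assms in auto)
  then have "\<forall>l\<in>J. (\<Sum>i<k. (if i < k' then a i else 0) * v i l) \<in> P"
    using a by simp
  then have "\<forall>i<k. (if i < k' then a i else 0) \<in> P"
    using assms(2)[unfolded indep_mod_def, THEN spec, of "\<lambda>i. if i < k' then a i else 0"] by blast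
  then show "a i \<in> P" using i assms(3) by (metis order_less_le_trans)
qed

lemma indep_mod_cong:
  assumes "\<And>i l. i < k \<Longrightarrow> l \<in> J \<Longrightarrow> v i l = w i l"
  shows "indep_mod P J k v \<longleftrightarrow> indep_mod P J k w"
proof -
  have "(\<Sum>i<k. a i * v i l) = (\<Sum>i<k. a i * w i l)" if "l \<in> J" for a l
    by (rule sum.cong) (use assms that in auto)
  then have "(\<forall>l\<in>J. (\<Sum>i<k. a i * v i l) \<in> P) \<longleftrightarrow> (\<forall>l\<in>J. (\<Sum>i<k. a i * w i l) \<in> P)" for a
    by simp
  then show ?thesis unfolding indep_mod_def by simp
qed

text \<open>A relation whose last coefficient is outside P could be solved for \<open>v k\<close>,
  with that coefficient as denominator.\<close>

lemma indep_mod_Suc: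
  assumes P: "is_prime P" and ind: "indep_mod P J k v" and nsp: "\<not> in_span_mod P J k v (v k)"
  shows "indep_mod P J (Suc k) v"
  unfolding indep_mod_def
proof (intro allI impI)
  fix a i assume a: "\<forall>l\<in>J. (\<Sum>i<Suc k. a i * v i l) \<in> P" and i: "i < Suc k"
  note id = is_prime_is_ideal[OF P]
  have ak: "a k \<in> P"
  proof (rule ccontr)
    assume "a k \<notin> P"
    then have "in_span_mod P J k v (v k)"
      unfolding in_span_mod_def
      by (intro exI[of _ "a k"] exI[of _ "\<lambda>i. - a i"]) (use a in \<open>auto simp: sum_negf algebra_simps\<close>)
    then show False using nsp by simp
  qed
  have "(\<Sum>i<k. a i * v i l) \<in> P" if "l \<in> J" for l
  proof -
    have "(\<Sum>i<Suc k. a i * v i l) - a k * v k l \<in> P"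
      using a that ak by (intro ideal_diff[OF id] ideal_mult2[OF id]) auto
    then show ?thesis by simp
  qed
  then have "\<forall>i<k. a i \<in> P" using ind by (simp add: indep_mod_def)
  then show "a i \<in> P" using ak i by (auto simp: less_Suc_eq)
qed

text \<open>Steinitz exchange: while \<open>k < N\<close>, some \<open>g j\<close> contributes a
  vector outside the span of those of the \<open>h i\<close>, since otherwise N independent vectors
  would lie in the span of k. The vectors are indexed through \<open>vv\<close> so that the added
  ones are again gradients of members of V; in this way the rows of a minor are completed to a
  system of parameters.\<close>

lemma indep_mod_extend:
  fixes vv :: "'x \<Rightarrow> nat \<Rightarrow> 'a::comm_ring_1"
  assumes P: "is_prime P" and "indep_mod P J N (\<lambda>i. vv (g i))" "\<And>i. i < N \<Longrightarrow> g i \<in> V"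
    and "indep_mod P J k (\<lambda>i. vv (h i))" "\<And>i. i < k \<Longrightarrow> h i \<in> V" "k \<le> N"
  shows "\<exists>h'. indep_mod P J N (\<lambda>i. vv (h' i)) \<and> (\<forall>i<N. h' i \<in> V) \<and> (\<forall>i<k. h' i = h i)"
  using assms(4-6)
proof (induction "N - k" arbitrary: k h)
  case 0
  then show ?case by auto
next
  case (Suc d)
  have "\<exists>j<N. \<not> in_span_mod P J k (\<lambda>i. vv (h i)) (vv (g j))"
  proof (rule ccontr)
    assume "\<not> ?thesis"
    then have "N \<le> card {..<k}"
      by (intro indep_mod_le_card_of_spanned[OF P assms(2), of _ "\<lambda>i. vv (h i)"])
        (auto simp: in_span_mod_def)
    then show False using Suc by simp
  qed
  then obtain j where j: "j < N" "\<not> in_span_mod P J k (\<lambda>i. vv (h i)) (vv (g j))" by auto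
  define h1 where "h1 = h(k := g j)"
  have eq: "in_span_mod P J k (\<lambda>i. vv (h1 i)) u = in_span_mod P J k (\<lambda>i. vv (h i)) u" for u
    by (simp add: in_span_mod_def h1_def)
  have "indep_mod P J (Suc k) (\<lambda>i. vv (h1 i))"
  proof (rule indep_mod_Suc[OF P])
    show "indep_mod P J k (\<lambda>i. vv (h1 i))"
      using Suc(3) by (simp add: indep_mod_def h1_def)
    show "\<not> in_span_mod P J k (\<lambda>i. vv (h1 i)) (vv (h1 k))"
      unfolding eq using j by (simp add: h1_def)
  qed
  moreover have "\<And>i. i < Suc k \<Longrightarrow> h1 i \<in> V"
    using Suc.prems(2) j assms(3) by (auto simp: h1_def less_Suc_eq)
  ultimately obtain h' where "indep_mod P J N (\<lambda>i. vv (h' i))" "\<forall>i<N. h' i \<in> V" "\<forall>i<Suc k. h' i = h1 i"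
    using Suc.hyps(1)[of "Suc k" h1] Suc.hyps(2) Suc.prems(3) by fastforce
  then show ?case by (intro exI[of _ h']) (auto simp: h1_def)
qed

section \<open>Minors, the adjugate matrix and Laplace expansion\<close>

definition minor :: "(nat \<Rightarrow> nat \<Rightarrow> 'a::comm_ring_1) \<Rightarrow> nat \<Rightarrow> nat list \<Rightarrow> 'a" where
  "minor v k js = det (mat k k (\<lambda>(i,j). v i (js ! j)))"

lemma minor_cong:
  assumes "\<And>i j. i < k \<Longrightarrow> j < k \<Longrightarrow> v i (js ! j) = w i (js' ! j)"
  shows "minor v k js = minor w k js'"
proof -
  have "mat k k (\<lambda>(i,j). v i (js ! j)) = mat k k (\<lambda>(i,j). w i (js' ! j))"
    by (rule eq_matI) (simp_all add: assms)
  then show ?thesis by (simp only: minor_def)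
qed
lemma minor_0 [simp]: "minor v 0 js = 1"
proof -
  have "mat 0 0 (\<lambda>(i,j). v i (js ! j)) \<in> carrier_mat 0 0" by simp
  then show ?thesis by (simp only: minor_def det_dim_zero)
qed

text \<open>Entries of the adjugate matrix, transposed relative to the minor: the first index is a
  position among the columns, the second a row.\<close>

definition minor_adj :: "(nat \<Rightarrow> nat \<Rightarrow> 'a::comm_ring_1) \<Rightarrow> nat \<Rightarrow> nat list \<Rightarrow> nat \<Rightarrow> nat \<Rightarrow> 'a" where
  "minor_adj v k js j i = adj_mat (mat k k (\<lambda>(i,j). v i (js ! j))) $$ (j, i)"

lemma minor_adj_right:
  assumes "i < k" "i' < k"
  shows "(\<Sum>j<k. v i (js ! j) * minor_adj v k js j i') = (if i = i' then minor v k js else 0)"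
proof -
  let ?M = "mat k k (\<lambda>(i,j). v i (js ! j))"
  have M: "?M \<in> carrier_mat k k" by simp
  have "(?M * adj_mat ?M) $$ (i, i') = (\<Sum>j<k. v i (js ! j) * minor_adj v k js j i')"
    using assms adj_mat(1)[OF M]
    by (simp add: scalar_prod_def minor_adj_def flip: atLeast0LessThan)
  also have "(?M * adj_mat ?M) $$ (i, i') = (if i = i' then minor v k js else 0)"
    unfolding adj_mat(2)[OF M] using assms by (simp add: minor_def)
  finally show ?thesis ..
qed

lemma minor_adj_left:
  assumes "j < k" "j' < k"
  shows "(\<Sum>i<k. minor_adj v k js j i * v i (js ! j')) = (if j = j' then minor v k js else 0)"
proof -
  let ?M = "mat k k (\<lambda>(i,j). v i (js ! j))"
  have M: "?M \<in> carrier_mat k k" by simp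
  have "(adj_mat ?M * ?M) $$ (j, j') = (\<Sum>i<k. minor_adj v k js j i * v i (js ! j'))"
    using assms adj_mat(1)[OF M]
    by (simp add: scalar_prod_def minor_adj_def flip: atLeast0LessThan)
  also have "(adj_mat ?M * ?M) $$ (j, j') = (if j = j' then minor v k js else 0)"
    unfolding adj_mat(3)[OF M] using assms by (simp add: minor_def)
  finally show ?thesis ..
qed

text \<open>Multiplying a relation between the rows by the adjugate gives each coefficient times the
  minor, and the minor can be cancelled modulo P.\<close>

lemma indep_mod_of_minor:
  assumes P: "is_prime P" and "minor v k js \<notin> P" "length js = k" "set js \<subseteq> J"
  shows "indep_mod P J k v"
  unfolding indep_mod_def
proof (intro allI impI)
  fix a i assume a: "\<forall>l\<in>J. (\<Sum>i<k. a i * v i l) \<in> P" and i: "i < k"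
  note id = is_prime_is_ideal[OF P]
  have "(\<Sum>j<k. (\<Sum>i'<k. a i' * v i' (js ! j)) * minor_adj v k js j i) \<in> P"
  proof (rule ideal_sum[OF id], rule ideal_mult2[OF id])
    fix j assume "j \<in> {..<k}"
    then have "js ! j \<in> J" using assms(3,4) by auto
    then show "(\<Sum>i'<k. a i' * v i' (js ! j)) \<in> P" using a by blast
  qed
  also have "(\<Sum>j<k. (\<Sum>i'<k. a i' * v i' (js ! j)) * minor_adj v k js j i)
      = (\<Sum>i'<k. a i' * (\<Sum>j<k. v i' (js ! j) * minor_adj v k js j i))"
    by (simp add: sum_distrib_left sum_distrib_right mult.assoc) (rule sum.swap)
  also have "\<dots> = (\<Sum>i'<k. a i' * (if i' = i then minor v k js else 0))"
    by (rule sum.cong) (use minor_adj_right[of _ k i v js] i in auto)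
  also have "\<dots> = a i * minor v k js"
    using i by (simp add: if_distrib sum.delta cong: if_cong)
  finally show "a i \<in> P" using assms(2) by (simp add: prime_mult[OF P])
qed

text \<open>The cofactors of the last column do not depend on which column \<open>l\<close> is put
  there, so one family \<open>c\<close> serves all \<open>l\<close>. If all these minors lay in P,
  then \<open>c\<close> would be a relation between the rows, with the smaller minor as last
  coefficient.\<close>

lemma minor_Suc_last_column:
  assumes "length js = k"
  shows "\<exists>c. c k = minor v k js \<and> (\<forall>l. minor v (Suc k) (js @ [l]) = (\<Sum>i<Suc k. c i * v i l))"
proof -
  define A where "A = (\<lambda>l. mat (Suc k) (Suc k) (\<lambda>(i,j). v i ((js @ [l]) ! j)))"
  have A: "A l \<in> carrier_mat (Suc k) (Suc k)" for l by (simp add: A_def)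
  have cof: "cofactor (A l) i k = cofactor (A 0) i k" for i l
  proof -
    have "mat_delete (A l) i k = mat_delete (A 0) i k"
      unfolding mat_delete_def A_def by (rule eq_matI) (auto simp: nth_append assms)
    then show ?thesis by (simp add: cofactor_def)
  qed
  have "minor v (Suc k) (js @ [l]) = (\<Sum>i<Suc k. cofactor (A 0) i k * v i l)" for l
  proof -
    have "minor v (Suc k) (js @ [l]) = det (A l)" by (simp add: minor_def A_def)
    also have "\<dots> = (\<Sum>i<Suc k. A l $$ (i,k) * cofactor (A l) i k)"
      by (rule laplace_expansion_column[OF A]) simp
    also have "\<dots> = (\<Sum>i<Suc k. cofactor (A 0) i k * v i l)"
    proof (rule sum.cong[OF refl])
      fix i assume "i \<in> {..<Suc k}"
      then have "A l $$ (i,k) = v i l" by (simp add: A_def nth_append assms)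
      then show "A l $$ (i,k) * cofactor (A l) i k = cofactor (A 0) i k * v i l"
        using cof[of l i] by (simp add: mult.commute)
    qed
    finally show ?thesis .
  qed
  moreover have "cofactor (A 0) k k = minor v k js"
  proof -
    have "mat_delete (A 0) k k = mat k k (\<lambda>(i,j). v i (js ! j))"
    unfolding mat_delete_def A_def by (rule eq_matI) (auto simp: nth_append assms)
    then show ?thesis by (simp add: cofactor_def minor_def)
  qed
  ultimately show ?thesis by (intro exI[of _ "\<lambda>i. cofactor (A 0) i k"]) simp
qed

lemma nth_omit_nth:
  "j < length xs \<Longrightarrow> i < length xs - 1 \<Longrightarrow> omit_nth j xs ! i = xs ! (if i < j then i else Suc i)"
  by (auto simp: omit_nth_def nth_append)

lemma length_omit_nth: "j < length xs \<Longrightarrow> length (omit_nth j xs) = length xs - 1"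
  by (simp add: omit_nth_def)

lemma set_omit_nth: "set (omit_nth j xs) \<subseteq> set xs"
  by (auto simp: omit_nth_def dest: in_set_takeD in_set_dropD)

text \<open>This expansion has the shape of the formula for the natural derivations: the same
  omitted columns, and signs whose exponents have the same parity.\<close>

lemma minor_Suc_last_row:
  assumes "length js = Suc k"
  shows "minor v (Suc k) js = (\<Sum>j<Suc k. (-1) ^ (k + j) * minor v k (omit_nth j js) * v k (js ! j))"
proof -
  define A where "A = mat (Suc k) (Suc k) (\<lambda>(i,j). v i (js ! j))"
  have A: "A \<in> carrier_mat (Suc k) (Suc k)" by (simp add: A_def)
  have "minor v (Suc k) js = (\<Sum>j<Suc k. A $$ (k,j) * cofactor A k j)"
    unfolding minor_def A_def[symmetric] by (rule laplace_expansion_row[OF A]) simp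
  also have "\<dots> = (\<Sum>j<Suc k. (-1) ^ (k + j) * minor v k (omit_nth j js) * v k (js ! j))"
  proof (rule sum.cong[OF refl])
    fix j assume j: "j \<in> {..<Suc k}"
    have "mat_delete A k j = mat k k (\<lambda>(i,ja). v i (omit_nth j js ! ja))"
      unfolding mat_delete_def A_def by (rule eq_matI) (use j assms in \<open>auto simp: nth_omit_nth\<close>)
    then show "A $$ (k,j) * cofactor A k j = (-1) ^ (k + j) * minor v k (omit_nth j js) * v k (js ! j)"
      using j by (simp add: A_def cofactor_def minor_def algebra_simps)
  qed
  finally show ?thesis .
qed

lemma minor_eq_0_of_equal_rows:
  assumes "i < k" "i' < k" "i \<noteq> i'" "v i = v i'"
  shows "minor v k js = 0"
  unfolding minor_def
  by (rule det_identical_rows[of _ k i i']) (use assms in \<open>auto intro!: eq_vecI\<close>)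

text \<open>A minor outside P is enlarged by one row and one column at a time; if no new column
  worked, the cofactors from \<open>minor_Suc_last_column\<close> would contradict
  independence.\<close>

lemma exists_minor_of_indep_mod:
  assumes P: "is_prime P"
  shows "indep_mod P J k v \<Longrightarrow> \<exists>js. length js = k \<and> set js \<subseteq> J \<and> minor v k js \<notin> P"
proof (induction k)
  case 0
  then show ?case using prime_1[OF P] by simp
next
  case (Suc k)
  obtain js where js: "length js = k" "set js \<subseteq> J" "minor v k js \<notin> P"
    using Suc indep_mod_mono[OF P, of J "Suc k" v k] by auto
  obtain c where c: "c k = minor v k js" "\<And>l. minor v (Suc k) (js @ [l]) = (\<Sum>i<Suc k. c i * v i l)"
    using minor_Suc_last_column[OF js(1), of v] by auto
  have "\<exists>l\<in>J. minor v (Suc k) (js @ [l]) \<notin> P"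
  proof (rule ccontr)
    assume "\<not> ?thesis"
    then have "\<forall>l\<in>J. (\<Sum>i<Suc k. c i * v i l) \<in> P" using c(2) by simp
    then have "c k \<in> P" using Suc.prems[unfolded indep_mod_def, THEN spec, of c] by blast
    then show False using js c by simp
  qed
  then obtain l where "l \<in> J" "minor v (Suc k) (js @ [l]) \<notin> P" by blast
  then show ?case using js by (intro exI[of _ "js @ [l]"]) simp
qed

lemma minor_permute_columns:
  assumes "p permutes {..<k}" "length js = k"
  shows "minor v k (permute_list p js) = of_int (sign p) * minor v k js"
proof -
  define B where "B = mat k k (\<lambda>(j,i). v i (js ! j))"
  have p: "p permutes {0..<k}" using assms(1) by (simp add: lessThan_atLeast0)
  have lt: "p j < k" if "j < k" for j using permutes_in_image[OF assms(1), of j] that by simp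
  have "minor v k (permute_list p js) = det (transpose_mat (mat k k (\<lambda>(j,i). B $$ (p j, i))))"
    unfolding minor_def
    by (intro arg_cong[of _ _ det] eq_matI) (auto simp: B_def permute_list_nth assms lt)
  also have "\<dots> = det (mat k k (\<lambda>(j,i). B $$ (p j, i)))"
    by (rule det_transpose[of _ k]) simp
  also have "\<dots> = signof p * det B"
    by (rule det_permute_rows[OF _ p]) (simp add: B_def)
  also have "det B = det (transpose_mat B)"
    by (rule det_transpose[of _ k, symmetric]) (simp add: B_def)
  also have "det (transpose_mat B) = minor v k js"
    unfolding minor_def by (intro arg_cong[of _ _ det] eq_matI) (auto simp: B_def)
  finally show ?thesis by simp
qed

text \<open>A repeated column makes the minor 0, and sorting the columns changes it only by a sign.
  Thus increasing tuples detect the rank.\<close>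

lemma sorted_minor_notin:
  assumes I: "is_ideal P" and js: "length js = k" "minor v k js \<notin> P"
  shows "sorted_wrt (<) (sort js) \<and> minor v k (sort js) \<notin> P"
proof
  have "distinct js"
  proof (rule ccontr)
    assume "\<not> distinct js"
    then obtain i j where ij: "i < k" "j < k" "i \<noteq> j" "js ! i = js ! j"
      using js by (auto simp: distinct_conv_nth)
    have "minor v k js = 0" unfolding minor_def
      by (rule det_identical_columns[of _ k i j]) (use ij in \<open>auto intro!: eq_vecI\<close>)
    then show False using js ideal_0[OF I] by simp
  qed
  then show "sorted_wrt (<) (sort js)"
    by (simp add: strict_sorted_iff)
  obtain p where p: "p permutes {..<k}" "permute_list p js = sort js"
    using mset_eq_permutation[of "sort js" js] js by auto
  have "minor v k js = of_int (sign p) * minor v k (sort js)"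
    using minor_permute_columns[OF p(1) js(1), of v] p(2)
    by (simp add: sign_def split: if_splits)
  then show "minor v k (sort js) \<notin> P"
    using js(2) ideal_mult[OF I] by metis
qed

text \<open>Cramer's rule; the point is that the denominator is the given minor.\<close>

lemma cramer_mod:
  assumes P: "is_prime P" and m: "minor v k js \<notin> P" and js: "length js = k" "set js \<subseteq> J"
    and sp: "in_span_mod P J k v u"
  shows "\<exists>b. \<forall>l\<in>J. minor v k js * u l - (\<Sum>i<k. b i * v i l) \<in> P"
proof -
  note id = is_prime_is_ideal[OF P]
  define D where "D = minor v k js"
  define b where "b = (\<lambda>i. \<Sum>j<k. u (js ! j) * minor_adj v k js j i)"
  define w where "w = (\<lambda>l. D * u l - (\<Sum>i<k. b i * v i l))"
  obtain c b' where c: "c \<notin> P" "\<And>l. l \<in> J \<Longrightarrow> c * u l - (\<Sum>i<k. b' i * v i l) \<in> P"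
    using sp by (auto simp: in_span_mod_def)
  have w0: "w (js ! j) = 0" if j: "j < k" for j
  proof -
    have "(\<Sum>i<k. b i * v i (js ! j)) = (\<Sum>j'<k. u (js ! j') * (\<Sum>i<k. minor_adj v k js j' i * v i (js ! j)))"
      unfolding b_def by (simp add: sum_distrib_left sum_distrib_right mult.assoc) (rule sum.swap)
    also have "\<dots> = (\<Sum>j'<k. u (js ! j') * (if j' = j then D else 0))"
      by (rule sum.cong) (use minor_adj_left[of _ k j v js] j in \<open>auto simp: D_def\<close>)
    also have "\<dots> = u (js ! j) * D"
      using j by (simp add: if_distrib sum.delta cong: if_cong)
    finally show ?thesis by (simp add: w_def mult.commute)
  qed
  \<comment> \<open>Two representations of \<open>u\<close> are compared, the given one with
    denominator \<open>c\<close> and Cramer's with denominator D. Their difference is a relation on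
    the columns in \<open>js\<close>, where \<open>w\<close> vanishes, so its coefficients lie in
    P.\<close>
  define a where "a = (\<lambda>i. D * b' i - c * b i)"
  have cw: "c * w l - (\<Sum>i<k. a i * v i l) \<in> P" if l: "l \<in> J" for l
  proof -
    have "c * w l - (\<Sum>i<k. a i * v i l) = D * (c * u l - (\<Sum>i<k. b' i * v i l))"
      by (simp add: w_def a_def sum_subtractf algebra_simps sum_distrib_left)
    then show ?thesis using ideal_mult[OF id c(2)[OF l], of D] by simp
  qed
  have "(\<Sum>i<k. a i * v i l) \<in> P" if l: "l \<in> set js" for l
  proof -
    obtain j where j: "j < k" "l = js ! j" using l js(1) by (metis in_set_conv_nth)
    have "l \<in> J" using js(2) l by (rule subsetD)
    from ideal_uminus[OF id cw[OF this]] show ?thesis using w0[OF j(1)] j(2) by simp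
  qed
  then have aP: "\<forall>i<k. a i \<in> P"
    using indep_mod_of_minor[OF P m js(1) subset_refl] by (simp add: indep_mod_def)
  have "w l \<in> P" if l: "l \<in> J" for l
  proof -
    have "(\<Sum>i<k. a i * v i l) \<in> P"
      by (rule ideal_sum[OF id], rule ideal_mult2[OF id]) (use aP in auto)
    then have "c * w l \<in> P" using cw[OF l] ideal_cong[OF id] by blast
    then show ?thesis using c(1) by (simp add: prime_mult[OF P])
  qed
  then show ?thesis unfolding w_def D_def by blast
qed

section \<open>Minimal equations over a prime ideal\<close>

definition is_subring :: "'a::comm_ring_1 set \<Rightarrow> bool" where
  "is_subring B \<longleftrightarrow> 1 \<in> B \<and> (\<forall>x\<in>B. \<forall>y\<in>B. x - y \<in> B \<and> x * y \<in> B)"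

lemma subring_1: "is_subring B \<Longrightarrow> 1 \<in> B"
  and subring_diff: "is_subring B \<Longrightarrow> x \<in> B \<Longrightarrow> y \<in> B \<Longrightarrow> x - y \<in> B"
  and subring_mult: "is_subring B \<Longrightarrow> x \<in> B \<Longrightarrow> y \<in> B \<Longrightarrow> x * y \<in> B"
  by (auto simp: is_subring_def)

lemma subring_0: "is_subring B \<Longrightarrow> 0 \<in> B"
  using subring_diff[of B 1 1] subring_1 by auto

lemma subring_add: "is_subring B \<Longrightarrow> x \<in> B \<Longrightarrow> y \<in> B \<Longrightarrow> x + y \<in> B"
  using subring_diff[of B x "0 - y"] subring_diff[of B 0 y] subring_0[of B] by auto

lemma subring_sum: "is_subring B \<Longrightarrow> (\<And>i. i \<in> S \<Longrightarrow> f i \<in> B) \<Longrightarrow> sum f S \<in> B"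
  by (induction S rule: infinite_finite_induct) (auto intro: subring_0 subring_add)

lemma subring_of_nat: "is_subring B \<Longrightarrow> of_nat k \<in> B"
  by (induction k) (auto intro: subring_0 subring_add subring_1)

lemma is_subring_polys_in: "is_subring (polys_in U)"
  by (auto simp: is_subring_def intro: polys_in_diff polys_in_mult)

lemma polys_over_diff: "is_subring B \<Longrightarrow> p \<in> polys_over B \<Longrightarrow> q \<in> polys_over B \<Longrightarrow> p - q \<in> polys_over B"
  by (auto simp: polys_over_def intro: subring_diff)

lemma polys_over_add: "is_subring B \<Longrightarrow> p \<in> polys_over B \<Longrightarrow> q \<in> polys_over B \<Longrightarrow> p + q \<in> polys_over B"
  by (auto simp: polys_over_def intro: subring_add)

lemma polys_over_mult: "is_subring B \<Longrightarrow> p \<in> polys_over B \<Longrightarrow> q \<in> polys_over B \<Longrightarrow> p * q \<in> polys_over B"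
  by (auto simp: polys_over_def coeff_mult intro!: subring_mult subring_sum)

lemma polys_over_smult: "is_subring B \<Longrightarrow> c \<in> B \<Longrightarrow> q \<in> polys_over B \<Longrightarrow> smult c q \<in> polys_over B"
  by (auto simp: polys_over_def intro: subring_mult)

lemma polys_over_monom: "is_subring B \<Longrightarrow> c \<in> B \<Longrightarrow> monom c k \<in> polys_over B"
  by (auto simp: polys_over_def subring_0)

lemma polys_over_pderiv:
  fixes q :: "'a::idom poly"
  shows "is_subring B \<Longrightarrow> q \<in> polys_over B \<Longrightarrow> pderiv q \<in> polys_over B"
  by (auto simp: polys_over_def coeff_pderiv intro!: subring_mult subring_of_nat
      simp del: of_nat_Suc)

lemma lead_coeff_in: "q \<in> polys_over B \<Longrightarrow> lead_coeff q \<in> B"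
  by (simp add: polys_over_def)

lemma poly_in_ideal:
  assumes "is_ideal P" "\<And>i. coeff r i \<in> P"
  shows "poly r x \<in> P"
  unfolding poly_altdef by (rule ideal_sum[OF assms(1)]) (use assms in \<open>auto intro: ideal_mult2\<close>)

lemma exists_lead_coeff_notin:
  assumes P: "is_prime P" and B: "is_subring B"
  shows "q \<in> polys_over B \<Longrightarrow> poly q x \<in> P \<Longrightarrow> coeff q i \<notin> P \<Longrightarrow>
    \<exists>q'\<in>polys_over B. poly q' x \<in> P \<and> lead_coeff q' \<notin> P \<and> degree q' \<le> degree q"
proof (induction "degree q" arbitrary: q rule: less_induct)
  case less
  note id = is_prime_is_ideal[OF P]
  show ?case
  proof (cases "lead_coeff q \<in> P")
    case True
    define q' where "q' = q - monom (lead_coeff q) (degree q)"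
    have "i \<noteq> degree q" using True less.prems by auto
    then have nz: "coeff q' i \<notin> P" using less.prems by (simp add: q'_def)
    have "degree q' \<le> degree q" unfolding q'_def
      by (rule degree_diff_le) (auto simp: degree_monom_le)
    moreover have "coeff q' (degree q) = 0" by (simp add: q'_def)
    ultimately have "q' = 0 \<or> degree q' < degree q"
      using eq_zero_or_degree_less by blast
    then have deg: "degree q' < degree q" using nz ideal_0[OF id] by auto
    have "q' \<in> polys_over B"
      unfolding q'_def using less.prems B by (intro polys_over_diff polys_over_monom lead_coeff_in)
    moreover have "poly q' x \<in> P"
      using less.prems True by (auto simp: q'_def poly_monom intro!: ideal_diff[OF id] ideal_mult2[OF id])
    ultimately show ?thesis using less.hyps[OF deg _ _ nz] deg by force
  qed (use less.prems in blast)
qed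

text \<open>A minimal polynomial of \<open>x\<close> modulo P over the fraction field of B modulo P,
  without denominators: the leading coefficient is kept outside P in place of being 1, so
  \<open>g\<close> is determined only up to such factors and up to coefficients in P.\<close>

definition minimal_eq :: "'a::comm_ring_1 set \<Rightarrow> 'a set \<Rightarrow> 'a \<Rightarrow> 'a poly \<Rightarrow> bool" where
  "minimal_eq P B x g \<longleftrightarrow> g \<in> polys_over B \<and> poly g x \<in> P \<and> lead_coeff g \<notin> P \<and>
     (\<forall>q\<in>polys_over B. poly q x \<in> P \<longrightarrow> lead_coeff q \<notin> P \<longrightarrow> degree g \<le> degree q)"

lemma minimal_eq_exists:
  assumes "q \<in> polys_over B" "poly q x \<in> P" "lead_coeff q \<notin> P"
  shows "\<exists>g. minimal_eq P B x g"
proof -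
  let ?Q = "\<lambda>g. g \<in> polys_over B \<and> poly g x \<in> P \<and> lead_coeff g \<notin> P"
  show ?thesis using ex_has_least_nat[of ?Q q degree] assms unfolding minimal_eq_def by blast
qed

text \<open>A relation of smaller degree with some coefficient outside P could be trimmed to one
  whose leading coefficient is outside P, against minimality.\<close>

lemma minimal_eq_coeff_in:
  assumes P: "is_prime P" and B: "is_subring B" and "minimal_eq P B x g"
    and "q \<in> polys_over B" "poly q x \<in> P" "degree q < degree g"
  shows "coeff q i \<in> P"
proof (rule ccontr)
  assume "coeff q i \<notin> P"
  then obtain q' where "q'\<in>polys_over B" "poly q' x \<in> P" "lead_coeff q' \<notin> P" "degree q' \<le> degree q"
    using exists_lead_coeff_notin[OF P B assms(4,5)] by blast
  then show False using assms(3,6) unfolding minimal_eq_def by fastforce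
qed

lemma minimal_eq_degree_pos:
  assumes "is_prime P" "minimal_eq P B x g"
  shows "degree g > 0"
proof (rule ccontr)
  assume "\<not> degree g > 0"
  then obtain c where "g = [:c:]" by (auto elim: degree_eq_zeroE)
  then show False using assms by (auto simp: minimal_eq_def)
qed

text \<open>Separability in characteristic zero: the derivative has smaller degree, so its vanishing
  modulo P would put its top coefficient, the degree times the leading coefficient of
  \<open>g\<close>, into P.\<close>

lemma minimal_eq_pderiv_notin:
  fixes P :: "'k::field_char_0 mpoly set"
  assumes P: "is_prime P" and B: "is_subring B" and g: "minimal_eq P B x g"
  shows "poly (pderiv g) x \<notin> P"
proof
  assume a: "poly (pderiv g) x \<in> P"
  have d: "degree g > 0" using minimal_eq_degree_pos[OF P g] .
  have "degree (pderiv g) < degree g" using d by (simp add: degree_pderiv)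
  then have "coeff (pderiv g) (degree g - 1) \<in> P"
    using minimal_eq_coeff_in[OF P B g polys_over_pderiv[OF B] a] g by (auto simp: minimal_eq_def)
  then have "of_nat (degree g) * lead_coeff g \<in> P"
    using d by (simp add: coeff_pderiv)
  then show False using prime_of_nat[OF P d] g by (auto simp: prime_mult[OF P] minimal_eq_def)
qed

text \<open>Euclidean division in which the leading coefficient of \<open>g\<close>, not invertible
  in general, is multiplied into the dividend at each stage. Degrees are true degrees, not degrees
  modulo P.\<close>

lemma pseudo_division:
  assumes B: "is_subring B" and g: "g \<in> polys_over B" "degree g > 0"
  shows "f \<in> polys_over B \<Longrightarrow> \<exists>N q r. q \<in> polys_over B \<and> r \<in> polys_over B \<and>
    smult (lead_coeff g ^ N) f = q * g + r \<and> degree r < degree g"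
proof (induction "degree f" arbitrary: f rule: less_induct)
  case less
  show ?case
  proof (cases "degree f < degree g")
    case True
    then show ?thesis using less.prems subring_0[OF B]
      by (intro exI[of _ 0] exI[of _ 0] exI[of _ f]) (auto simp: polys_over_def)
  next
    case False
    define m where "m = monom (lead_coeff f) (degree f - degree g)"
    define f' where "f' = smult (lead_coeff g) f - m * g"
    have m: "m \<in> polys_over B" unfolding m_def by (intro polys_over_monom B lead_coeff_in less.prems)
    have f': "f' \<in> polys_over B" unfolding f'_def
      by (intro polys_over_diff polys_over_smult polys_over_mult B m g less.prems lead_coeff_in)
    have "degree f' \<le> degree f" unfolding f'_def
    proof (rule degree_diff_le)
      show "degree (m * g) \<le> degree f"
        using degree_mult_le[of m g] degree_monom_le[of "lead_coeff f" "degree f - degree g"] False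
        by (simp add: m_def)
    qed (rule degree_smult_le)
    moreover have "coeff f' (degree f) = 0"
      using False by (simp add: f'_def m_def coeff_monom_mult)
    ultimately have "f' = 0 \<or> degree f' < degree f"
      using eq_zero_or_degree_less by blast
    then have "degree f' < degree f" using False g(2) by auto
    then obtain N q r where IH: "q \<in> polys_over B" "r \<in> polys_over B"
      "smult (lead_coeff g ^ N) f' = q * g + r" "degree r < degree g"
      using less.hyps[OF _ f'] by blast
    have "smult (lead_coeff g ^ Suc N) f = smult (lead_coeff g ^ N) (f' + m * g)"
      by (simp add: f'_def mult.commute)
    also have "\<dots> = (q + smult (lead_coeff g ^ N) m) * g + r"
      by (simp add: smult_add_right IH(3) algebra_simps)
    finally have eq: "smult (lead_coeff g ^ Suc N) f = (q + smult (lead_coeff g ^ N) m) * g + r" .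
    have "lead_coeff g ^ N \<in> B"
      by (induction N) (auto intro: subring_1 subring_mult B lead_coeff_in g)
    then have "q + smult (lead_coeff g ^ N) m \<in> polys_over B"
      by (intro polys_over_add polys_over_smult B IH m)
    then show ?thesis using eq IH by blast
  qed
qed

text \<open>The remainder is again a relation and has smaller degree than the minimal equation, so
  its coefficients lie in P. Up to powers of its leading coefficient, the minimal equation therefore
  divides every relation modulo P.\<close>

lemma pseudo_division_minimal_eq:
  assumes P: "is_prime P" and B: "is_subring B" and g: "minimal_eq P B x g"
    and f: "f \<in> polys_over B" "poly f x \<in> P"
  shows "\<exists>N q r. q \<in> polys_over B \<and> r \<in> polys_over B \<and> smult (lead_coeff g ^ N) f = q * g + r \<and>
    degree r < degree g \<and> (\<forall>i. coeff r i \<in> P)"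
proof -
  have g': "g \<in> polys_over B" "poly g x \<in> P" using g by (auto simp: minimal_eq_def)
  obtain N q r where *: "q \<in> polys_over B" "r \<in> polys_over B"
    "smult (lead_coeff g ^ N) f = q * g + r" "degree r < degree g"
    using pseudo_division[OF B g'(1) minimal_eq_degree_pos[OF P g] f(1)] by blast
  have "poly r x = lead_coeff g ^ N * poly f x - poly q x * poly g x"
    using arg_cong[OF *(3), of "\<lambda>p. poly p x"] by simp
  also have "\<dots> \<in> P"
    using f g' P by (intro ideal_diff ideal_mult is_prime_is_ideal) auto
  finally have "\<forall>i. coeff r i \<in> P" using minimal_eq_coeff_in[OF P B g *(2) _ *(4)] by blast
  then show ?thesis using * by blast
qed

section \<open>Transcendence degree and the rank of the gradients of a prime ideal\<close>

text \<open>Stands for a prime ideal of the polynomial ring in \<open>n\<close> variables: the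
  second condition puts all variables with index at least \<open>n\<close> into P.\<close>

definition prime_over :: "nat \<Rightarrow> 'k::comm_ring_1 mpoly set \<Rightarrow> bool" where
  "prime_over n P \<longleftrightarrow> is_prime P \<and> (\<forall>p. retr n p = 0 \<longrightarrow> p \<in> P)"

definition alg_indep_vars :: "'k::comm_ring_1 mpoly set \<Rightarrow> nat set \<Rightarrow> bool" where
  "alg_indep_vars P T \<longleftrightarrow> P \<inter> polys_in T \<subseteq> {0}"

text \<open>This is the transcendence degree of the polynomials modulo P: only sets of variables
  compete, but the variables generate, so a transcendence basis can be chosen among them.\<close>

definition trans_deg :: "nat \<Rightarrow> 'k::comm_ring_1 mpoly set \<Rightarrow> nat" where
  "trans_deg n P = Max (card ` {T. T \<subseteq> {..<n} \<and> alg_indep_vars P T})"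

definition codim :: "nat \<Rightarrow> 'k::comm_ring_1 mpoly set \<Rightarrow> nat" where
  "codim n P = n - trans_deg n P"

abbreviation grad :: "'k::comm_ring_1 mpoly \<Rightarrow> nat \<Rightarrow> 'k mpoly" where
  "grad p \<equiv> \<lambda>l. pderiv_mpoly l p"

lemma prime_over_is_prime: "prime_over n P \<Longrightarrow> is_prime P"
  and prime_over_is_ideal: "prime_over n P \<Longrightarrow> is_ideal P"
  and prime_over_retr_0: "prime_over n P \<Longrightarrow> retr n p = 0 \<Longrightarrow> p \<in> P"
  by (auto simp: prime_over_def is_prime_def)

lemma prime_over_retr: "prime_over n P \<Longrightarrow> retr n p \<in> P \<longleftrightarrow> p \<in> P"
  by (rule ideal_cong) (auto simp: prime_over_is_ideal prime_over_retr_0 retr_diff)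

lemma prime_over_pd: "prime_over n P \<Longrightarrow> retr n p = 0 \<Longrightarrow> l < n \<Longrightarrow> pderiv_mpoly l p \<in> P"
  by (rule prime_over_retr_0) (auto simp: retr_pd)

section \<open>Transcendence bases among the variables\<close>

lemma alg_indep_vars_empty:
  fixes P :: "'k::field_char_0 mpoly set"
  assumes "is_prime P" shows "alg_indep_vars P {}"
  unfolding alg_indep_vars_def
proof
  fix p assume p: "p \<in> P \<inter> polys_in {}"
  then obtain c where c: "p = mpoly_const c" using polys_in_empty by blast
  have "c = 0"
  proof (rule ccontr)
    assume "c \<noteq> 0"
    then have "mpoly_const (1 / c) * p = 1" by (simp add: c flip: mpoly_const_mult)
    then show False
      using ideal_mult[OF is_prime_is_ideal[OF assms], of p "mpoly_const (1 / c)"] p prime_1[OF assms] by auto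
  qed
  then show "p \<in> {0}" by (simp add: c)
qed

lemma card_le_trans_deg:
  assumes "T \<subseteq> {..<n}" "alg_indep_vars P T"
  shows "card T \<le> trans_deg n P"
proof -
  have "finite {T. T \<subseteq> {..<n} \<and> alg_indep_vars P T}"
    by (rule finite_subset[of _ "Pow {..<n}"]) auto
  then show ?thesis unfolding trans_deg_def using assms by (intro Max_ge) auto
qed

lemma trans_deg_attained:
  fixes P :: "'k::field_char_0 mpoly set"
  assumes "is_prime P"
  obtains T where "T \<subseteq> {..<n}" "alg_indep_vars P T" "card T = trans_deg n P"
proof -
  let ?S = "{T. T \<subseteq> {..<n} \<and> alg_indep_vars P T}"
  have "finite ?S" by (rule finite_subset[of _ "Pow {..<n}"]) auto
  moreover have "{} \<in> ?S" using alg_indep_vars_empty[OF assms] by simp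
  ultimately have "trans_deg n P \<in> card ` ?S"
    unfolding trans_deg_def by (intro Max_in) auto
  then show ?thesis using that by auto
qed

lemma trans_deg_le:
  fixes P :: "'k::field_char_0 mpoly set"
  assumes "is_prime P" shows "trans_deg n P \<le> n"
  using trans_deg_attained[OF assms, of n] card_mono[of "{..<n}"] by (metis card_lessThan finite_lessThan)

text \<open>Adding \<open>k\<close> to an independent set of maximal size creates a nonzero element
  of P, and its nonzero coefficients as a polynomial in \<open>k\<close> are outside P because T is
  independent. The coefficient ring may be larger than \<open>polys_in T\<close>, as the successive
  adjunction of variables demands.\<close>

lemma exists_minimal_eq:
  fixes P :: "'k::field_char_0 mpoly set"
  assumes P: "is_prime P" and T: "T \<subseteq> {..<n}" "alg_indep_vars P T" "card T = trans_deg n P"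
    and k: "k < n" "k \<notin> T" and U: "T \<subseteq> U"
  shows "\<exists>g. minimal_eq P (polys_in U) (mpoly_var k) g"
proof -
  have "\<not> alg_indep_vars P (insert k T)"
  proof
    assume "alg_indep_vars P (insert k T)"
    then have "card (insert k T) \<le> trans_deg n P" using T k by (intro card_le_trans_deg) auto
    moreover have "finite T" using T(1) finite_subset by blast
    ultimately show False using T k by simp
  qed
  then obtain p where p: "p \<in> P" "p \<in> polys_in (insert k T)" "p \<noteq> 0"
    by (auto simp: alg_indep_vars_def)
  then obtain q where q: "q \<in> polys_over (polys_in T)" "p = poly q (mpoly_var k)"
    using polys_in_insert_eq_poly by blast
  then obtain i where "coeff q i \<noteq> 0" using p(3) by (metis leading_coeff_0_iff poly_0)
  then have "coeff q i \<notin> P" using q T(2) by (auto simp: polys_over_def alg_indep_vars_def)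
  then obtain q' where "q' \<in> polys_over (polys_in T)" "poly q' (mpoly_var k) \<in> P" "lead_coeff q' \<notin> P"
    using exists_lead_coeff_notin[OF P is_subring_polys_in q(1)] p q by blast
  then show ?thesis
    using minimal_eq_exists polys_over_mono[OF polys_in_mono[OF U]] by blast
qed

text \<open>Adjoining the variables outside a transcendence basis one at a time, their minimal equations form
  a triangular system that generates the prime ideal locally.\<close>

lemma triangular_generators:
  fixes P :: "'k::field_char_0 mpoly set"
  assumes P: "is_prime P" and T: "T \<subseteq> {..<n}" "alg_indep_vars P T" "card T = trans_deg n P"
  shows "finite V \<Longrightarrow> V \<subseteq> {..<n} - T \<Longrightarrow> \<exists>g. (\<forall>k\<in>V. g k \<in> P \<inter> polys_in (T \<union> V)) \<and>
     (\<forall>a. (\<forall>l\<in>V. (\<Sum>k\<in>V. a k * pderiv_mpoly l (g k)) \<in> P) \<longrightarrow> (\<forall>k\<in>V. a k \<in> P)) \<and>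
     (\<forall>h\<in>P \<inter> polys_in (T \<union> V). \<exists>c b. c \<notin> P \<and> c * h = (\<Sum>k\<in>V. b k * g k))"
proof (induction V rule: finite_induct)
  case empty
  have "\<exists>c. c \<notin> P \<and> c * h = 0" if "h \<in> P \<inter> polys_in T" for h
    using that T(2) prime_1[OF P] by (auto simp: alg_indep_vars_def)
  then show ?case by auto
next
  case (insert k V)
  note id = is_prime_is_ideal[OF P]
  let ?B = "polys_in (T \<union> V)"
  let ?x = "mpoly_var k"
  have un: "T \<union> insert k V = insert k (T \<union> V)" by auto
  have sub: "?B \<subseteq> polys_in (insert k (T \<union> V))" by (intro polys_in_mono) auto
  have knot: "k \<notin> T \<union> V" using insert by auto
  obtain g where g: "\<forall>k\<in>V. g k \<in> P \<inter> ?B"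
    "\<And>a. (\<forall>l\<in>V. (\<Sum>k\<in>V. a k * pderiv_mpoly l (g k)) \<in> P) \<Longrightarrow> (\<forall>k\<in>V. a k \<in> P)"
    "\<And>h. h\<in>P \<inter> ?B \<Longrightarrow> \<exists>c b. c \<notin> P \<and> c * h = (\<Sum>k\<in>V. b k * g k)"
    using insert.IH insert.prems by auto
  obtain q where q: "minimal_eq P ?B ?x q"
    using exists_minimal_eq[OF P T, of k "T \<union> V"] insert.prems by auto
  have qB: "q \<in> polys_over ?B" using q by (simp add: minimal_eq_def)
  define g' where "g' = g(k := poly q ?x)"
  have g'k: "g' k = poly q ?x" by (simp add: g'_def)
  have g'V: "g' j = g j" if "j \<in> V" for j using that insert by (auto simp: g'_def)
  have sum': "(\<Sum>j\<in>insert k V. F j (g' j)) = F k (poly q ?x) + (\<Sum>j\<in>V. F j (g j))"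
    for F :: "nat \<Rightarrow> 'k mpoly \<Rightarrow> 'k mpoly"
    using insert g'V g'k by (simp cong: sum.cong)
  have c1: "\<forall>j\<in>insert k V. g' j \<in> P \<inter> polys_in (T \<union> insert k V)"
    unfolding un using g(1) sub poly_var_in_polys_in[OF qB, of k] q g'V g'k
    by (auto simp: minimal_eq_def)
  have c2: "\<forall>j\<in>insert k V. a j \<in> P"
    if a: "\<forall>l\<in>insert k V. (\<Sum>j\<in>insert k V. a j * pderiv_mpoly l (g' j)) \<in> P" for a
  proof -
    \<comment> \<open>The matrix of derivatives is triangular: the earlier equations do not contain
      the variable \<open>k\<close>, and the new one has a derivative in \<open>k\<close> outside
      P.\<close>
    have "(\<Sum>j\<in>V. a j * pderiv_mpoly k (g j)) = 0"
      by (rule sum.neutral) (use g(1) pd_polys_in_eq_0[OF _ knot] in auto)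
    then have "a k * poly (pderiv q) ?x \<in> P"
      using a[rule_format, of k] sum'[of "\<lambda>j p. a j * pderiv_mpoly k p"] by (simp add: pd_poly_var[OF qB knot])
    then have ak: "a k \<in> P"
      using minimal_eq_pderiv_notin[OF P is_subring_polys_in q] by (simp add: prime_mult[OF P])
    have "(\<Sum>j\<in>V. a j * pderiv_mpoly l (g j)) \<in> P" if "l \<in> V" for l
      using ideal_diff[OF id a[rule_format, of l] ideal_mult2[OF id ak, of "pderiv_mpoly l (poly q ?x)"]]
        that sum'[of "\<lambda>j p. a j * pderiv_mpoly l p"] by simp
    then show ?thesis using g(2) ak by auto
  qed
  have c3: "\<exists>c b. c \<notin> P \<and> c * h = (\<Sum>j\<in>insert k V. b j * g' j)"
    if h: "h \<in> P \<inter> polys_in (T \<union> insert k V)" for h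
  proof -
    obtain f where f: "f \<in> polys_over ?B" "h = poly f ?x"
      using h polys_in_insert_eq_poly[of h k "T \<union> V"] unfolding un by auto
    obtain N u r where ur: "u \<in> polys_over ?B" "r \<in> polys_over ?B"
      "smult (lead_coeff q ^ N) f = u * q + r" "\<forall>i. coeff r i \<in> P"
      using pseudo_division_minimal_eq[OF P is_subring_polys_in q f(1)] h f by auto
    \<comment> \<open>The coefficients of the remainder lie in P and involve only the earlier
      variables, so the induction hypothesis applies to each of them; \<open>C\<close> below is a
      common denominator.\<close>
    have "\<exists>c b. c \<notin> P \<and> c * coeff r i = (\<Sum>k\<in>V. b k * g k)" for i
      using g(3)[of "coeff r i"] ur by (auto simp: polys_over_def)
    then obtain c b where cb: "\<And>i. c i \<notin> P" "\<And>i. c i * coeff r i = (\<Sum>k\<in>V. b i k * g k)"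
      by metis
    define C where "C = (\<Prod>i\<le>degree r. c i)"
    define C' where "C' = (\<lambda>i. \<Prod>j\<in>{..degree r}-{i}. c j)"
    have C: "C \<notin> P" unfolding C_def using cb(1) by (simp add: prime_prod[OF P])
    have CC: "C = C' i * c i" if "i \<le> degree r" for i
      unfolding C_def C'_def using that by (simp add: prod.remove mult.commute)
    have "C * poly r ?x = (\<Sum>i\<le>degree r. C' i * ?x ^ i * (c i * coeff r i))"
      unfolding poly_altdef sum_distrib_left
      by (rule sum.cong) (auto simp: CC algebra_simps)
    also have "\<dots> = (\<Sum>j\<in>V. (\<Sum>i\<le>degree r. C' i * ?x ^ i * b i j) * g j)"
      unfolding cb(2) by (simp add: sum_distrib_left sum_distrib_right mult.assoc) (rule sum.swap)
    finally have r: "C * poly r ?x = (\<Sum>j\<in>V. (\<Sum>i\<le>degree r. C' i * ?x ^ i * b i j) * g j)" .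
    define b' where "b' = (\<lambda>j. if j = k then C * poly u ?x else (\<Sum>i\<le>degree r. C' i * ?x ^ i * b i j))"
    have "lead_coeff q ^ N * h = poly u ?x * poly q ?x + poly r ?x"
      using arg_cong[OF ur(3), of "\<lambda>p. poly p ?x"] f by simp
    then have "C * lead_coeff q ^ N * h = C * poly u ?x * poly q ?x + C * poly r ?x"
      by (simp add: algebra_simps)
    also have "\<dots> = (\<Sum>j\<in>insert k V. b' j * g' j)"
      unfolding r sum'[of "\<lambda>j p. b' j * p"] using insert(2) by (auto simp: b'_def intro!: sum.cong)
    finally have "C * lead_coeff q ^ N * h = (\<Sum>j\<in>insert k V. b' j * g' j)" .
    moreover have "C * lead_coeff q ^ N \<notin> P"
      using C q prime_power[OF P] by (auto simp: prime_mult[OF P] minimal_eq_def)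
    ultimately show ?thesis by blast
  qed
  show ?case using c1 c2 c3 by (intro exI[of _ g']) auto
qed

text \<open>Generation of P after localizing at P, with denominator \<open>c\<close>; applying
  \<open>retr\<close> disregards the variables with index at least \<open>n\<close>.\<close>

definition generates_locally :: "nat \<Rightarrow> 'k::comm_ring_1 mpoly set \<Rightarrow> nat \<Rightarrow> (nat \<Rightarrow> 'k mpoly) \<Rightarrow> bool" where
  "generates_locally n P N h \<longleftrightarrow> (\<forall>i<N. h i \<in> P) \<and>
     (\<forall>p\<in>P. \<exists>c b. c \<notin> P \<and> retr n (c * p - (\<Sum>i<N. b i * h i)) = 0)"

text \<open>The triangular system, renumbered from 0. It has one equation for each variable outside
  a transcendence basis, which makes their number the codimension.\<close>

lemma exists_local_generators:
  fixes P :: "'k::field_char_0 mpoly set"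
  assumes P: "prime_over n P"
  shows "\<exists>h. generates_locally n P (codim n P) h \<and> indep_mod P {..<n} (codim n P) (\<lambda>i. grad (h i))"
proof -
  note P' = prime_over_is_prime[OF P]
  obtain T where T: "T \<subseteq> {..<n}" "alg_indep_vars P T" "card T = trans_deg n P"
    using trans_deg_attained[OF P'] by blast
  define V where "V = {..<n} - T"
  have TV: "T \<union> V = {..<n}" using T by (auto simp: V_def)
  have fV: "finite V" by (simp add: V_def)
  have cV: "card V = codim n P"
    using T finite_subset[OF T(1)] by (simp add: V_def codim_def card_Diff_subset)
  obtain g where g: "\<forall>k\<in>V. g k \<in> P \<inter> polys_in {..<n}"
    "\<And>a. (\<forall>l\<in>V. (\<Sum>k\<in>V. a k * pderiv_mpoly l (g k)) \<in> P) \<Longrightarrow> (\<forall>k\<in>V. a k \<in> P)"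
    "\<And>h. h\<in>P \<inter> polys_in {..<n} \<Longrightarrow> \<exists>c b. c \<notin> P \<and> c * h = (\<Sum>k\<in>V. b k * g k)"
    using triangular_generators[OF P' T fV] unfolding TV by (auto simp: V_def)
  obtain e where e: "bij_betw e {..<codim n P} V"
    using ex_bij_betw_nat_finite[OF fV] by (auto simp: cV atLeast0LessThan)
  define h where "h = g \<circ> e"
  have reindex: "(\<Sum>i<codim n P. F (e i)) = (\<Sum>k\<in>V. F k)" for F :: "nat \<Rightarrow> 'k mpoly"
    by (rule sum.reindex_bij_betw[OF e])
  have eV: "e i \<in> V" if "i < codim n P" for i using e that by (auto simp: bij_betw_def)
  have "generates_locally n P (codim n P) h"
    unfolding generates_locally_def
  proof (intro conjI allI impI ballI)
    fix i assume "i < codim n P"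
    then show "h i \<in> P" using g(1) eV by (auto simp: h_def)
  next
    fix p assume p: "p \<in> P"
    then have "retr n p \<in> P \<inter> polys_in {..<n}" using prime_over_retr[OF P] retr_in by auto
    then obtain c b where cb: "c \<notin> P" "c * retr n p = (\<Sum>k\<in>V. b k * g k)" using g(3) by blast
    have "retr n (c * p - (\<Sum>i<codim n P. (b \<circ> e) i * h i)) = retr n (c * p - c * retr n p)"
      unfolding cb(2) by (simp add: h_def reindex[of "\<lambda>k. b k * g k"])
    also have "\<dots> = 0" by (simp add: retr_diff retr_mult)
    finally show "\<exists>c b. c \<notin> P \<and> retr n (c * p - (\<Sum>i<codim n P. b i * h i)) = 0"
      using cb(1) by blast
  qed
  moreover have "indep_mod P {..<n} (codim n P) (\<lambda>i. grad (h i))"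
    unfolding indep_mod_def
  proof (intro allI impI)
    fix a i assume a: "\<forall>l\<in>{..<n}. (\<Sum>i<codim n P. a i * pderiv_mpoly l (h i)) \<in> P" and i: "i < codim n P"
    define a' where "a' = a \<circ> the_inv_into {..<codim n P} e"
    have a': "a' (e i) = a i" if "i < codim n P" for i
      using e that by (simp add: a'_def the_inv_into_f_f bij_betw_def)
    have "(\<Sum>k\<in>V. a' k * pderiv_mpoly l (g k)) \<in> P" if "l \<in> V" for l
    proof -
      have "(\<Sum>k\<in>V. a' k * pderiv_mpoly l (g k)) = (\<Sum>i<codim n P. a i * pderiv_mpoly l (h i))"
        unfolding reindex[of "\<lambda>k. a' k * pderiv_mpoly l (g k)", symmetric]
        by (rule sum.cong) (auto simp: a' h_def)
      then show ?thesis using a that by (auto simp: V_def)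
    qed
    then have "\<forall>k\<in>V. a' k \<in> P" by (rule g(2)[OF ballI])
    then show "a i \<in> P" using a'[OF i] eV[OF i] by fastforce
  qed
  ultimately show ?thesis by blast
qed

text \<open>In the product rule, the terms in which a coefficient is differentiated carry a factor
  \<open>p\<close> or \<open>h i\<close> from P. So a linear relation between elements of P passes
  to their gradients modulo P.\<close>

lemma grad_in_span:
  fixes N n :: nat
  assumes P: "prime_over n P" and "c \<notin> P" "p \<in> P" "\<And>i. i < N \<Longrightarrow> h i \<in> P"
    and w: "w = c * p - (\<Sum>i<N. b i * h i)" "\<And>l. l < n \<Longrightarrow> pderiv_mpoly l w \<in> P"
  shows "\<forall>l\<in>{..<n}. c * pderiv_mpoly l p - (\<Sum>i<N. b i * pderiv_mpoly l (h i)) \<in> P"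
proof
  fix l assume l: "l \<in> {..<n}"
  note id = prime_over_is_ideal[OF P]
  have "c * pderiv_mpoly l p - (\<Sum>i<N. b i * pderiv_mpoly l (h i))
      = pderiv_mpoly l w - pderiv_mpoly l c * p + (\<Sum>i<N. pderiv_mpoly l (b i) * h i)"
    by (simp add: w(1) pd_diff pd_sum pd_mult sum.distrib algebra_simps)
  also have "\<dots> \<in> P"
    using assms l by (intro ideal_add ideal_diff ideal_mult ideal_sum id w(2)) auto
  finally show "c * pderiv_mpoly l p - (\<Sum>i<N. b i * pderiv_mpoly l (h i)) \<in> P" .
qed

lemma generates_locally_grad:
  assumes P: "prime_over n P" and g: "generates_locally n P N h" and p: "p \<in> P"
  shows "\<exists>c b. c \<notin> P \<and> (\<forall>l\<in>{..<n}. c * pderiv_mpoly l p - (\<Sum>i<N. b i * pderiv_mpoly l (h i)) \<in> P)"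
proof -
  obtain c b where cb: "c \<notin> P" "retr n (c * p - (\<Sum>i<N. b i * h i)) = 0"
    using g p unfolding generates_locally_def by blast
  then show ?thesis
    using grad_in_span[OF P cb(1) p _ refl, of N h b] prime_over_pd[OF P cb(2)] g
    unfolding generates_locally_def by blast
qed

text \<open>The gradients of the local generators span the gradients of all elements of P, so their
  number bounds the rank.\<close>

lemma indep_grad_le_codim:
  fixes P :: "'k::field_char_0 mpoly set"
  assumes P: "prime_over n P" and "indep_mod P {..<n} N (\<lambda>i. grad (h i))" "\<And>i. i < N \<Longrightarrow> h i \<in> P"
  shows "N \<le> codim n P"
proof -
  obtain g where g: "generates_locally n P (codim n P) g"
    using exists_local_generators[OF P] by blast
  have "N \<le> card {..<codim n P}"
    using indep_mod_le_card_of_spanned[OF prime_over_is_prime[OF P] assms(2), of "{..<codim n P}" "\<lambda>i. grad (g i)"]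
      generates_locally_grad[OF P g assms(3)] by simp
  then show ?thesis by simp
qed

text \<open>The opposite bound: the gradients of the local generators are independent, so fewer than
  \<open>codim n P\<close> vectors cannot span them. This provides the extra row of an (r + 1)-minor
  at a larger prime.\<close>

lemma exists_grad_notin_span:
  fixes P :: "'k::field_char_0 mpoly set"
  assumes P: "prime_over n P" and "k < codim n P"
  shows "\<exists>p\<in>P. \<not> in_span_mod P {..<n} k (\<lambda>i. grad (h i)) (grad p)"
proof (rule ccontr)
  assume a: "\<not> ?thesis"
  obtain g where g: "generates_locally n P (codim n P) g"
    "indep_mod P {..<n} (codim n P) (\<lambda>i. grad (g i))"
    using exists_local_generators[OF P] by blast
  have "codim n P \<le> card {..<k}"
    using indep_mod_le_card_of_spanned[OF prime_over_is_prime[OF P] g(2), of "{..<k}" "\<lambda>i. grad (h i)"]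
      a g(1) unfolding in_span_mod_def generates_locally_def by auto
  then show False using assms by simp
qed

text \<open>The matrix \<open>b\<close> that expresses \<open>h\<close> through known local
  generators \<open>g\<close> is invertible modulo P, because the gradients of \<open>h\<close> are
  independent; its adjugate then expresses \<open>g\<close> through \<open>h\<close>, with a minor
  of \<open>b\<close> as denominator.\<close>

lemma generates_locally_of_indep:
  fixes P :: "'k::field_char_0 mpoly set"
  assumes P: "prime_over n P" and ind: "indep_mod P {..<n} (codim n P) (\<lambda>i. grad (h i))"
    and hP: "\<And>i. i < codim n P \<Longrightarrow> h i \<in> P"
  shows "generates_locally n P (codim n P) h"
proof -
  define N where "N = codim n P"
  note P' = prime_over_is_prime[OF P] and id = prime_over_is_ideal[OF P]
  obtain g where g: "generates_locally n P N g"
    using exists_local_generators[OF P] N_def by blast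
  have gP: "\<And>j. j < N \<Longrightarrow> g j \<in> P" using g by (simp add: generates_locally_def)
  have "\<exists>c b. c \<notin> P \<and> retr n (c * h i - (\<Sum>j<N. b j * g j)) = 0" if "i < N" for i
    using g hP that unfolding generates_locally_def N_def by blast
  then obtain c b where cb: "\<And>i. i < N \<Longrightarrow> c i \<notin> P"
    "\<And>i. i < N \<Longrightarrow> retr n (c i * h i - (\<Sum>j<N. b i j * g j)) = 0"
    by metis
  have gr: "c i * pderiv_mpoly l (h i) - (\<Sum>j<N. b i j * pderiv_mpoly l (g j)) \<in> P"
    if "i < N" "l < n" for i l
  proof -
    have "\<And>l. l < n \<Longrightarrow> pderiv_mpoly l (c i * h i - (\<Sum>j<N. b i j * g j)) \<in> P"
      using prime_over_pd[OF P cb(2)] that(1) by blast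
    from grad_in_span[OF P cb(1)[OF that(1)] _ gP refl this] show ?thesis
      using hP that unfolding N_def by blast
  qed
  \<comment> \<open>A relation between the rows of \<open>b\<close> gives one between the gradients
    of the \<open>h i\<close>, with its coefficients multiplied by the denominators
    \<open>c i\<close>.\<close>
  have "indep_mod P {..<N} N b"
    unfolding indep_mod_def
  proof (intro allI impI)
    fix a i assume a: "\<forall>l\<in>{..<N}. (\<Sum>i<N. a i * b i l) \<in> P" and i: "i < N"
    have "(\<Sum>i<N. a i * c i * pderiv_mpoly l (h i)) \<in> P" if l: "l \<in> {..<n}" for l
    proof -
      have "(\<Sum>i<N. a i * c i * pderiv_mpoly l (h i)) =
        (\<Sum>i<N. a i * (c i * pderiv_mpoly l (h i) - (\<Sum>j<N. b i j * pderiv_mpoly l (g j))))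
        + (\<Sum>i<N. a i * (\<Sum>j<N. b i j * pderiv_mpoly l (g j)))"
        unfolding sum.distrib[symmetric] by (rule sum.cong) (simp_all add: right_diff_distrib mult.assoc)
      also have "(\<Sum>i<N. a i * (\<Sum>j<N. b i j * pderiv_mpoly l (g j)))
          = (\<Sum>j<N. (\<Sum>i<N. a i * b i j) * pderiv_mpoly l (g j))"
        by (simp add: sum_distrib_left sum_distrib_right mult.assoc) (rule sum.swap)
      finally have eq: "(\<Sum>i<N. a i * c i * pderiv_mpoly l (h i)) =
        (\<Sum>i<N. a i * (c i * pderiv_mpoly l (h i) - (\<Sum>j<N. b i j * pderiv_mpoly l (g j))))
        + (\<Sum>j<N. (\<Sum>i<N. a i * b i j) * pderiv_mpoly l (g j))" .
      show ?thesis unfolding eq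
      proof (intro ideal_add[OF id] ideal_sum[OF id])
        show "a i * (c i * pderiv_mpoly l (h i) - (\<Sum>j<N. b i j * pderiv_mpoly l (g j))) \<in> P"
          if "i \<in> {..<N}" for i
          using gr[of i l] l that by (intro ideal_mult[OF id]) simp
        show "(\<Sum>i<N. a i * b i j) * pderiv_mpoly l (g j) \<in> P" if "j \<in> {..<N}" for j
          using a that by (intro ideal_mult2[OF id]) blast
      qed
    qed
    then have "\<forall>i<N. a i * c i \<in> P"
      using ind[unfolded indep_mod_def, THEN spec, of "\<lambda>i. a i * c i"] unfolding N_def by simp
    then show "a i \<in> P" using i cb(1) by (simp add: prime_mult[OF P'])
  qed
  then obtain js where js: "length js = N" "set js \<subseteq> {..<N}" "minor b N js \<notin> P"
    using exists_minor_of_indep_mod[OF P'] by blast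
  have "distinct js"
    using sorted_minor_notin[OF id js(1,3)] by (simp add: strict_sorted_iff)
  then have setjs: "set js = {..<N}"
    using js by (intro card_subset_eq) (auto simp: distinct_card)
  define D where "D = minor b N js"
  have "\<exists>e. retr n (D * g m - (\<Sum>i<N. e i * h i)) = 0" if m: "m < N" for m
  proof -
    obtain j where j: "j < N" "m = js ! j" using m setjs js(1) by (metis in_set_conv_nth lessThan_iff)
    define A where "A = minor_adj b N js j"
    have col: "(\<Sum>i<N. A i * b i m') = (if m = m' then D else 0)" if m': "m' < N" for m'
    proof -
      obtain j' where j': "j' < N" "m' = js ! j'" using m' setjs js(1) by (metis in_set_conv_nth lessThan_iff)
      have "j = j' \<longleftrightarrow> m = m'" using j j' \<open>distinct js\<close> js(1) by (simp add: nth_eq_iff_index_eq)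
      then show ?thesis using minor_adj_left[OF j(1) j'(1), of b js] j' by (simp add: A_def D_def)
    qed
    have "(\<Sum>i<N. A i * (\<Sum>j<N. b i j * g j)) = (\<Sum>j<N. (\<Sum>i<N. A i * b i j) * g j)"
      by (simp add: sum_distrib_left sum_distrib_right mult.assoc) (rule sum.swap)
    also have "\<dots> = (\<Sum>j<N. (if m = j then D else 0) * g j)"
      by (rule sum.cong) (auto simp: col)
    also have "\<dots> = D * g m"
      using m by (simp add: if_distrib[of "\<lambda>x. x * _"] sum.delta cong: if_cong)
    finally have eq: "(\<Sum>i<N. A i * (\<Sum>j<N. b i j * g j)) = D * g m" .
    have "D * g m - (\<Sum>i<N. A i * c i * h i) = (\<Sum>i<N. - A i * (c i * h i - (\<Sum>j<N. b i j * g j)))"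
      unfolding eq[symmetric] sum_subtractf[symmetric] by (rule sum.cong) (simp_all add: algebra_simps)
    then have "retr n (D * g m - (\<Sum>i<N. A i * c i * h i)) = 0"
      using cb(2) by (simp add: retr_sum retr_mult retr_uminus)
    then show ?thesis by (intro exI[of _ "\<lambda>i. A i * c i"])
  qed
  then obtain e where e: "\<And>m. m < N \<Longrightarrow> retr n (D * g m - (\<Sum>i<N. e m i * h i)) = 0"
    by metis
  have "\<exists>c b. c \<notin> P \<and> retr n (c * p - (\<Sum>i<N. b i * h i)) = 0" if p: "p \<in> P" for p
  proof -
    obtain c' b' where c': "c' \<notin> P" "retr n (c' * p - (\<Sum>j<N. b' j * g j)) = 0"
      using g p unfolding generates_locally_def by blast
    have "D * c' * p - (\<Sum>i<N. (\<Sum>m<N. b' m * e m i) * h i)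
      = D * (c' * p - (\<Sum>j<N. b' j * g j)) + (\<Sum>m<N. b' m * (D * g m - (\<Sum>i<N. e m i * h i)))"
    proof -
      have "(\<Sum>i<N. (\<Sum>m<N. b' m * e m i) * h i) = (\<Sum>m<N. b' m * (\<Sum>i<N. e m i * h i))"
        by (simp add: sum_distrib_left sum_distrib_right mult.assoc) (rule sum.swap)
      moreover have "(\<Sum>m<N. b' m * (D * g m - (\<Sum>i<N. e m i * h i)))
          = D * (\<Sum>j<N. b' j * g j) - (\<Sum>m<N. b' m * (\<Sum>i<N. e m i * h i))"
        unfolding sum_distrib_left sum_subtractf[symmetric] by (rule sum.cong) (simp_all add: algebra_simps sum_distrib_left)
      ultimately show ?thesis by (simp add: algebra_simps)
    qed
    then have "retr n (D * c' * p - (\<Sum>i<N. (\<Sum>m<N. b' m * e m i) * h i)) = 0"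
      using c'(2) e by (simp add: retr_add retr_mult retr_sum)
    moreover have "D * c' \<notin> P" using js(3) c'(1) by (simp add: D_def prime_mult[OF P'])
    ultimately show ?thesis
      by (intro exI[of _ "D * c'"] exI[of _ "\<lambda>i. \<Sum>m<N. b' m * e m i"]) simp
  qed
  then show ?thesis unfolding generates_locally_def N_def[symmetric] using hP N_def by blast
qed

text \<open>A transcendence basis of the larger prime that is also one of the smaller prime would force all
  minimal equations of the two primes to agree.\<close>

lemma codim_strict_mono:
  fixes P :: "'k::field_char_0 mpoly set"
  assumes I: "prime_over n I" and P: "prime_over n P" and IP: "I \<subset> P"
  shows "codim n I < codim n P"
proof (rule ccontr)
  assume neg: "\<not> codim n I < codim n P"
  note I' = prime_over_is_prime[OF I] and P' = prime_over_is_prime[OF P]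
  have tr: "trans_deg n I \<le> trans_deg n P"
    using neg trans_deg_le[OF I', of n] trans_deg_le[OF P', of n] by (simp add: codim_def)
  obtain T where T: "T \<subseteq> {..<n}" "alg_indep_vars P T" "card T = trans_deg n P"
    using trans_deg_attained[OF P'] by blast
  have TI: "alg_indep_vars I T" using T(2) IP by (auto simp: alg_indep_vars_def)
  \<comment> \<open>A transcendence basis modulo P is independent modulo the smaller I, and by the
    assumption on the codimensions it has maximal size there too.\<close>
  have cTI: "card T = trans_deg n I"
    using card_le_trans_deg[OF T(1) TI] T(3) tr by simp
  have "P \<inter> polys_in (T \<union> V) \<subseteq> I" if "finite V" "V \<subseteq> {..<n} - T" for V
    using that
  proof (induction V rule: finite_induct)
    case empty
    then show ?case using T(2) ideal_0[OF prime_over_is_ideal[OF I]] by (auto simp: alg_indep_vars_def)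
  next
    case (insert k V)
    let ?B = "polys_in (T \<union> V)"
    let ?x = "mpoly_var k :: 'k mpoly"
    note B = is_subring_polys_in[of "T \<union> V"] and idI = prime_over_is_ideal[OF I]
    have IH: "P \<inter> ?B \<subseteq> I" using insert by auto
    obtain g where g: "minimal_eq I ?B ?x g"
      using exists_minimal_eq[OF I' T(1) TI cTI, of k "T \<union> V"] insert.prems by auto
    have gB: "g \<in> polys_over ?B" "poly g ?x \<in> I" "lead_coeff g \<notin> I" using g by (auto simp: minimal_eq_def)
    \<comment> \<open>The leading coefficient involves only the variables in T and V, where P is
      contained in I by the induction hypothesis. Hence \<open>g\<close> competes with the minimal
      equation \<open>g'\<close> modulo P.\<close>
    have lgP: "lead_coeff g \<notin> P" using IH gB lead_coeff_in by blast
    obtain g' where g': "minimal_eq P ?B ?x g'"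
      using exists_minimal_eq[OF P' T, of k "T \<union> V"] insert.prems by auto
    have g'B: "g' \<in> polys_over ?B" "poly g' ?x \<in> P" "lead_coeff g' \<notin> P" using g' by (auto simp: minimal_eq_def)
    have lg'I: "lead_coeff g' \<notin> I" using g'B IP by auto
    have dg': "degree g' > 0" using minimal_eq_degree_pos[OF P' g'] .
    have deg: "degree g' \<le> degree g" using g' gB IP lgP by (auto simp: minimal_eq_def)
    have division: "\<exists>N q r. q \<in> polys_over ?B \<and> smult (lead_coeff g' ^ N) f = q * g' + r \<and>
       degree r < degree g' \<and> poly r ?x \<in> I" if f: "f \<in> polys_over ?B" "poly f ?x \<in> P" for f
    proof -
      obtain N q r where *: "q \<in> polys_over ?B" "r \<in> polys_over ?B"
        "smult (lead_coeff g' ^ N) f = q * g' + r" "degree r < degree g'" "\<forall>i. coeff r i \<in> P"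
        using pseudo_division_minimal_eq[OF P' B g' f] by blast
      have "coeff r i \<in> I" for i using * IH by (auto simp: polys_over_def)
      then show ?thesis using * poly_in_ideal[OF idI] by blast
    qed
    obtain N q r where qr: "q \<in> polys_over ?B" "smult (lead_coeff g' ^ N) g = q * g' + r"
      "degree r < degree g'" "poly r ?x \<in> I"
      using division[OF gB(1)] gB IP by blast
    have "poly q ?x * poly g' ?x = lead_coeff g' ^ N * poly g ?x - poly r ?x"
      using arg_cong[OF qr(2), of "\<lambda>p. poly p ?x"] by simp
    also have "\<dots> \<in> I" by (intro ideal_diff ideal_mult idI gB qr)
    finally have "poly q ?x \<in> I \<or> poly g' ?x \<in> I" by (simp add: prime_mult[OF I'])
    \<comment> \<open>Otherwise, since \<open>q\<close> has smaller degree than \<open>g\<close>,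
      minimality of \<open>g\<close> puts the leading coefficient of \<open>q\<close> into I;
      comparing leading coefficients in the division then puts that of \<open>g\<close> or of
      \<open>g'\<close> there.\<close>
    moreover have "poly q ?x \<notin> I"
    proof
      assume qI: "poly q ?x \<in> I"
      have cN: "lead_coeff g' ^ N \<notin> I" using lg'I prime_power[OF I'] by blast
      then have cN0: "lead_coeff g' ^ N \<noteq> 0" using ideal_0[OF idI] by metis
      have dsm: "degree (smult (lead_coeff g' ^ N) g) = degree g"
        unfolding degree_smult_eq if_not_P[OF cN0] ..
      have q0: "q \<noteq> 0" using qr deg dsm by auto
      have g'0: "g' \<noteq> 0" using dg' by auto
      have dqg: "degree (q * g') = degree q + degree g'" using q0 g'0 by (rule degree_mult_eq)
      then have "degree (q * g' + r) = degree q + degree g'" using qr(3) by (simp add: degree_add_eq_left)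
      then have dg: "degree g = degree q + degree g'" using dsm qr(2) by simp
      have "coeff q (degree q) \<in> I"
        using minimal_eq_coeff_in[OF I' B g qr(1) qI] dg dg' by simp
      moreover have "lead_coeff g' ^ N * lead_coeff g = lead_coeff q * lead_coeff g'"
      proof -
        have "lead_coeff g' ^ N * lead_coeff g = coeff (q * g' + r) (degree q + degree g')"
          using dg by (simp flip: qr(2))
        also have "\<dots> = lead_coeff q * lead_coeff g'"
          using qr(3) by (simp add: coeff_mult_degree_sum coeff_eq_0)
        finally show ?thesis .
      qed
      ultimately have "lead_coeff g' ^ N * lead_coeff g \<in> I" using ideal_mult2[OF idI] by simp
      then show False using cN gB by (simp add: prime_mult[OF I'])
    qed
    ultimately have g'I: "poly g' ?x \<in> I" by simp
    show ?case
    proof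
      fix p assume "p \<in> P \<inter> polys_in (T \<union> insert k V)"
      then have p: "p \<in> P" "p \<in> polys_in (insert k (T \<union> V))" by auto
      obtain f where f: "f \<in> polys_over ?B" "p = poly f ?x"
        using polys_in_insert_eq_poly[OF p(2)] by blast
      obtain N q r where qr: "smult (lead_coeff g' ^ N) f = q * g' + r" "poly r ?x \<in> I"
        using division[OF f(1)] f p by blast
      have "lead_coeff g' ^ N * p = poly q ?x * poly g' ?x + poly r ?x"
        using arg_cong[OF qr(1), of "\<lambda>p. poly p ?x"] f by simp
      also have "\<dots> \<in> I" by (intro ideal_add ideal_mult idI qr g'I)
      finally show "p \<in> I" using lg'I prime_power[OF I'] by (auto simp: prime_mult[OF I'])
    qed
  qed
  from this[of "{..<n} - T"] have "P \<inter> polys_in {..<n} \<subseteq> I" using T(1) by (simp add: Un_absorb1)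
  then have "P \<subseteq> I" using prime_over_retr[OF I] prime_over_retr[OF P] retr_in by blast
  then show False using IP by auto
qed

lemma codim_mono:
  fixes P :: "'k::field_char_0 mpoly set"
  assumes "prime_over n I" "prime_over n P" "I \<subseteq> P"
  shows "codim n I \<le> codim n P"
  using codim_strict_mono[OF assms(1,2)] assms(3) by (cases "I = P") (auto simp: psubset_eq)

section \<open>Prime ideals stable under derivations\<close>

definition is_derivation :: "('a::comm_ring_1 \<Rightarrow> 'a) \<Rightarrow> bool" where
  "is_derivation D \<longleftrightarrow> (\<forall>x y. D (x + y) = D x + D y) \<and> (\<forall>x y. D (x * y) = D x * y + x * D y)"

lemma derivation_add: "is_derivation D \<Longrightarrow> D (x + y) = D x + D y"
  and derivation_mult: "is_derivation D \<Longrightarrow> D (x * y) = D x * y + x * D y"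
  by (auto simp: is_derivation_def)

lemma derivation_0: "is_derivation D \<Longrightarrow> D 0 = 0"
  using derivation_add[of D 0 0] by simp

lemma derivation_sum: "is_derivation D \<Longrightarrow> D (sum f S) = (\<Sum>i\<in>S. D (f i))"
  by (induction S rule: infinite_finite_induct) (auto simp: derivation_add derivation_0)

lemma derivation_of_nat_mult:
  assumes "is_derivation D" shows "D (of_nat k * x) = of_nat k * D x"
  by (induction k) (auto simp: derivation_0[OF assms] derivation_add[OF assms] algebra_simps)

lemma funpow_derivation_add: "is_derivation D \<Longrightarrow> (D ^^ k) (x + y) = (D ^^ k) x + (D ^^ k) y"
  by (induction k) (auto simp: derivation_add)

lemma leibniz_funpow:
  assumes D: "is_derivation D"
  shows "(D ^^ k) (x * y) = (\<Sum>i\<le>k. of_nat (k choose i) * ((D ^^ i) x * (D ^^ (k - i)) y))"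
proof (induction k)
  case (Suc k)
  let ?a = "\<lambda>i. (D ^^ i) x" and ?b = "\<lambda>i. (D ^^ i) y"
  have "(D ^^ Suc k) (x * y) = (\<Sum>i\<le>k. of_nat (k choose i) * D (?a i * ?b (k - i)))"
    by (simp add: Suc.IH derivation_sum[OF D] derivation_of_nat_mult[OF D])
  also have "\<dots> = (\<Sum>i\<le>k. of_nat (k choose i) * (?a (Suc i) * ?b (k - i)))
      + (\<Sum>i\<le>k. of_nat (k choose i) * (?a i * ?b (Suc k - i)))"
    unfolding sum.distrib[symmetric]
    by (rule sum.cong) (auto simp: derivation_mult[OF D] Suc_diff_le algebra_simps)
  also have "(\<Sum>i\<le>k. of_nat (k choose i) * (?a i * ?b (Suc k - i)))
      = (\<Sum>i\<le>Suc k. of_nat (k choose i) * (?a i * ?b (Suc k - i)))"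
    by (simp add: binomial_eq_0)
  also have "\<dots> = ?a 0 * ?b (Suc k) + (\<Sum>i\<le>k. of_nat (k choose Suc i) * (?a (Suc i) * ?b (k - i)))"
    by (subst sum.atMost_Suc_shift) simp
  also have "(\<Sum>i\<le>k. of_nat (k choose i) * (?a (Suc i) * ?b (k - i))) +
      (?a 0 * ?b (Suc k) + (\<Sum>i\<le>k. of_nat (k choose Suc i) * (?a (Suc i) * ?b (k - i))))
      = ?a 0 * ?b (Suc k) + (\<Sum>i\<le>k. of_nat (Suc k choose Suc i) * (?a (Suc i) * ?b (k - i)))"
    by (simp add: sum.distrib algebra_simps)
  also have "\<dots> = (\<Sum>i\<le>Suc k. of_nat (Suc k choose i) * (?a i * ?b (Suc k - i)))"
    by (subst sum.atMost_Suc_shift) simp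
  finally show ?case .
qed simp

text \<open>For a derivation D and an ideal P this is the largest ideal inside P that D maps into
  itself.\<close>

definition derivation_core :: "('a \<Rightarrow> 'a) \<Rightarrow> 'a::comm_ring_1 set \<Rightarrow> 'a set" where
  "derivation_core D P = {x. \<forall>i. (D ^^ i) x \<in> P}"

lemma derivation_core_subset: "derivation_core D P \<subseteq> P"
  unfolding derivation_core_def by (auto dest: spec[of _ 0])

text \<open>The lowest derivatives leaving \<open>P\<close> multiply, up to a binomial coefficient.\<close>

lemma derivation_core_prime:
  fixes P :: "'k::field_char_0 mpoly set"
  assumes P: "is_prime P" and D: "is_derivation D"
  shows "is_prime (derivation_core D P)"
  unfolding is_prime_def
proof (intro conjI allI impI)
  note id = is_prime_is_ideal[OF P]
  have z: "(D ^^ i) 0 = 0" for i by (induction i) (auto simp: derivation_0[OF D])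
  show "is_ideal (derivation_core D P)"
    unfolding is_ideal_def derivation_core_def
    by (auto simp: z ideal_0[OF id] funpow_derivation_add[OF D] leibniz_funpow[OF D] intro: ideal_add[OF id]
        intro!: ideal_sum[OF id] ideal_mult[OF id])
  show "1 \<notin> derivation_core D P"
    using derivation_core_subset prime_1[OF P] by blast
next
  fix x y assume xy: "x * y \<in> derivation_core D P"
  note id = is_prime_is_ideal[OF P]
  show "x \<in> derivation_core D P \<or> y \<in> derivation_core D P"
  proof (rule ccontr)
    assume "\<not> ?thesis"
    then have ex: "\<exists>i. (D ^^ i) x \<notin> P" "\<exists>i. (D ^^ i) y \<notin> P" by (auto simp: derivation_core_def)
    define e where "e = (LEAST i. (D ^^ i) x \<notin> P)"
    define e' where "e' = (LEAST i. (D ^^ i) y \<notin> P)"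
    have e: "(D ^^ e) x \<notin> P" "\<And>i. i < e \<Longrightarrow> (D ^^ i) x \<in> P"
      unfolding e_def using LeastI_ex[OF ex(1)] not_less_Least by auto
    have e': "(D ^^ e') y \<notin> P" "\<And>i. i < e' \<Longrightarrow> (D ^^ i) y \<in> P"
      unfolding e'_def using LeastI_ex[OF ex(2)] not_less_Least by auto
    \<comment> \<open>At order \<open>e + e'\<close> every term except the \<open>e\<close>-th
      contains a derivative of \<open>x\<close> of order below \<open>e\<close> or one of
      \<open>y\<close> of order below \<open>e'\<close>.\<close>
    let ?t = "\<lambda>i. of_nat ((e + e') choose i) * ((D ^^ i) x * (D ^^ (e + e' - i)) y)"
    have "(\<Sum>i\<in>{..e + e'}-{e}. ?t i) \<in> P"
    proof (rule ideal_sum[OF id])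
      fix i assume i: "i \<in> {..e + e'} - {e}"
      show "?t i \<in> P"
      proof (cases "i < e")
        case True
        then show ?thesis by (intro ideal_mult[OF id] ideal_mult2[OF id] e)
      next
        case False
        then show ?thesis using i by (intro ideal_mult[OF id] e') auto
      qed
    qed
    moreover have "(D ^^ (e + e')) (x * y) \<in> P" using xy by (auto simp: derivation_core_def)
    moreover have "(D ^^ (e + e')) (x * y) = ?t e + (\<Sum>i\<in>{..e + e'}-{e}. ?t i)"
      unfolding leibniz_funpow[OF D] by (rule sum.remove) auto
    ultimately have "?t e \<in> P" using ideal_diff[OF id] by fastforce
    moreover have "of_nat ((e + e') choose e) \<notin> P" by (rule prime_of_nat[OF P]) simp
    ultimately show False using e(1) e'(1) by (simp add: prime_mult[OF P])
  qed
qed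

text \<open>A prime Q of least codimension between S and P is stable under all of DD at once: for
  each D the core of Q is again such a prime, and being contained in Q without having smaller
  codimension it equals Q. In this way derivations that do not commute are treated one at a time. S
  contains the kernel of \<open>retr\<close> so that the cores do as well.\<close>

lemma exists_stable_prime:
  fixes P :: "'k::field_char_0 mpoly set"
  assumes P: "prime_over n P" and S: "S \<subseteq> P" "\<And>p. retr n p = 0 \<Longrightarrow> p \<in> S"
    and D: "\<And>D. D \<in> DD \<Longrightarrow> is_derivation D" "\<And>D x. D \<in> DD \<Longrightarrow> x \<in> S \<Longrightarrow> D x \<in> S"
  shows "\<exists>Q. prime_over n Q \<and> S \<subseteq> Q \<and> Q \<subseteq> P \<and> (\<forall>D\<in>DD. \<forall>x\<in>Q. D x \<in> Q)"
proof -
  let ?C = "\<lambda>Q. prime_over n Q \<and> S \<subseteq> Q \<and> Q \<subseteq> P"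
  obtain Q where Q: "?C Q" and least: "\<And>Q'. ?C Q' \<Longrightarrow> codim n Q \<le> codim n Q'"
    using ex_has_least_nat[of ?C P "codim n"] P S by blast
  have "D x \<in> Q" if "D \<in> DD" "x \<in> Q" for D x
  proof (rule ccontr)
    assume "D x \<notin> Q"
    let ?Q' = "derivation_core D Q"
    have "(D ^^ i) s \<in> S" if "s \<in> S" for s i
      using that by (induction i) (auto intro: D \<open>D \<in> DD\<close>)
    then have "S \<subseteq> ?Q'" using Q by (auto simp: derivation_core_def)
    moreover have "is_prime ?Q'" using derivation_core_prime[OF _ D(1)] Q that by (auto simp: prime_over_def)
    ultimately have Q': "?C ?Q'" using Q S derivation_core_subset[of D Q] by (auto simp: prime_over_def)
    have "x \<notin> ?Q'" using \<open>D x \<notin> Q\<close> by (auto simp: derivation_core_def intro!: exI[of _ 1])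
    then have "?Q' \<subset> Q" using that derivation_core_subset by blast
    then have "codim n ?Q' < codim n Q" using codim_strict_mono Q Q' by blast
    then show False using least[OF Q'] by simp
  qed
  then show ?thesis using Q by blast
qed

section \<open>Hilbert's basis theorem\<close>

definition is_subideal :: "'a::comm_ring_1 set \<Rightarrow> 'a set \<Rightarrow> bool" where
  "is_subideal B J \<longleftrightarrow> J \<subseteq> B \<and> 0 \<in> J \<and> (\<forall>x\<in>J. \<forall>y\<in>J. x + y \<in> J) \<and> (\<forall>a\<in>B. \<forall>x\<in>J. a * x \<in> J)"

text \<open>Generation is expressed by minimality among the ideals containing G, which spares
  explicit linear combinations.\<close>

definition finitely_generated_in :: "'a::comm_ring_1 set \<Rightarrow> 'a set \<Rightarrow> bool" where
  "finitely_generated_in B J \<longleftrightarrow>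
     (\<exists>G. finite G \<and> G \<subseteq> J \<and> (\<forall>J'. is_subideal B J' \<longrightarrow> G \<subseteq> J' \<longrightarrow> J \<subseteq> J'))"

definition noetherian_subring :: "'a::comm_ring_1 set \<Rightarrow> bool" where
  "noetherian_subring B \<longleftrightarrow> is_subring B \<and> (\<forall>J. is_subideal B J \<longrightarrow> finitely_generated_in B J)"

lemma noetherian_subring_constants: "noetherian_subring (polys_in {} :: 'k::field mpoly set)"
  unfolding noetherian_subring_def
proof (intro conjI allI impI)
  fix J :: "'k mpoly set"
  assume J: "is_subideal (polys_in {}) J"
  show "finitely_generated_in (polys_in {}) J"
  proof (cases "J \<subseteq> {0}")
    case True
    then show ?thesis unfolding finitely_generated_in_def is_subideal_def
      by (intro exI[of _ "{}"]) auto
  next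
    case False
    then obtain p where p: "p \<in> J" "p \<noteq> 0" by auto
    then obtain c where c: "p = mpoly_const c" "c \<noteq> 0"
      using J polys_in_empty[of p] unfolding is_subideal_def by (metis mpoly_const_0 subsetD)
    have "J \<subseteq> J'" if J': "is_subideal (polys_in {}) J'" "{p} \<subseteq> J'" for J'
    proof
      fix q assume "q \<in> J"
      then obtain d where "q = mpoly_const d" using J polys_in_empty[of q] by (auto simp: is_subideal_def)
      then have "q = mpoly_const (d / c) * p" using c by (simp flip: mpoly_const_mult)
      then show "q \<in> J'" using J' by (simp add: is_subideal_def)
    qed
    then show ?thesis unfolding finitely_generated_in_def using p by (intro exI[of _ "{p}"]) auto
  qed
qed (rule is_subring_polys_in)

lemma is_subring_poly_image:
  assumes B: "is_subring B" shows "is_subring ((\<lambda>q. poly q x) ` polys_over B)"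
  unfolding is_subring_def
proof (intro conjI ballI)
  show "1 \<in> (\<lambda>q. poly q x) ` polys_over B"
    by (rule image_eqI[of _ _ 1]) (auto simp: polys_over_def coeff_1 subring_0[OF B] subring_1[OF B])
next
  fix u v assume "u \<in> (\<lambda>q. poly q x) ` polys_over B" "v \<in> (\<lambda>q. poly q x) ` polys_over B"
  then obtain p q where pq: "p \<in> polys_over B" "q \<in> polys_over B" "u = poly p x" "v = poly q x" by auto
  show "u - v \<in> (\<lambda>q. poly q x) ` polys_over B"
    by (rule image_eqI[of _ _ "p - q"]) (use pq B in \<open>auto intro: polys_over_diff\<close>)
  show "u * v \<in> (\<lambda>q. poly q x) ` polys_over B"
    by (rule image_eqI[of _ _ "p * q"]) (use pq B in \<open>auto intro: polys_over_mult\<close>)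
qed

text \<open>Hilbert's argument for the ring obtained from B by adjoining an element \<open>x\<close>
  of the ambient ring: ideals are pulled back to polynomials over B along evaluation at
  \<open>x\<close> and controlled by their leading coefficients in each degree.\<close>

lemma noetherian_subring_adjoin:
  fixes B :: "'a::comm_ring_1 set"
  assumes B: "noetherian_subring B"
  shows "noetherian_subring ((\<lambda>q. poly q x) ` polys_over B)" (is "noetherian_subring ?B'")
  unfolding noetherian_subring_def
proof (intro conjI allI impI)
  have sB: "is_subring B" using B by (simp add: noetherian_subring_def)
  show sB': "is_subring ?B'" by (rule is_subring_poly_image[OF sB])
  fix J assume J: "is_subideal ?B' J"
  define J' where "J' = {q \<in> polys_over B. poly q x \<in> J}"
  have mono1: "monom 1 d \<in> polys_over B" for d
    using sB by (intro polys_over_monom subring_1)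
  have xB': "x ^ d \<in> ?B'" for d
    by (rule image_eqI[OF _ mono1[of d]]) (simp add: poly_monom)
  have cB': "b \<in> ?B'" if "b \<in> B" for b
    by (rule image_eqI[of _ _ "[:b:]"]) (use that sB in \<open>auto simp: polys_over_def coeff_pCons subring_0 split: nat.split\<close>)
  have J'diff: "p - q \<in> J'" if "p \<in> J'" "q \<in> J'" for p q
  proof -
    have "- 1 \<in> B" using subring_diff[OF sB subring_0[OF sB] subring_1[OF sB]] by simp
    then have "(-1) * poly q x \<in> J"
      using J that cB'[of "-1"] unfolding J'_def is_subideal_def by blast
    then have "poly p x + (-1) * poly q x \<in> J"
      using J that unfolding J'_def is_subideal_def by blast
    then show ?thesis using that polys_over_diff[OF sB] by (simp add: J'_def)
  qed
  define L where "L = (\<lambda>d. {c. \<exists>q\<in>J'. degree q \<le> d \<and> coeff q d = c})"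
  text \<open>With \<open>J1 = J\<close> this says that the leading coefficients form an ideal; the general form is used to
    show that a subideal \<open>J1\<close> containing the generators exhausts \<open>J\<close>.\<close>
  have ideal_lead: "is_subideal B {c. \<exists>q\<in>J'. degree q \<le> d \<and> coeff q d = c \<and> poly q x \<in> J1}"
    if J1: "is_subideal ?B' J1" for d J1
    unfolding is_subideal_def
  proof (intro conjI ballI)
    show "{c. \<exists>q\<in>J'. degree q \<le> d \<and> coeff q d = c \<and> poly q x \<in> J1} \<subseteq> B"
      by (auto simp: J'_def polys_over_def)
    have "0 \<in> J'" using J sB by (auto simp: J'_def polys_over_def is_subideal_def subring_0)
    then show "0 \<in> {c. \<exists>q\<in>J'. degree q \<le> d \<and> coeff q d = c \<and> poly q x \<in> J1}"
      using J1 by (auto simp: is_subideal_def intro!: bexI[of _ 0])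
  next
    fix c c' assume "c \<in> {c. \<exists>q\<in>J'. degree q \<le> d \<and> coeff q d = c \<and> poly q x \<in> J1}"
      "c' \<in> {c. \<exists>q\<in>J'. degree q \<le> d \<and> coeff q d = c \<and> poly q x \<in> J1}"
    then obtain q q' where q: "q \<in> J'" "degree q \<le> d" "coeff q d = c" "poly q x \<in> J1"
      "q' \<in> J'" "degree q' \<le> d" "coeff q' d = c'" "poly q' x \<in> J1" by auto
    have "q + q' \<in> J'" "poly (q + q') x \<in> J1" using q J J1 polys_over_add[OF sB] by (auto simp: J'_def is_subideal_def)
    then show "c + c' \<in> {c. \<exists>q\<in>J'. degree q \<le> d \<and> coeff q d = c \<and> poly q x \<in> J1}"
      using q degree_add_le[of q d q'] by (auto intro!: bexI[of _ "q + q'"])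
  next
    fix a c assume a: "a \<in> B" and "c \<in> {c. \<exists>q\<in>J'. degree q \<le> d \<and> coeff q d = c \<and> poly q x \<in> J1}"
    then obtain q where q: "q \<in> J'" "degree q \<le> d" "coeff q d = c" "poly q x \<in> J1" by auto
    have "smult a q \<in> J'" "poly (smult a q) x \<in> J1"
      using q J J1 a polys_over_smult[OF sB a] cB'[OF a] by (auto simp: J'_def is_subideal_def)
    then show "a * c \<in> {c. \<exists>q\<in>J'. degree q \<le> d \<and> coeff q d = c \<and> poly q x \<in> J1}"
      using q degree_smult_le[of a q] by (auto intro!: bexI[of _ "smult a q"])
  qed
  have L_ideal: "is_subideal B (L d)" for d
  proof -
    have "L d = {c. \<exists>q\<in>J'. degree q \<le> d \<and> coeff q d = c \<and> poly q x \<in> J}"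
      by (auto simp: L_def J'_def)
    then show ?thesis using ideal_lead[OF J, of d] by simp
  qed
  have shift: "monom 1 k * q \<in> J'" "degree (monom 1 k * q) \<le> d + k" "coeff (monom 1 k * q) (d + k) = coeff q d"
    "poly (monom 1 k * q) x = x ^ k * poly q x"
    if q: "q \<in> J'" "degree q \<le> d" for q k d
  proof -
    show p: "poly (monom 1 k * q) x = x ^ k * poly q x" by (simp add: poly_monom)
    show "monom 1 k * q \<in> J'"
    proof -
      have "x ^ k * poly q x \<in> J"
        using q(1) J xB'[of k] unfolding J'_def is_subideal_def by blast
      then show ?thesis using q(1) polys_over_mult[OF sB mono1] p unfolding J'_def by simp
    qed
    show "degree (monom 1 k * q) \<le> d + k"
      using degree_mult_le[of "monom 1 k" q] degree_monom_le[of "1::'a" k] q by linarith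
    show "coeff (monom 1 k * q) (d + k) = coeff q d" by (simp add: coeff_monom_mult)
  qed
  have L_mono: "L d \<subseteq> L (d + k)" for d k
    using shift(1-3)[where k = k] unfolding L_def by blast
  have L_mono': "L d \<subseteq> L e" if "d \<le> e" for d e
    using L_mono[of d "e - d"] that by simp
  have "is_subideal B (\<Union>d. L d)"
    unfolding is_subideal_def
  proof (intro conjI ballI)
    fix c c' assume "c \<in> (\<Union>d. L d)" "c' \<in> (\<Union>d. L d)"
    then obtain d d' where "c \<in> L d" "c' \<in> L d'" by auto
    then have "c \<in> L (max d d')" "c' \<in> L (max d d')" using L_mono' by (meson max.cobounded1 max.cobounded2 subsetD)+
    then show "c + c' \<in> (\<Union>d. L d)" using L_ideal unfolding is_subideal_def by blast
  next
    show "(\<Union>d. L d) \<subseteq> B" using L_ideal unfolding is_subideal_def by blast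
    show "0 \<in> (\<Union>d. L d)" using L_ideal unfolding is_subideal_def by blast
    show "a * c \<in> (\<Union>d. L d)" if "a \<in> B" "c \<in> (\<Union>d. L d)" for a c
      using L_ideal that unfolding is_subideal_def by blast
  qed
  then obtain GL where GL: "finite GL" "GL \<subseteq> (\<Union>d. L d)"
    "\<And>J'. is_subideal B J' \<Longrightarrow> GL \<subseteq> J' \<Longrightarrow> (\<Union>d. L d) \<subseteq> J'"
    using B unfolding noetherian_subring_def finitely_generated_in_def by meson
  have "\<exists>D. GL \<subseteq> L D"
  proof -
    have "\<exists>d. G \<subseteq> L d" if "finite G" "G \<subseteq> (\<Union>d. L d)" for G
      using that
    proof (induction G rule: finite_induct)
      case (insert c G)
      then obtain d d' where "G \<subseteq> L d" "c \<in> L d'" by auto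
      then have "insert c G \<subseteq> L (max d d')"
        using L_mono'[of d "max d d'"] L_mono'[of d' "max d d'"] by auto
      then show ?case by blast
    qed simp
    from this[OF GL(1,2)] show ?thesis .
  qed
  then obtain D where D: "GL \<subseteq> L D" by blast
  have "\<exists>G. finite G \<and> G \<subseteq> L d \<and> (\<forall>J'. is_subideal B J' \<longrightarrow> G \<subseteq> J' \<longrightarrow> L d \<subseteq> J')" for d
    using B L_ideal unfolding noetherian_subring_def finitely_generated_in_def by meson
  then obtain G0 where G0: "\<And>d. finite (G0 d)" "\<And>d. G0 d \<subseteq> L d"
    "\<And>d J'. is_subideal B J' \<Longrightarrow> G0 d \<subseteq> J' \<Longrightarrow> L d \<subseteq> J'"
    by metis
  have "\<forall>d c. \<exists>q. c \<in> L d \<longrightarrow> q \<in> J' \<and> degree q \<le> d \<and> coeff q d = c" unfolding L_def by blast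
  then obtain w where w: "\<And>d c. c \<in> L d \<Longrightarrow> w d c \<in> J' \<and> degree (w d c) \<le> d \<and> coeff (w d c) d = c"
    by metis
  \<comment> \<open>Representatives of generators of \<open>L d\<close> for each \<open>d\<close> up
    to D, and of generators of the union of all \<open>L d\<close>, chosen in degree D; multiplied
    by powers of \<open>x\<close>, the latter serve all degrees above D.\<close>
  define G where "G = (\<Union>d\<in>{..D}. (\<lambda>c. poly (w d c) x) ` G0 d) \<union> (\<lambda>c. poly (w D c) x) ` GL"
  have "J \<subseteq> J1" if J1: "is_subideal ?B' J1" "G \<subseteq> J1" for J1
  proof -
    have step: "\<exists>u\<in>J'. degree u \<le> d \<and> coeff u d = c \<and> poly u x \<in> J1" if c: "c \<in> L d" for d c
    proof (cases "d \<le> D")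
      case True
      have "G0 d \<subseteq> {c. \<exists>q\<in>J'. degree q \<le> d \<and> coeff q d = c \<and> poly q x \<in> J1}"
      proof
        fix c assume "c \<in> G0 d"
        then have "poly (w d c) x \<in> G" "c \<in> L d" using True G0(2) unfolding G_def by blast+
        then have "poly (w d c) x \<in> J1" "c \<in> L d" using J1(2) by blast+
        then show "c \<in> {c. \<exists>q\<in>J'. degree q \<le> d \<and> coeff q d = c \<and> poly q x \<in> J1}"
          using w by blast
      qed
      then show ?thesis using G0(3)[OF ideal_lead[OF J1(1)]] c by blast
    next
      case False
      have "GL \<subseteq> {c. \<exists>q\<in>J'. degree q \<le> d \<and> coeff q d = c \<and> poly q x \<in> J1}"
      proof
        fix c assume c: "c \<in> GL"
        then have "poly (w D c) x \<in> G" "c \<in> L D" using D unfolding G_def by blast+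
        then have "x ^ (d - D) * poly (w D c) x \<in> J1"
          using J1 xB'[of "d - D"] unfolding is_subideal_def by blast
        moreover have wc: "w D c \<in> J'" "degree (w D c) \<le> D" "coeff (w D c) D = c" using w[OF \<open>c \<in> L D\<close>] by simp_all
        ultimately show "c \<in> {c. \<exists>q\<in>J'. degree q \<le> d \<and> coeff q d = c \<and> poly q x \<in> J1}"
          using shift[OF wc(1,2), of "d - D"] False by (auto intro!: bexI[of _ "monom 1 (d - D) * w D c"])
      qed
      then show ?thesis using GL(3)[OF ideal_lead[OF J1(1)]] c by blast
    qed
    have "poly q x \<in> J1" if "q \<in> J'" "degree q \<le> d" for q d
      using that
    proof (induction d arbitrary: q)
      case 0
      obtain u where u: "u \<in> J'" "degree u \<le> 0" "coeff u 0 = coeff q 0" "poly u x \<in> J1"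
        using step[of "coeff q 0" 0] 0 by (auto simp: L_def)
      have "q = u" using u 0 by (metis degree_eq_zeroE bot_nat_0.extremum_uniqueI coeff_pCons_0)
      then show ?case using u by simp
    next
      case (Suc d)
      obtain u where u: "u \<in> J'" "degree u \<le> Suc d" "coeff u (Suc d) = coeff q (Suc d)" "poly u x \<in> J1"
        using step[of "coeff q (Suc d)" "Suc d"] Suc.prems by (auto simp: L_def)
      have "degree (q - u) \<le> Suc d" using u Suc by (intro degree_diff_le)
      then have "degree (q - u) \<le> d"
        using eq_zero_or_degree_less[of "q - u" "Suc d"] u(3) by auto
      then have "poly (q - u) x \<in> J1" using Suc.IH J'diff Suc.prems u by blast
      then have "poly (q - u) x + poly u x \<in> J1" using u(4) J1(1) unfolding is_subideal_def by blast
      then show ?case by simp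
    qed
    then have val: "poly q x \<in> J1" if "q \<in> J'" for q using that by blast
    show ?thesis
    proof
      fix p assume p: "p \<in> J"
      then obtain q where "q \<in> polys_over B" "p = poly q x" using J unfolding is_subideal_def by blast
      then show "p \<in> J1" using val[of q] p by (simp add: J'_def)
    qed
  qed
  moreover have "finite G" unfolding G_def using G0 GL by auto
  moreover have "G \<subseteq> J"
  proof -
    have "poly (w d c) x \<in> J" if "c \<in> L d" for c d using w[OF that] by (simp add: J'_def)
    then show ?thesis using G0(2) D unfolding G_def by blast
  qed
  ultimately show "finitely_generated_in ?B' J" unfolding finitely_generated_in_def by blast
qed

lemma noetherian_polys_in: "finite U \<Longrightarrow> noetherian_subring (polys_in U :: 'k::field mpoly set)"
proof (induction U rule: finite_induct)
  case empty
  then show ?case by (rule noetherian_subring_constants)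
next
  case (insert k U)
  have "polys_in (insert k U) = (\<lambda>q. poly q (mpoly_var k)) ` polys_over (polys_in U :: 'k mpoly set)"
    using polys_in_insert_eq_poly[of _ k U] poly_var_in_polys_in[of _ U k] by blast
  then show ?case using noetherian_subring_adjoin[OF insert.IH] by simp
qed

text \<open>The whole type has infinitely many variables, so J itself may fail to be finitely
  generated. Generators of its part in the first \<open>n\<close> variables do the work once the
  kernel of \<open>retr\<close> is added.\<close>

lemma ideal_finitely_generated_over_retr:
  fixes J :: "'k::field mpoly set"
  assumes J: "is_ideal J"
  shows "\<exists>G. finite G \<and> G \<subseteq> J \<and> (\<forall>J'. is_ideal J' \<longrightarrow> (\<forall>p. retr n p = 0 \<longrightarrow> p \<in> J') \<longrightarrow> G \<subseteq> J' \<longrightarrow>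
     (\<forall>p\<in>J. retr n p \<in> J \<longrightarrow> p \<in> J'))"
proof -
  let ?B = "polys_in {..<n} :: 'k mpoly set"
  have "is_subideal ?B (J' \<inter> ?B)" if "is_ideal J'" for J'
    using that by (auto simp: is_subideal_def is_ideal_def intro: polys_in_add polys_in_mult)
  note sub = this
  obtain G where G: "finite G" "G \<subseteq> J \<inter> ?B" "\<And>J'. is_subideal ?B J' \<Longrightarrow> G \<subseteq> J' \<Longrightarrow> J \<inter> ?B \<subseteq> J'"
    using noetherian_polys_in[of "{..<n}"] sub[OF J]
    unfolding noetherian_subring_def finitely_generated_in_def by (meson finite_lessThan)
  have "p \<in> J'" if J': "is_ideal J'" "\<forall>p. retr n p = 0 \<longrightarrow> p \<in> J'" "G \<subseteq> J'" and p: "p \<in> J" "retr n p \<in> J" for J' p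
  proof -
    have "retr n p \<in> J'" using G(3)[OF sub[OF J'(1)]] G(2) J'(3) p retr_in[of n p] by blast
    moreover have "p - retr n p \<in> J'" using J'(2) by (simp add: retr_diff)
    ultimately show ?thesis using ideal_cong[OF J'(1)] by blast
  qed
  then show ?thesis using G by blast
qed

section \<open>Minors of the Jacobi matrix and natural derivations of the polynomial ring\<close>

lemma in_span_mod_mono:
  assumes "in_span_mod P J k v u" "k \<le> k'" "\<And>i. i < k \<Longrightarrow> v' i = v i"
  shows "in_span_mod P J k' v' u"
proof -
  obtain c b where cb: "c \<notin> P" "\<And>l. l \<in> J \<Longrightarrow> c * u l - (\<Sum>i<k. b i * v i l) \<in> P"
    using assms(1) by (auto simp: in_span_mod_def)
  have "(\<Sum>i<k'. (if i < k then b i else 0) * v' i l) = (\<Sum>i<k. b i * v i l)" for l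
    by (rule sum.mono_neutral_cong_right) (use assms in auto)
  then show ?thesis unfolding in_span_mod_def
    using cb by (intro exI[of _ c] exI[of _ "\<lambda>i. if i < k then b i else 0"]) simp
qed

lemma in_span_mod_generator:
  assumes "is_prime P" "i < k" "v i = u"
  shows "in_span_mod P J k v u"
proof -
  have "(\<Sum>j<k. (if j = i then 1 else 0) * v j l) = u l" for l
    using assms by (simp add: if_distrib[of "\<lambda>x. x * _"] sum.delta cong: if_cong)
  then show ?thesis unfolding in_span_mod_def
    using assms ideal_0 prime_1[OF assms(1)] is_prime_is_ideal
    by (intro exI[of _ 1] exI[of _ "\<lambda>j. if j = i then 1 else 0"]) auto
qed

text \<open>Transitivity of spans; the product E of the denominators belonging to the
  \<open>w i\<close> serves as a common one.\<close>

lemma in_span_mod_lincomb: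
  fixes m :: nat
  assumes P: "is_prime P" and w: "\<And>i. i < m \<Longrightarrow> in_span_mod P J k v (w i)"
    and u: "c \<notin> P" "\<And>l. l \<in> J \<Longrightarrow> c * u l - (\<Sum>i<m. b i * w i l) \<in> P"
  shows "in_span_mod P J k v u"
proof -
  note id = is_prime_is_ideal[OF P]
  obtain e d where ed: "\<And>i. i < m \<Longrightarrow> e i \<notin> P"
    "\<And>i l. i < m \<Longrightarrow> l \<in> J \<Longrightarrow> e i * w i l - (\<Sum>j<k. d i j * v j l) \<in> P"
    using w unfolding in_span_mod_def by metis
  define E where "E = (\<Prod>i<m. e i)"
  define E' where "E' = (\<lambda>i. \<Prod>j\<in>{..<m}-{i}. e j)"
  have E: "E \<notin> P" unfolding E_def using ed(1) by (auto simp: prime_prod[OF P])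
  have EE: "E = E' i * e i" if "i < m" for i
    unfolding E_def E'_def using that by (subst prod.remove[of _ i]) (auto simp: mult.commute)
  have "E * c * u l - (\<Sum>j<k. (\<Sum>i<m. b i * E' i * d i j) * v j l) \<in> P" if l: "l \<in> J" for l
  proof -
    have "(\<Sum>j<k. (\<Sum>i<m. b i * E' i * d i j) * v j l) = (\<Sum>i<m. b i * E' i * (\<Sum>j<k. d i j * v j l))"
      by (simp add: sum_distrib_left sum_distrib_right mult.assoc) (rule sum.swap)
    moreover have "(\<Sum>i<m. b i * E' i * (e i * w i l - (\<Sum>j<k. d i j * v j l)))
        = (\<Sum>i<m. E * b i * w i l) - (\<Sum>i<m. b i * E' i * (\<Sum>j<k. d i j * v j l))"
      unfolding sum_subtractf[symmetric] by (rule sum.cong) (auto simp: EE right_diff_distrib mult_ac)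
    moreover have "(\<Sum>i<m. E * b i * w i l) = E * (\<Sum>i<m. b i * w i l)"
      by (simp add: sum_distrib_left mult.assoc)
    ultimately have "E * c * u l - (\<Sum>j<k. (\<Sum>i<m. b i * E' i * d i j) * v j l)
      = E * (c * u l - (\<Sum>i<m. b i * w i l)) + (\<Sum>i<m. b i * E' i * (e i * w i l - (\<Sum>j<k. d i j * v j l)))"
      by (simp add: algebra_simps)
    also have "\<dots> \<in> P"
      using u(2)[OF l] ed(2) l by (intro ideal_add[OF id] ideal_sum[OF id] ideal_mult[OF id]) auto
    finally show ?thesis .
  qed
  moreover have "E * c \<notin> P" using E u(1) by (simp add: prime_mult[OF P])
  ultimately show ?thesis unfolding in_span_mod_def
    by (intro exI[of _ "E * c"] exI[of _ "\<lambda>j. \<Sum>i<m. b i * E' i * d i j"]) simp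
qed

definition nat_derivation :: "nat \<Rightarrow> (nat \<Rightarrow> 'k::comm_ring_1 mpoly) \<Rightarrow> nat list \<Rightarrow> 'k mpoly \<Rightarrow> 'k mpoly" where
  "nat_derivation k h jj p = minor (\<lambda>i. grad (if i < k then h i else p)) (Suc k) jj"

lemma nat_derivation_expand:
  assumes "length jj = Suc k"
  shows "nat_derivation k h jj p =
    (\<Sum>j<Suc k. (-1) ^ (k + j) * minor (\<lambda>i. grad (h i)) k (omit_nth j jj) * pderiv_mpoly (jj ! j) p)"
proof -
  have "minor (\<lambda>i. grad (if i < k then h i else p)) k js = minor (\<lambda>i. grad (h i)) k js" for js
    by (rule minor_cong) simp
  then show ?thesis
    unfolding nat_derivation_def minor_Suc_last_row[OF assms] by simp
qed

lemma is_derivation_nat_derivation: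
  assumes "length jj = Suc k" shows "is_derivation (nat_derivation k h jj)"
  unfolding is_derivation_def nat_derivation_expand[OF assms]
proof (intro conjI allI)
  let ?c = "\<lambda>j. (- 1) ^ (k + j) * minor (\<lambda>i. grad (h i)) k (omit_nth j jj)"
  fix x y
  show "(\<Sum>j<Suc k. ?c j * pderiv_mpoly (jj ! j) (x + y)) =
      (\<Sum>j<Suc k. ?c j * pderiv_mpoly (jj ! j) x) + (\<Sum>j<Suc k. ?c j * pderiv_mpoly (jj ! j) y)"
    by (simp only: pd_add distrib_left sum.distrib)
  have "(\<Sum>j<Suc k. ?c j * pderiv_mpoly (jj ! j) (x * y)) =
      (\<Sum>j<Suc k. ?c j * pderiv_mpoly (jj ! j) x * y + x * (?c j * pderiv_mpoly (jj ! j) y))"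
    by (rule sum.cong) (simp_all only: pd_mult distrib_left mult_ac)
  then show "(\<Sum>j<Suc k. ?c j * pderiv_mpoly (jj ! j) (x * y)) =
      (\<Sum>j<Suc k. ?c j * pderiv_mpoly (jj ! j) x) * y + x * (\<Sum>j<Suc k. ?c j * pderiv_mpoly (jj ! j) y)"
    by (simp only: sum.distrib sum_distrib_left sum_distrib_right)
qed

lemma nat_derivation_kills:
  assumes "i < k" shows "nat_derivation k h jj (h i) = 0"
  unfolding nat_derivation_def
proof (rule minor_eq_0_of_equal_rows)
  show "i < Suc k" "k < Suc k" "i \<noteq> k" using assms by simp_all
  show "grad (if i < k then h i else h i) = grad (if k < k then h k else h i)" by simp
qed

lemma sorted_wrt_omit_nth: "sorted_wrt R xs \<Longrightarrow> sorted_wrt R (omit_nth j xs)"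
proof -
  assume "sorted_wrt R xs"
  then have "sorted_wrt R (take j xs @ drop j xs)" by simp
  then have *: "sorted_wrt R (take j xs)" "sorted_wrt R (drop j xs)" "\<forall>x\<in>set (take j xs). \<forall>y\<in>set (drop j xs). R x y"
    unfolding sorted_wrt_append by auto
  have "sorted_wrt R (drop (Suc j) xs)" using \<open>sorted_wrt R xs\<close> by (rule sorted_wrt_drop)
  moreover have "set (drop (Suc j) xs) \<subseteq> set (drop j xs)" by (rule set_drop_subset_set_drop) simp
  ultimately show ?thesis using * unfolding omit_nth_def sorted_wrt_append by blast
qed

lemma omit_nth_inc_tuples: "jj \<in> inc_tuples (Suc r) n \<Longrightarrow> j < Suc r \<Longrightarrow> omit_nth j jj \<in> inc_tuples r n"
proof -
  assume a: "jj \<in> inc_tuples (Suc r) n" "j < Suc r"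
  then have *: "length jj = Suc r" "set jj \<subseteq> {..<n}" "sorted_wrt (<) jj" by (simp_all add: inc_tuples_def tuples_def)
  have "length (omit_nth j jj) = r" using length_omit_nth[of j jj] * a by simp
  then show ?thesis using subset_trans[OF set_omit_nth *(2)] sorted_wrt_omit_nth[OF *(3)]
    unfolding inc_tuples_def tuples_def by blast
qed

lemma nth_tuple: "ii \<in> tuples k m \<Longrightarrow> i < k \<Longrightarrow> ii ! i < m"
proof -
  assume "ii \<in> tuples k m" "i < k"
  then have "set ii \<subseteq> {..<m}" "ii ! i \<in> set ii" by (simp_all add: tuples_def)
  then show ?thesis by (metis lessThan_iff subsetD)
qed

lemma sort_tuple_inc:
  assumes "is_ideal P" "length js = k" "set js \<subseteq> {..<n}" "minor v k js \<notin> P"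
  shows "sort js \<in> inc_tuples k n \<and> minor v k (sort js) \<notin> P"
proof -
  have "length (sort js) = k \<and> set (sort js) \<subseteq> {..<n}" using assms(2,3) by simp
  then show ?thesis using sorted_minor_notin[OF assms(1,2,4)] unfolding inc_tuples_def tuples_def by blast
qed

section \<open>Prime ideals containing an ideal\<close>

text \<open>Zorn's lemma gives an ideal M maximal among those that contain J and not 1. If
  \<open>x\<close> is outside M, then 1 is a multiple of \<open>x\<close> modulo M, and multiplying
  two such expressions shows that M is prime.\<close>

lemma exists_prime_containing:
  assumes J: "is_ideal J" "1 \<notin> J"
  shows "\<exists>P. is_prime P \<and> J \<subseteq> P"
proof -
  define A where "A = {K. is_ideal K \<and> J \<subseteq> K \<and> 1 \<notin> K}"
  have "\<exists>M\<in>A. \<forall>U\<in>A. M \<subseteq> U \<longrightarrow> U = M"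
  proof (rule subset_Zorn_nonempty)
    show "A \<noteq> {}" using J unfolding A_def by blast
    fix C assume C: "C \<noteq> {}" "subset.chain A C"
    have tot: "U \<subseteq> V \<or> V \<subseteq> U" if "U \<in> C" "V \<in> C" for U V
      using C that by (auto simp: subset_chain_def)
    have el: "is_ideal U" "J \<subseteq> U" "1 \<notin> U" if "U \<in> C" for U
      using C that by (auto simp: subset_chain_def A_def)
    have "is_ideal (\<Union>C)"
      unfolding is_ideal_def
    proof (intro conjI ballI allI)
      show "0 \<in> \<Union>C" using C(1) el(1) ideal_0 by blast
      show "a * x \<in> \<Union>C" if "x \<in> \<Union>C" for a x using that el(1) ideal_mult by blast
      fix x y assume "x \<in> \<Union>C" "y \<in> \<Union>C"
      then obtain U V where UV: "U \<in> C" "V \<in> C" "x \<in> U" "y \<in> V" by auto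
      then show "x + y \<in> \<Union>C"
        using tot[OF UV(1,2)] el(1) ideal_add[of U x y] ideal_add[of V x y] by blast
    qed
    then show "\<Union>C \<in> A" using C(1) el unfolding A_def by blast
  qed
  then obtain M where M0: "M \<in> A" "\<And>U. U \<in> A \<Longrightarrow> M \<subseteq> U \<Longrightarrow> U = M" by blast
  have M: "is_ideal M" "J \<subseteq> M" "1 \<notin> M" using M0(1) by (simp_all add: A_def)
  have max: "U = M" if "is_ideal U" "J \<subseteq> U" "1 \<notin> U" "M \<subseteq> U" for U
    by (rule M0(2)) (use that in \<open>simp_all add: A_def\<close>)
  have ext: "\<exists>a. \<exists>z\<in>M. 1 = a * x + z" if x: "x \<notin> M" for x
  proof (rule ccontr)
    assume neg: "\<not> ?thesis"
    let ?U = "{a * x + z |a z. z \<in> M}"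
    have "is_ideal ?U"
      unfolding is_ideal_def
    proof (intro conjI ballI allI)
      show "0 \<in> ?U" using ideal_0[OF M(1)] by (auto intro!: exI[of _ 0])
      show "u + v \<in> ?U" if uv: "u \<in> ?U" "v \<in> ?U" for u v
      proof -
        obtain a z b y where "u = a * x + z" "v = b * x + y" "z \<in> M" "y \<in> M" using uv by blast
        then have "u + v = (a + b) * x + (z + y)" "z + y \<in> M"
          using ideal_add[OF M(1)] by (auto simp: algebra_simps)
        then show ?thesis by blast
      qed
      show "c * u \<in> ?U" if uU: "u \<in> ?U" for c u
      proof -
        obtain a z where "u = a * x + z" "z \<in> M" using uU by blast
        then have "c * u = (c * a) * x + c * z" "c * z \<in> M"
          using ideal_mult[OF M(1), of z c] by (simp_all add: algebra_simps)
        then show ?thesis by blast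
      qed
    qed
    moreover have MU: "M \<subseteq> ?U"
    proof
      fix z assume "z \<in> M"
      then have "z = 0 * x + z" "z \<in> M" by auto
      then show "z \<in> ?U" by blast
    qed
    moreover have "1 \<notin> ?U" using neg by blast
    ultimately have "?U = M" using M(2) by (intro max subset_trans[OF M(2)])
    moreover have "x \<in> ?U"
    proof -
      have "x = 1 * x + 0" "0 \<in> M" using ideal_0[OF M(1)] by auto
      then show ?thesis by blast
    qed
    ultimately show False using x by simp
  qed
  have "x \<in> M \<or> y \<in> M" if xy: "x * y \<in> M" for x y
  proof (rule ccontr)
    assume "\<not> ?thesis"
    then obtain a z b w where az: "1 = a * x + z" "z \<in> M" "1 = b * y + w" "w \<in> M"
      using ext by blast
    have "(1::'a) = (a * x + z) * (b * y + w)" using az(1,3) by simp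
    also have "\<dots> = a * b * (x * y) + a * x * w + (b * y + w) * z" by (simp add: algebra_simps)
    also have "\<dots> \<in> M"
      by (intro ideal_add[OF M(1)] ideal_mult[OF M(1)] xy az)
    finally show False using M(3) by simp
  qed
  then show ?thesis using M unfolding is_prime_def by blast
qed

section \<open>The Jacobian criterion and stable ideals\<close>

text \<open>The situation of the theorem transported to the whole polynomial type:
  \<open>gen\<close> says that the \<open>f i\<close> generate I up to the kernel of
  \<open>retr\<close>. Ideals of A are represented by ideals containing I.\<close>

locale affine_presentation =
  fixes n m :: nat and f :: "nat \<Rightarrow> 'k::field_char_0 mpoly" and I :: "'k mpoly set"
  assumes I: "prime_over n I"
    and f_in: "\<And>i. i < m \<Longrightarrow> f i \<in> I"
    and gen: "\<And>p. p \<in> I \<Longrightarrow> \<exists>b. retr n (p - (\<Sum>i<m. b i * f i)) = 0"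
begin

text \<open>Here r is the codimension of I; that this is the rank of the Jacobi matrix over the
  field of fractions is shown in \<open>jacobi_rank_eq\<close>.\<close>

abbreviation r :: nat where "r \<equiv> codim n I"

definition fminor :: "nat list \<Rightarrow> nat list \<Rightarrow> 'k mpoly" where
  "fminor ii jj = minor (\<lambda>i. grad (f (ii ! i))) (length ii) jj"

definition jacobian_criterion :: "'k mpoly set \<Rightarrow> bool" where
  "jacobian_criterion P \<longleftrightarrow> (\<exists>ii\<in>inc_tuples r m. \<exists>jj\<in>inc_tuples r n. fminor ii jj \<notin> P)"

definition rows :: "nat list set" where
  "rows = {ii \<in> inc_tuples r m. \<exists>jj\<in>tuples r n. fminor ii jj \<notin> I}"

definition cols :: "nat list set" where
  "cols = {jj \<in> inc_tuples r n. \<exists>ii\<in>tuples r m. fminor ii jj \<notin> I}"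

definition cols_Suc :: "nat list set" where
  "cols_Suc = {jj \<in> inc_tuples (Suc r) n. \<exists>k<length jj. omit_nth k jj \<in> cols}"

definition natder :: "nat list \<Rightarrow> nat list \<Rightarrow> 'k mpoly \<Rightarrow> 'k mpoly" where
  "natder ii jj = nat_derivation r (\<lambda>i. f (ii ! i)) jj"

definition stable :: "'k mpoly set \<Rightarrow> bool" where
  "stable J \<longleftrightarrow> (\<forall>ii\<in>rows. \<forall>jj\<in>cols_Suc. \<forall>x\<in>J. natder ii jj x \<in> J)"

lemma I_prime: "is_prime I" and I_ideal: "is_ideal I"
  using I prime_over_is_prime prime_over_is_ideal by auto

lemma prime_over_superset: "is_prime P \<Longrightarrow> I \<subseteq> P \<Longrightarrow> prime_over n P"
  using I by (auto simp: prime_over_def)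

text \<open>A greedy choice: the rows are examined in order, and a new one is appended when it is
  outside the span so far, which keeps the tuple increasing. The prime is arbitrary, since the
  selection is made both modulo I and modulo larger primes.\<close>

lemma exists_maximal_indep_rows:
  assumes P: "is_prime P"
  shows "M \<le> m \<Longrightarrow> \<exists>ii. ii \<in> inc_tuples (length ii) M \<and> indep_mod P {..<n} (length ii) (\<lambda>i. grad (f (ii ! i))) \<and>
     (\<forall>i<M. in_span_mod P {..<n} (length ii) (\<lambda>i. grad (f (ii ! i))) (grad (f i)))"
proof (induction M)
  case 0
  show ?case by (intro exI[of _ "[]"]) (auto simp: inc_tuples_def tuples_def indep_mod_def)
next
  case (Suc M)
  obtain ii where ii: "ii \<in> inc_tuples (length ii) M" "indep_mod P {..<n} (length ii) (\<lambda>i. grad (f (ii ! i)))"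
    "\<forall>i<M. in_span_mod P {..<n} (length ii) (\<lambda>i. grad (f (ii ! i))) (grad (f i))"
    using Suc by auto
  show ?case
  proof (cases "in_span_mod P {..<n} (length ii) (\<lambda>i. grad (f (ii ! i))) (grad (f M))")
    case True
    have "ii \<in> inc_tuples (length ii) (Suc M)"
      using ii(1) by (auto simp: inc_tuples_def tuples_def)
    then show ?thesis using ii True by (auto simp: less_Suc_eq)
  next
    case False
    let ?jj = "ii @ [M]"
    have eq: "grad (f (?jj ! i)) = grad (f (ii ! i))" if "i < length ii" for i
      using that by (simp add: nth_append)
    have inc: "?jj \<in> inc_tuples (length ?jj) (Suc M)"
      using ii(1) by (auto simp: inc_tuples_def tuples_def sorted_wrt_append)
    have "indep_mod P {..<n} (Suc (length ii)) (\<lambda>i. grad (f (?jj ! i)))"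
    proof (rule indep_mod_Suc[OF P])
      show "indep_mod P {..<n} (length ii) (\<lambda>i. grad (f (?jj ! i)))"
        using ii(2) indep_mod_cong[of "length ii" "{..<n}" "\<lambda>i. grad (f (?jj ! i))" "\<lambda>i. grad (f (ii ! i))" P]
        by (simp add: nth_append)
      show "\<not> in_span_mod P {..<n} (length ii) (\<lambda>i. grad (f (?jj ! i))) (grad (f (?jj ! length ii)))"
      proof
        assume "in_span_mod P {..<n} (length ii) (\<lambda>i. grad (f (?jj ! i))) (grad (f (?jj ! length ii)))"
        from in_span_mod_mono[OF this order_refl eq[symmetric]] show False using False by simp
      qed
    qed
    moreover have "in_span_mod P {..<n} (Suc (length ii)) (\<lambda>i. grad (f (?jj ! i))) (grad (f i))" if i: "i < Suc M" for i
    proof (cases "i < M")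
      case True
      show ?thesis by (rule in_span_mod_mono[OF ii(3)[rule_format, OF True]]) (use eq in auto)
    next
      case False
      then have "i = M" using i by simp
    then show ?thesis by (intro in_span_mod_generator[OF P, of "length ii"]) simp_all
    qed
    ultimately show ?thesis using inc by (intro exI[of _ ?jj] conjI) auto
  qed
qed

text \<open>One more independent gradient would exceed the bound given by the codimension.\<close>

lemma in_span_grad_I:
  assumes "indep_mod I {..<n} r (\<lambda>i. grad (h i))" "\<And>i. i < r \<Longrightarrow> h i \<in> I" "p \<in> I"
  shows "in_span_mod I {..<n} r (\<lambda>i. grad (h i)) (grad p)"
proof (rule ccontr)
  assume "\<not> ?thesis"
  then have "\<not> in_span_mod I {..<n} r (\<lambda>i. grad ((h(r := p)) i)) (grad ((h(r := p)) r))"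
    by (simp add: in_span_mod_def)
  moreover have "indep_mod I {..<n} r (\<lambda>i. grad ((h(r := p)) i))"
    using assms(1) by (simp add: indep_mod_def)
  ultimately have "indep_mod I {..<n} (Suc r) (\<lambda>i. grad ((h(r := p)) i))"
    by (intro indep_mod_Suc[OF I_prime])
  then have "Suc r \<le> r" by (rule indep_grad_le_codim[OF I]) (use assms in \<open>auto simp: less_Suc_eq\<close>)
  then show False by simp
qed

text \<open>By \<open>gen\<close> and the product rule, the rows of the Jacobi matrix span the
  gradients of all elements of I modulo I. So a maximal independent set of rows has as many members
  as there are local generators.\<close>

lemma jacobian_rank:
  shows "\<exists>ii\<in>inc_tuples r m. indep_mod I {..<n} r (\<lambda>i. grad (f (ii ! i)))"
proof -
  obtain ii where ii: "ii \<in> inc_tuples (length ii) m" "indep_mod I {..<n} (length ii) (\<lambda>i. grad (f (ii ! i)))"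
    "\<forall>i<m. in_span_mod I {..<n} (length ii) (\<lambda>i. grad (f (ii ! i))) (grad (f i))"
    using exists_maximal_indep_rows[OF I_prime order_refl] by blast
  have iim: "ii ! i < m" if "i < length ii" for i
    using nth_tuple[of ii _ m i] ii(1) that unfolding inc_tuples_def by blast
  have "length ii \<le> r"
    by (rule indep_grad_le_codim[OF I ii(2)]) (use iim f_in in auto)
  moreover have "r \<le> length ii"
  proof -
    obtain g where g: "generates_locally n I r g" "indep_mod I {..<n} r (\<lambda>i. grad (g i))"
      using exists_local_generators[OF I] by blast
    have "in_span_mod I {..<n} (length ii) (\<lambda>i. grad (f (ii ! i))) (grad (g i))" if "i < r" for i
    proof -
      have gI: "g i \<in> I" using g that by (simp add: generates_locally_def)
      obtain b where b: "retr n (g i - (\<Sum>i<m. b i * f i)) = 0" using gen[OF gI] by blast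
      have "\<forall>l\<in>{..<n}. 1 * pderiv_mpoly l (g i) - (\<Sum>i<m. b i * pderiv_mpoly l (f i)) \<in> I"
        by (rule grad_in_span[OF I prime_1[OF I_prime] gI f_in refl]) (use prime_over_pd[OF I b] in auto)
      then show ?thesis
        using in_span_mod_lincomb[OF I_prime _ prime_1[OF I_prime], where w = "\<lambda>i. grad (f i)" and b = b and m = m
            and u = "grad (g i)"] ii(3) by blast
    qed
    then have "r \<le> card {..<length ii}"
      by (intro indep_mod_le_card_of_spanned[OF I_prime g(2), of _ "\<lambda>i. grad (f (ii ! i))"]) (auto simp: in_span_mod_def)
    then show ?thesis by simp
  qed
  ultimately show ?thesis using ii by auto
qed

lemma fminor_inc_of_indep:
  assumes P: "is_prime P" and ii: "length ii = k" "indep_mod P {..<n} k (\<lambda>i. grad (f (ii ! i)))"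
  shows "\<exists>jj\<in>inc_tuples k n. fminor ii jj \<notin> P"
proof -
  obtain js where js: "length js = k" "set js \<subseteq> {..<n}" "minor (\<lambda>i. grad (f (ii ! i))) k js \<notin> P"
    using exists_minor_of_indep_mod[OF P ii(2)] by blast
  from sort_tuple_inc[OF is_prime_is_ideal[OF P] this] show ?thesis unfolding fminor_def ii(1) by blast
qed

lemma jacobian_criterion_I: "jacobian_criterion I"
proof -
  obtain ii where ii: "ii\<in>inc_tuples r m" "indep_mod I {..<n} r (\<lambda>i. grad (f (ii ! i)))"
    using jacobian_rank by blast
  have "length ii = r" using ii by (simp add: inc_tuples_def tuples_def)
  then show ?thesis using fminor_inc_of_indep[OF I_prime _ ii(2)] ii(1) unfolding jacobian_criterion_def by blast
qed

lemma natder_expand: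
  assumes "ii \<in> tuples r m" "jj \<in> tuples (Suc r) n"
  shows "natder ii jj p = (\<Sum>j<Suc r. (-1) ^ (r + j) * fminor ii (omit_nth j jj) * pderiv_mpoly (jj ! j) p)"
  using nat_derivation_expand[of jj r "\<lambda>i. f (ii ! i)"] assms
  by (simp add: natder_def fminor_def tuples_def)

text \<open>The value at an element of I is a minor of size r + 1 formed from gradients of elements
  of I; outside I it would make r + 1 such gradients independent. Hence natural derivations are well
  defined on A.\<close>

lemma natder_I:
  assumes "ii \<in> tuples r m" "jj \<in> tuples (Suc r) n" "p \<in> I"
  shows "natder ii jj p \<in> I"
proof (rule ccontr)
  assume neg: "natder ii jj p \<notin> I"
  let ?h = "\<lambda>i. if i < r then f (ii ! i) else p"
  have ind: "indep_mod I {..<n} (Suc r) (\<lambda>i. grad (?h i))"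
    by (rule indep_mod_of_minor[OF I_prime, of _ _ jj])
      (use neg assms in \<open>auto simp: natder_def nat_derivation_def tuples_def\<close>)
  have "?h i \<in> I" for i
  proof (cases "i < r")
    case True
    then have "ii ! i < m" using nth_tuple[OF assms(1)] by simp
    then show ?thesis using True f_in by simp
  qed (use assms in simp)
  from indep_grad_le_codim[OF I ind this] show False by simp
qed

lemma inc_tuples_tuples: "ii \<in> inc_tuples k l \<Longrightarrow> ii \<in> tuples k l"
  by (simp add: inc_tuples_def)

lemma rows_cols_tuples: "ii \<in> rows \<Longrightarrow> ii \<in> tuples r m" "jj \<in> cols_Suc \<Longrightarrow> jj \<in> tuples (Suc r) n"
  by (auto simp: rows_def cols_Suc_def inc_tuples_def)

lemma stable_ideal_trivial:
  assumes crit: "\<And>P. is_prime P \<Longrightarrow> I \<subseteq> P \<Longrightarrow> jacobian_criterion P"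
    and J: "is_ideal J" "I \<subseteq> J" "stable J"
  shows "J = I \<or> J = UNIV"
proof (rule ccontr)
  assume neg: "\<not> ?thesis"
  have "1 \<notin> J" using neg ideal_mult2[OF J(1), of 1] by auto
  then obtain P where P: "is_prime P" "J \<subseteq> P" using exists_prime_containing[OF J(1)] by blast
  have "\<exists>Q. prime_over n Q \<and> J \<subseteq> Q \<and> Q \<subseteq> P \<and> (\<forall>D\<in>{natder ii jj |ii jj. ii \<in> rows \<and> jj \<in> cols_Suc}. \<forall>x\<in>Q. D x \<in> Q)"
  proof (rule exists_stable_prime)
    show "prime_over n P" using P J by (intro prime_over_superset) auto
    show "p \<in> J" if "retr n p = 0" for p using prime_over_retr_0[OF I that] J by auto
    fix D assume "D \<in> {natder ii jj |ii jj. ii \<in> rows \<and> jj \<in> cols_Suc}"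
    then obtain ii jj where D: "D = natder ii jj" "ii \<in> rows" "jj \<in> cols_Suc" by auto
    show "is_derivation D" unfolding D natder_def
      using rows_cols_tuples(2)[OF D(3)] by (intro is_derivation_nat_derivation) (simp add: tuples_def)
    show "D x \<in> J" if "x \<in> J" for x using J(3) D that unfolding stable_def by auto
  qed (use P in auto)
  then obtain Q where Q: "prime_over n Q" "J \<subseteq> Q"
    "\<And>ii jj x. ii \<in> rows \<Longrightarrow> jj \<in> cols_Suc \<Longrightarrow> x \<in> Q \<Longrightarrow> natder ii jj x \<in> Q" by blast
  note Q' = prime_over_is_prime[OF Q(1)] and idQ = prime_over_is_ideal[OF Q(1)]
  have "I \<subset> Q" using J neg Q by auto
  then have cQ: "r < codim n Q" by (rule codim_strict_mono[OF I Q(1)])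
  have "jacobian_criterion Q" using crit[OF Q'] J Q by auto
  then obtain ii jj where ij: "ii\<in>inc_tuples r m" "jj\<in>inc_tuples r n" "fminor ii jj \<notin> Q"
    unfolding jacobian_criterion_def by blast
  have li: "length ii = r" using ij by (simp add: inc_tuples_def tuples_def)
  have "indep_mod Q {..<n} r (\<lambda>i. grad (f (ii ! i)))"
    by (rule indep_mod_of_minor[OF Q', of _ _ jj]) (use ij li in \<open>auto simp: fminor_def inc_tuples_def tuples_def\<close>)
  moreover obtain p where p: "p \<in> Q" "\<not> in_span_mod Q {..<n} r (\<lambda>i. grad (f (ii ! i))) (grad p)"
    using exists_grad_notin_span[OF Q(1) cQ, of "\<lambda>i. f (ii ! i)"] by blast
  let ?h = "\<lambda>i. if i < r then f (ii ! i) else p"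
  have "indep_mod Q {..<n} (Suc r) (\<lambda>i. grad (?h i))"
  proof (rule indep_mod_Suc[OF Q'])
    show "indep_mod Q {..<n} r (\<lambda>i. grad (?h i))" using calculation by (simp add: indep_mod_def)
    show "\<not> in_span_mod Q {..<n} r (\<lambda>i. grad (?h i)) (grad (?h r))" using p(2) by (simp add: in_span_mod_def)
  qed
  then obtain js where "length js = Suc r" "set js \<subseteq> {..<n}" "minor (\<lambda>i. grad (?h i)) (Suc r) js \<notin> Q"
    using exists_minor_of_indep_mod[OF Q'] by blast
  then have "sort js \<in> inc_tuples (Suc r) n \<and> minor (\<lambda>i. grad (?h i)) (Suc r) (sort js) \<notin> Q"
    by (intro sort_tuple_inc[OF idQ])
  then obtain kk where kk: "kk \<in> inc_tuples (Suc r) n" "natder ii kk p \<notin> Q"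
    by (auto simp: natder_def nat_derivation_def)
  have iiT: "ii \<in> tuples r m" and kkT: "kk \<in> tuples (Suc r) n" using ij kk inc_tuples_tuples by auto
  \<comment> \<open>The value at \<open>p\<close> is a combination of the minors with one column of
    \<open>kk\<close> omitted. One of these is outside Q, therefore outside I, which makes
    \<open>kk\<close> admissible as the column tuple of a natural derivation.\<close>
  have "\<exists>j<Suc r. fminor ii (omit_nth j kk) \<notin> Q"
  proof (rule ccontr)
    assume "\<not> ?thesis"
    then have "natder ii kk p \<in> Q" unfolding natder_expand[OF iiT kkT]
      by (intro ideal_sum[OF idQ] ideal_mult2[OF idQ] ideal_mult[OF idQ]) auto
    then show False using kk by simp
  qed
  then obtain j where j: "j < Suc r" "fminor ii (omit_nth j kk) \<notin> Q" by blast
  have "omit_nth j kk \<in> cols"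
    using omit_nth_inc_tuples[OF kk(1) j(1)] iiT j(2) \<open>I \<subset> Q\<close> unfolding cols_def by blast
  then have "kk \<in> cols_Suc" using kk j unfolding cols_Suc_def by (auto simp: inc_tuples_def tuples_def)
  moreover have "ii \<in> rows" using ij inc_tuples_tuples \<open>I \<subset> Q\<close> unfolding rows_def by blast
  ultimately show False using Q(3) p(1) kk(2) by blast
qed

text \<open>Natural derivations have values in the ideal of maximal minors, which is therefore stable.\<close>

lemma jacobian_criterion_of_no_stable_ideal:
  assumes triv: "\<And>J. is_ideal J \<Longrightarrow> I \<subseteq> J \<Longrightarrow> stable J \<Longrightarrow> J = I \<or> J = UNIV"
    and P: "is_prime P" "I \<subseteq> P"
  shows "jacobian_criterion P"
proof (rule ccontr)
  assume neg: "\<not> jacobian_criterion P"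
  let ?K = "\<lambda>K. is_ideal K \<and> I \<subseteq> K \<and> (\<forall>ii\<in>inc_tuples r m. \<forall>jj\<in>inc_tuples r n. fminor ii jj \<in> K)"
  \<comment> \<open>The ideal generated by I and the maximal minors. Some minor is outside I, so J
    is not I; and J lies in P, so it is not everything.\<close>
  define J where "J = \<Inter>{K. ?K K}"
  have "?K P" using P neg is_prime_is_ideal unfolding jacobian_criterion_def by blast
  then have "J \<subseteq> P" by (auto simp: J_def)
  then have "1 \<notin> J" using prime_1[OF P(1)] by auto
  have minors: "fminor ii jj \<in> J" if "ii \<in> inc_tuples r m" "jj \<in> inc_tuples r n" for ii jj
    using that by (auto simp: J_def)
  have J: "is_ideal J" unfolding is_ideal_def
    by (auto simp: J_def intro: ideal_0 ideal_add ideal_mult)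
  have "stable J" unfolding stable_def
  proof (intro ballI)
    fix ii jj x assume ij: "ii \<in> rows" "jj \<in> cols_Suc"
    have ii: "ii \<in> inc_tuples r m" "ii \<in> tuples r m" and jj: "jj \<in> inc_tuples (Suc r) n" "jj \<in> tuples (Suc r) n"
      using ij by (auto simp: rows_def cols_Suc_def inc_tuples_def)
    show "natder ii jj x \<in> J"
      unfolding natder_expand[OF ii(2) jj(2)]
      by (intro ideal_sum[OF J] ideal_mult2[OF J] ideal_mult[OF J] minors ii omit_nth_inc_tuples[OF jj(1)]) simp
  qed
  moreover have "I \<subseteq> J" by (auto simp: J_def)
  ultimately have "J = I" using triv[OF J] \<open>1 \<notin> J\<close> by auto
  then show False using minors jacobian_criterion_I unfolding jacobian_criterion_def by auto
qed

section \<open>Local generators and chains of primes\<close>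

text \<open>Generators of P modulo I, together with the \<open>f i\<close>, have gradients spanning
  those of all elements of P. If \<open>k\<close> is the rank of the Jacobi matrix modulo P, then
  \<open>codim n P\<close> is at most \<open>k + d\<close>, and the bound on \<open>d\<close> gives
  that r is at most \<open>k\<close>.\<close>

lemma jacobian_criterion_of_few_generators:
  assumes P: "is_prime P" "I \<subseteq> P" and s: "\<And>j. j < d \<Longrightarrow> s j \<in> P"
    and sgen: "\<And>p. p \<in> P \<Longrightarrow> \<exists>c b. c \<notin> P \<and> c * p - (\<Sum>j<d. b j * s j) \<in> I"
    and d: "r + d \<le> codim n P"
  shows "jacobian_criterion P"
proof -
  have P': "prime_over n P" using P by (rule prime_over_superset)
  obtain ii where ii: "ii \<in> inc_tuples (length ii) m" "indep_mod P {..<n} (length ii) (\<lambda>i. grad (f (ii ! i)))"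
    "\<forall>i<m. in_span_mod P {..<n} (length ii) (\<lambda>i. grad (f (ii ! i))) (grad (f i))"
    using exists_maximal_indep_rows[OF P(1) order_refl] by blast
  define k where "k = length ii"
  obtain g where g: "generates_locally n P (codim n P) g" "indep_mod P {..<n} (codim n P) (\<lambda>i. grad (g i))"
    using exists_local_generators[OF P'] by blast
  define v where "v = (\<lambda>i. grad (if i < k then f (ii ! i) else s (i - k)))"
  define w where "w = (\<lambda>i. if i < d then s i else f (i - d))"
  have wP: "w i \<in> P" if "i < d + m" for i
  proof (cases "i < d")
    case False
    then have "i - d < m" using that by simp
    then show ?thesis using False f_in P by (auto simp: w_def)
  qed (use s in \<open>simp add: w_def\<close>)
  have wspan: "in_span_mod P {..<n} (k + d) v (grad (w i))" if "i < d + m" for i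
  proof (cases "i < d")
    case True
    then show ?thesis by (intro in_span_mod_generator[OF P(1), of "k + i"]) (auto simp: v_def w_def)
  next
    case False
    then have "i - d < m" using that by simp
    then have "in_span_mod P {..<n} k (\<lambda>i. grad (f (ii ! i))) (grad (f (i - d)))" using ii(3) k_def by blast
    then have "in_span_mod P {..<n} (k + d) v (grad (f (i - d)))"
      by (rule in_span_mod_mono) (auto simp: v_def)
    then show ?thesis using False by (simp add: w_def)
  qed
  have "in_span_mod P {..<n} (k + d) v (grad (g i))" if "i < codim n P" for i
  proof -
    have gP: "g i \<in> P" using g that by (simp add: generates_locally_def)
    obtain c b where cb: "c \<notin> P" "c * g i - (\<Sum>j<d. b j * s j) \<in> I" using sgen[OF gP] by blast
    obtain b' where b': "retr n (c * g i - (\<Sum>j<d. b j * s j) - (\<Sum>i<m. b' i * f i)) = 0" using gen[OF cb(2)] by blast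
    define e where "e = (\<lambda>i. if i < d then b i else b' (i - d))"
    have split: "(\<Sum>i<d + m. F i) = (\<Sum>i<d. F i) + (\<Sum>i<m. F (d + i))" for F :: "nat \<Rightarrow> 'k mpoly"
      by (induction m) (auto simp: add.assoc)
    have "(\<Sum>i<d + m. e i * w i) = (\<Sum>j<d. b j * s j) + (\<Sum>i<m. b' i * f i)"
      unfolding split by (simp add: e_def w_def)
    then have "c * g i - (\<Sum>j<d. b j * s j) - (\<Sum>i<m. b' i * f i) = c * g i - (\<Sum>i<d + m. e i * w i)"
      by simp
    from grad_in_span[OF P' cb(1) gP wP this] prime_over_pd[OF P' b']
    have "\<forall>l\<in>{..<n}. c * pderiv_mpoly l (g i) - (\<Sum>i<d + m. e i * pderiv_mpoly l (w i)) \<in> P" by blast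
    then show ?thesis
      using in_span_mod_lincomb[OF P(1) _ cb(1), where w = "\<lambda>i. grad (w i)" and b = e and m = "d + m"
          and u = "grad (g i)"] wspan by blast
  qed
  then have "codim n P \<le> card {..<k + d}"
    by (intro indep_mod_le_card_of_spanned[OF P(1) g(2), of _ v]) (auto simp: in_span_mod_def)
  then have rk: "r \<le> k" using d by simp
  \<comment> \<open>The selection produced at least r rows; the first r of them remain independent
    and form an increasing tuple.\<close>
  define i2 where "i2 = take r ii"
  have i2: "length i2 = r" "i2 \<in> inc_tuples r m"
    using ii(1) rk unfolding i2_def inc_tuples_def tuples_def k_def
    by (auto dest: in_set_takeD sorted_wrt_take)
  have "indep_mod P {..<n} r (\<lambda>i. grad (f (ii ! i)))" using indep_mod_mono[OF P(1) ii(2)] rk k_def by simp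
  then have "indep_mod P {..<n} r (\<lambda>i. grad (f (i2 ! i)))"
    using indep_mod_cong[of r "{..<n}" "\<lambda>i. grad (f (i2 ! i))" "\<lambda>i. grad (f (ii ! i))" P] by (simp add: i2_def)
  then show ?thesis using fminor_inc_of_indep[OF P(1) i2(1)] i2(2) unfolding jacobian_criterion_def by blast
qed

text \<open>The rows of a minor outside P are completed to a system \<open>h\<close> of
  \<open>codim n P\<close> elements of P with independent gradients. The first r lie in I, and the
  others are a regular system of parameters of the localization; they stay distinct modulo I, so
  that they can be counted as a set. The primes of the chain contain more and more of the
  \<open>h i\<close>.\<close>

lemma regular_parameters_and_chain:
  assumes P: "is_prime P" "I \<subseteq> P" and crit: "jacobian_criterion P"
  shows "\<exists>h Q. (\<forall>i<codim n P. h i \<in> P) \<and>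
    (\<forall>p\<in>P. \<exists>c b. c \<notin> P \<and> c * p - (\<Sum>i\<in>{r..<codim n P}. b i * h i) \<in> I) \<and>
    (\<forall>i\<in>{r..<codim n P}. \<forall>j\<in>{r..<codim n P}. i \<noteq> j \<longrightarrow> h i - h j \<notin> I) \<and>
    (\<forall>k\<in>{r..codim n P}. is_prime (Q k) \<and> I \<subseteq> Q k \<and> Q k \<subseteq> P) \<and>
    (\<forall>k\<in>{r..<codim n P}. Q k \<subset> Q (Suc k))"
proof -
  have P': "prime_over n P" using P by (rule prime_over_superset)
  note idP = is_prime_is_ideal[OF P(1)]
  define N where "N = codim n P"
  have rN: "r \<le> N" unfolding N_def by (rule codim_mono[OF I P' P(2)])
  obtain ii jj where ij: "ii\<in>inc_tuples r m" "jj\<in>inc_tuples r n" "fminor ii jj \<notin> P"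
    using crit unfolding jacobian_criterion_def by blast
  define \<Delta> where "\<Delta> = fminor ii jj"
  have li: "length ii = r" "length jj = r" "set jj \<subseteq> {..<n}" using ij by (auto simp: inc_tuples_def tuples_def)
  have iim: "ii ! i < m" if "i < r" for i
    using nth_tuple[of ii r m i] ij(1) that by (simp add: inc_tuples_def)
  have \<Delta>P: "\<Delta> \<notin> P" and \<Delta>I: "\<Delta> \<notin> I" using ij P by (auto simp: \<Delta>_def)
  have "indep_mod P {..<n} r (\<lambda>i. grad (f (ii ! i)))"
    by (rule indep_mod_of_minor[OF P(1), of _ _ jj]) (use ij li in \<open>auto simp: fminor_def\<close>)
  moreover obtain g where "generates_locally n P N g" "indep_mod P {..<n} N (\<lambda>i. grad (g i))"
    using exists_local_generators[OF P'] unfolding N_def by blast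
  ultimately obtain h where h: "indep_mod P {..<n} N (\<lambda>i. grad (h i))" "\<forall>i<N. h i \<in> P" "\<forall>i<r. h i = f (ii ! i)"
    using indep_mod_extend[OF P(1), of "{..<n}" N grad g P r "\<lambda>i. f (ii ! i)"] rN f_in iim P(2)
    unfolding generates_locally_def by blast
  have hI: "h i \<in> I" if "i < r" for i using h(3) that f_in iim by simp
  have \<Delta>h: "\<Delta> = minor (\<lambda>i. grad (h i)) r jj"
    unfolding \<Delta>_def fminor_def li by (rule minor_cong) (simp add: h(3))
  have indI: "indep_mod I {..<n} r (\<lambda>i. grad (h i))"
    by (rule indep_mod_of_minor[OF I_prime, of _ _ jj]) (use \<Delta>I \<Delta>h li in auto)
  \<comment> \<open>The denominator \<Delta> is outside P and not merely outside I, so the relation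
    can also be used modulo P.\<close>
  have cramer: "\<exists>b. \<forall>l\<in>{..<n}. \<Delta> * pderiv_mpoly l p - (\<Sum>i<r. b i * pderiv_mpoly l (h i)) \<in> I" if p: "p \<in> I" for p
    unfolding \<Delta>h
    by (rule cramer_mod[OF I_prime _ li(2,3) in_span_grad_I[OF indI hI p]]) (use \<Delta>I \<Delta>h in auto)
  have "generates_locally n P N h"
    unfolding N_def by (rule generates_locally_of_indep[OF P']) (use h N_def in auto)
  then have hgen: "\<exists>c b. c \<notin> P \<and> c * p - (\<Sum>i\<in>{r..<N}. b i * h i) \<in> I" if p: "p \<in> P" for p
  proof -
    obtain c b where cb: "c \<notin> P" "retr n (c * p - (\<Sum>i<N. b i * h i)) = 0"
      using p \<open>generates_locally n P N h\<close> unfolding generates_locally_def by blast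
    have "{..<N} = {..<r} \<union> {r..<N}" using rN by auto
    then have "(\<Sum>i<N. b i * h i) = (\<Sum>i<r. b i * h i) + (\<Sum>i\<in>{r..<N}. b i * h i)"
      by (simp add: sum.union_disjoint ivl_disj_int)
    then have "c * p - (\<Sum>i\<in>{r..<N}. b i * h i) = (c * p - (\<Sum>i<N. b i * h i)) + (\<Sum>i<r. b i * h i)"
      by simp
    also have "\<dots> \<in> I"
      using prime_over_retr_0[OF I cb(2)] hI by (intro ideal_add[OF I_ideal] ideal_sum[OF I_ideal] ideal_mult[OF I_ideal]) auto
    finally show ?thesis using cb(1) by blast
  qed
  \<comment> \<open>If the difference were in I, its gradient would be a combination of those of the
    first r elements, with denominator \<Delta>, contradicting independence modulo P.\<close>
  have hdist: "h i - h j \<notin> I" if i: "i \<in> {r..<N}" and j: "j \<in> {r..<N}" and "i \<noteq> j" for i j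
  proof
    assume "h i - h j \<in> I"
    then obtain b where b: "\<forall>l\<in>{..<n}. \<Delta> * pderiv_mpoly l (h i - h j) - (\<Sum>i<r. b i * pderiv_mpoly l (h i)) \<in> I"
      using cramer by blast
    define a where "a = (\<lambda>k. if k = i then \<Delta> else if k = j then - \<Delta> else if k < r then - b k else 0)"
    have "(\<Sum>k<N. a k * pderiv_mpoly l (h k)) \<in> P" if l: "l \<in> {..<n}" for l
    proof -
      have "(\<Sum>k<N. a k * pderiv_mpoly l (h k)) = (\<Sum>k\<in>{i, j} \<union> {..<r}. a k * pderiv_mpoly l (h k))"
        by (rule sum.mono_neutral_right) (use i j rN in \<open>auto simp: a_def\<close>)
      also have "\<dots> = (\<Sum>k\<in>{i, j}. a k * pderiv_mpoly l (h k)) + (\<Sum>k<r. a k * pderiv_mpoly l (h k))"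
        by (rule sum.union_disjoint) (use i j in auto)
      also have "(\<Sum>k<r. a k * pderiv_mpoly l (h k)) = (\<Sum>k<r. - (b k * pderiv_mpoly l (h k)))"
        by (rule sum.cong) (use i j in \<open>auto simp: a_def\<close>)
      also have "(\<Sum>k\<in>{i, j}. a k * pderiv_mpoly l (h k)) = \<Delta> * pderiv_mpoly l (h i - h j)"
        using \<open>i \<noteq> j\<close> by (simp add: a_def pd_diff algebra_simps)
      finally have "(\<Sum>k<N. a k * pderiv_mpoly l (h k)) = \<Delta> * pderiv_mpoly l (h i - h j) - (\<Sum>i<r. b i * pderiv_mpoly l (h i))"
        by (simp add: sum_negf)
      then show ?thesis using b l P(2) by auto
    qed
    then have "a i \<in> P" using h(1)[unfolded indep_mod_def, THEN spec, of a] i by auto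
    then show False using \<Delta>P by (simp add: a_def)
  qed
  \<comment> \<open>These derivations keep I and \<open>h 0\<close>, ..., \<open>h (k - 1)\<close>
    within any stable ideal, while one of them sends \<open>h k\<close> outside P; a stable prime
    inside P therefore cannot contain \<open>h k\<close>.\<close>
  define DD where "DD = (\<lambda>k. {D. is_derivation D \<and> (\<forall>x\<in>I. D x \<in> I) \<and> (\<forall>i<k. D (h i) = 0)})"
  have DDex: "\<exists>D\<in>DD k. D (h k) \<notin> P" if k: "r \<le> k" "k < N" for k
  proof -
    have "indep_mod P {..<n} (Suc k) (\<lambda>i. grad (h i))" using indep_mod_mono[OF P(1) h(1)] k by simp
    then obtain js where js: "length js = Suc k" "set js \<subseteq> {..<n}" "minor (\<lambda>i. grad (h i)) (Suc k) js \<notin> P"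
      using exists_minor_of_indep_mod[OF P(1)] by blast
    define D where "D = nat_derivation k h js"
    have "D (h k) = minor (\<lambda>i. grad (h i)) (Suc k) js"
      unfolding D_def nat_derivation_def by (rule minor_cong) (auto simp: less_Suc_eq)
    then have "D (h k) \<notin> P" using js by simp
    moreover have kills: "D (h i) = 0" if "i < k" for i unfolding D_def by (rule nat_derivation_kills[OF that])
    \<comment> \<open>Modulo I, the gradient of \<open>p\<close> times \<Delta> is a combination of
      the gradients of the \<open>h i\<close> with \<open>i < r\<close>. Since r is at most
      \<open>k\<close>, these \<open>h i\<close> are killed by D, and \<Delta> can be
      cancelled.\<close>
    moreover have "D p \<in> I" if p: "p \<in> I" for p
    proof -
      obtain b where b: "\<forall>l\<in>{..<n}. \<Delta> * pderiv_mpoly l p - (\<Sum>i<r. b i * pderiv_mpoly l (h i)) \<in> I"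
        using cramer p by blast
      let ?c = "\<lambda>j. (-1) ^ (k + j) * minor (\<lambda>i. grad (h i)) k (omit_nth j js)"
      have exp: "D x = (\<Sum>j<Suc k. ?c j * pderiv_mpoly (js ! j) x)" for x
        unfolding D_def by (rule nat_derivation_expand[OF js(1)])
      have "\<Delta> * D p = (\<Sum>j<Suc k. ?c j * (\<Delta> * pderiv_mpoly (js ! j) p - (\<Sum>i<r. b i * pderiv_mpoly (js ! j) (h i))))
         + (\<Sum>j<Suc k. ?c j * (\<Sum>i<r. b i * pderiv_mpoly (js ! j) (h i)))"
        unfolding exp sum_distrib_left[of \<Delta>] sum.distrib[symmetric]
        by (rule sum.cong) (simp_all add: right_diff_distrib mult_ac)
      also have "(\<Sum>j<Suc k. ?c j * (\<Sum>i<r. b i * pderiv_mpoly (js ! j) (h i))) = (\<Sum>i<r. b i * D (h i))"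
        unfolding exp sum_distrib_left by (subst sum.swap) (simp add: mult_ac)
      also have "\<dots> = 0" by (rule sum.neutral) (use kills k in auto)
      also have "(\<Sum>j<Suc k. ?c j * (\<Delta> * pderiv_mpoly (js ! j) p - (\<Sum>i<r. b i * pderiv_mpoly (js ! j) (h i)))) + 0 \<in> I"
      proof (simp only: add_0_right, intro ideal_sum[OF I_ideal] ideal_mult[OF I_ideal])
        fix j assume "j \<in> {..<Suc k}"
        then have "js ! j \<in> {..<n}" using js by (metis lessThan_iff nth_mem subsetD)
        then show "\<Delta> * pderiv_mpoly (js ! j) p - (\<Sum>i<r. b i * pderiv_mpoly (js ! j) (h i)) \<in> I" using b by blast
      qed
      finally show ?thesis using \<Delta>I by (simp add: prime_mult[OF I_prime])
    qed
    ultimately show ?thesis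
      using is_derivation_nat_derivation[OF js(1), of h] by (intro bexI[of _ D]) (auto simp: DD_def D_def)
  qed
  let ?ok = "\<lambda>U k. prime_over n U \<and> I \<subseteq> U \<and> U \<subseteq> P \<and> (\<forall>i<k. h i \<in> U)"
  \<comment> \<open>Downward induction on \<open>k\<close>, starting with P itself at
    \<open>k = N\<close>: inside a prime containing \<open>h 0\<close>, ..., \<open>h k\<close> a
    smaller one is found that is stable under \<open>DD k\<close>, and it still contains all of
    these except \<open>h k\<close>.\<close>
  have chain: "\<exists>Q. (\<forall>i. k \<le> i \<and> i \<le> N \<longrightarrow> ?ok (Q i) i) \<and> (\<forall>i. k \<le> i \<and> i < N \<longrightarrow> Q i \<subset> Q (Suc i))"
    if "r \<le> k" "k \<le> N" for k
    using that
  proof (induction "N - k" arbitrary: k)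
    case 0
    then have "k = N" by simp
    then show ?case using P' P h(2) by (intro exI[of _ "\<lambda>_. P"]) auto
  next
    case (Suc d)
    then have k: "r \<le> k" "k < N" by auto
    have IH: "\<exists>Q. (\<forall>i. Suc k \<le> i \<and> i \<le> N \<longrightarrow> ?ok (Q i) i) \<and> (\<forall>i. Suc k \<le> i \<and> i < N \<longrightarrow> Q i \<subset> Q (Suc i))"
      by (rule Suc.hyps(1)) (use Suc.hyps(2) k in simp_all)
    obtain Q where Q: "\<And>i. Suc k \<le> i \<and> i \<le> N \<Longrightarrow> ?ok (Q i) i" "\<And>i. Suc k \<le> i \<and> i < N \<Longrightarrow> Q i \<subset> Q (Suc i)"
      using IH by (elim exE conjE) blast
    have ok: "?ok (Q (Suc k)) (Suc k)" using Q(1)[of "Suc k"] k by auto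
    have "\<exists>U. prime_over n U \<and> I \<union> h ` {..<k} \<subseteq> U \<and> U \<subseteq> Q (Suc k) \<and> (\<forall>D\<in>DD k. \<forall>x\<in>U. D x \<in> U)"
    proof (rule exists_stable_prime)
      show "p \<in> I \<union> h ` {..<k}" if "retr n p = 0" for p using prime_over_retr_0[OF I that] by simp
      show "D x \<in> I \<union> h ` {..<k}" if "D \<in> DD k" "x \<in> I \<union> h ` {..<k}" for D x
        using that ideal_0[OF I_ideal] by (auto simp: DD_def)
    qed (use ok in \<open>auto simp: DD_def\<close>)
    then obtain U where U: "prime_over n U" "I \<union> h ` {..<k} \<subseteq> U" "U \<subseteq> Q (Suc k)" "\<forall>D\<in>DD k. \<forall>x\<in>U. D x \<in> U" by blast
    have "h k \<notin> U" using DDex[OF k] U(3,4) ok by blast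
    then have strict: "U \<subset> Q (Suc k)" using U ok by blast
    have okU: "?ok U k" using U ok by auto
    show ?case
    proof (intro exI[of _ "Q(k := U)"] conjI allI impI)
      fix i assume i: "k \<le> i \<and> i \<le> N"
      have "?ok ((Q(k := U)) i) i"
      proof (cases "i = k")
        case False
        then have "Suc k \<le> i \<and> i \<le> N" using i by simp
        from Q(1)[OF this] show ?thesis using False by simp
      qed (use okU in simp)
      then show "prime_over n ((Q(k := U)) i)" "I \<subseteq> (Q(k := U)) i" "(Q(k := U)) i \<subseteq> P" "\<And>j. j < i \<Longrightarrow> h j \<in> (Q(k := U)) i"
        by blast+
    next
      fix i assume i: "k \<le> i \<and> i < N"
      show "(Q(k := U)) i \<subset> (Q(k := U)) (Suc i)"
      proof (cases "i = k")
        case False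
        then have "Suc k \<le> i \<and> i < N" using i by simp
        from Q(2)[OF this] show ?thesis using False i by simp
      qed (use strict in simp)
    qed
  qed
  obtain Q where Q: "\<forall>i. r \<le> i \<and> i \<le> N \<longrightarrow> ?ok (Q i) i" "\<forall>i. r \<le> i \<and> i < N \<longrightarrow> Q i \<subset> Q (Suc i)"
    using chain[OF order_refl rN] by blast
  show ?thesis
    unfolding N_def[symmetric]
  proof (intro exI[of _ h] exI[of _ Q] conjI)
    show "\<forall>k\<in>{r..N}. is_prime (Q k) \<and> I \<subseteq> Q k \<and> Q k \<subseteq> P"
    proof
      fix k assume "k \<in> {r..N}"
      then have "?ok (Q k) k" using Q(1) by simp
      then show "is_prime (Q k) \<and> I \<subseteq> Q k \<and> Q k \<subseteq> P" using prime_over_is_prime by blast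
    qed
  qed (use h(2) hgen hdist Q(2) in auto)
qed

text \<open>Each strict inclusion raises the codimension, which is at least r from the
  start.\<close>

lemma chain_length_le:
  assumes "\<And>i. i \<le> k \<Longrightarrow> is_prime (p i) \<and> I \<subseteq> p i \<and> p i \<subseteq> P" "\<And>i. i < k \<Longrightarrow> p i \<subset> p (Suc i)"
    and P: "is_prime P"
  shows "r + k \<le> codim n P"
proof -
  have po: "prime_over n (p i)" if "i \<le> k" for i using assms(1)[OF that] prime_over_superset by blast
  have "r + i \<le> codim n (p i)" if "i \<le> k" for i
    using that
  proof (induction i)
    case 0
    then show ?case using codim_mono[OF I po[of 0]] assms(1)[of 0] by simp
  next
    case (Suc i)
    have "codim n (p i) < codim n (p (Suc i))"
      using Suc.prems assms(2)[of i] by (intro codim_strict_mono po) auto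
    then show ?case using Suc by simp
  qed
  moreover have "I \<subseteq> P" using assms(1)[of 0] by auto
  then have "codim n (p k) \<le> codim n P"
    using assms(1)[of k] by (intro codim_mono po prime_over_superset[OF P]) auto
  ultimately show ?thesis by fastforce
qed

end

section \<open>Localization of a domain\<close>

locale multiplicative_subset = domain R for R (structure) +
  fixes S
  assumes S_sub: "S \<subseteq> carrier R" and S_one: "\<one> \<in> S" and S_zero: "\<zero> \<notin> S"
    and S_mult: "\<And>s t. s \<in> S \<Longrightarrow> t \<in> S \<Longrightarrow> s \<otimes> t \<in> S"
begin

abbreviation fr where "fr \<equiv> loc_frac R S"
abbreviation L where "L \<equiv> localization R S"

lemma S_carr: "s \<in> S \<Longrightarrow> s \<in> carrier R" using S_sub by auto

text \<open>In a domain the factor \<open>u\<close> from the definition of fractions can be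
  cancelled, as 0 is not in S.\<close>

lemma mem_fr:
  assumes "a \<in> carrier R" "s \<in> S"
  shows "(b, t) \<in> fr a s \<longleftrightarrow> b \<in> carrier R \<and> t \<in> S \<and> a \<otimes> t = b \<otimes> s"
proof -
  have "(\<exists>u\<in>S. u \<otimes> (a \<otimes> t) = u \<otimes> (b \<otimes> s)) \<longleftrightarrow> a \<otimes> t = b \<otimes> s" if "b \<in> carrier R" "t \<in> S"
    using assms that S_carr S_zero S_one by (metis m_closed m_lcancel)
  then show ?thesis unfolding loc_frac_def by auto
qed

lemma fr_eq_iff:
  assumes a: "a \<in> carrier R" "s \<in> S" and b: "b \<in> carrier R" "t \<in> S"
  shows "fr a s = fr b t \<longleftrightarrow> a \<otimes> t = b \<otimes> s"
proof
  assume "fr a s = fr b t"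
  moreover have "(b, t) \<in> fr b t" unfolding mem_fr[OF b] using b by auto
  ultimately show "a \<otimes> t = b \<otimes> s" by (metis mem_fr[OF a])
next
  assume eq: "a \<otimes> t = b \<otimes> s"
  note c = a(1) b(1) S_carr[OF a(2)] S_carr[OF b(2)]
  have "a \<otimes> v = u \<otimes> s \<longleftrightarrow> b \<otimes> v = u \<otimes> t" if uv: "u \<in> carrier R" "v \<in> S" for u v
  proof -
    note c' = c uv(1) S_carr[OF uv(2)]
    have s0: "s \<noteq> \<zero>" "t \<noteq> \<zero>" using a b S_zero by auto
    have "a \<otimes> v = u \<otimes> s \<longleftrightarrow> t \<otimes> (a \<otimes> v) = t \<otimes> (u \<otimes> s)" using c' s0 m_lcancel by auto
    also have "t \<otimes> (a \<otimes> v) = s \<otimes> (b \<otimes> v)" using eq c' by (metis m_assoc m_comm)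
    also have "t \<otimes> (u \<otimes> s) = s \<otimes> (u \<otimes> t)" using c' by algebra
    also have "s \<otimes> (b \<otimes> v) = s \<otimes> (u \<otimes> t) \<longleftrightarrow> b \<otimes> v = u \<otimes> t" using c' s0 m_lcancel by auto
    finally show ?thesis .
  qed
  then have "(u, v) \<in> fr a s \<longleftrightarrow> (u, v) \<in> fr b t" for u v
    unfolding mem_fr[OF a] mem_fr[OF b] by blast
  then show "fr a s = fr b t" by auto
qed

lemma carrier_L: "carrier L = {fr a s |a s. a \<in> carrier R \<and> s \<in> S}"
  by (simp add: localization_def)

lemma fr_closed: "a \<in> carrier R \<Longrightarrow> s \<in> S \<Longrightarrow> fr a s \<in> carrier L"
  unfolding carrier_L by blast

lemma mult_L:
  assumes "a \<in> carrier R" "s \<in> S" "b \<in> carrier R" "t \<in> S"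
  shows "fr a s \<otimes>\<^bsub>L\<^esub> fr b t = fr (a \<otimes> b) (s \<otimes> t)"
proof -
  have "fr (fst x \<otimes> fst y) (snd x \<otimes> snd y) = fr (a \<otimes> b) (s \<otimes> t)" if "x \<in> fr a s" "y \<in> fr b t" for x y
  proof -
    obtain a' s' b' t' where xy: "x = (a', s')" "y = (b', t')" by (cases x, cases y)
    have *: "a' \<in> carrier R" "s' \<in> S" "a \<otimes> s' = a' \<otimes> s" "b' \<in> carrier R" "t' \<in> S" "b \<otimes> t' = b' \<otimes> t"
      using that unfolding xy mem_fr[OF assms(1,2)] mem_fr[OF assms(3,4)] by auto
    note c = assms(1,3) *(1,4) S_carr[OF assms(2)] S_carr[OF assms(4)] S_carr[OF *(2)] S_carr[OF *(5)]
    have "(a' \<otimes> b') \<otimes> (s \<otimes> t) = (a' \<otimes> s) \<otimes> (b' \<otimes> t)" using c by algebra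
    also have "\<dots> = (a \<otimes> s') \<otimes> (b \<otimes> t')" using * by simp
    also have "\<dots> = (a \<otimes> b) \<otimes> (s' \<otimes> t')" using c by algebra
    finally show ?thesis unfolding xy using c * assms S_mult by (simp add: fr_eq_iff)
  qed
  moreover have "(a, s) \<in> fr a s" "(b, t) \<in> fr b t"
    unfolding mem_fr[OF assms(1,2)] mem_fr[OF assms(3,4)] using assms by auto
  ultimately have "(\<Union>x\<in>fr a s. \<Union>y\<in>fr b t. fr (fst x \<otimes> fst y) (snd x \<otimes> snd y)) = fr (a \<otimes> b) (s \<otimes> t)"
    by blast
  then show ?thesis by (simp add: localization_def)
qed

lemma add_L:
  assumes "a \<in> carrier R" "s \<in> S" "b \<in> carrier R" "t \<in> S"
  shows "fr a s \<oplus>\<^bsub>L\<^esub> fr b t = fr (a \<otimes> t \<oplus> b \<otimes> s) (s \<otimes> t)"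
proof -
  have "fr (fst x \<otimes> snd y \<oplus> fst y \<otimes> snd x) (snd x \<otimes> snd y) = fr (a \<otimes> t \<oplus> b \<otimes> s) (s \<otimes> t)"
    if "x \<in> fr a s" "y \<in> fr b t" for x y
  proof -
    obtain a' s' b' t' where xy: "x = (a', s')" "y = (b', t')" by (cases x, cases y)
    have *: "a' \<in> carrier R" "s' \<in> S" "a \<otimes> s' = a' \<otimes> s" "b' \<in> carrier R" "t' \<in> S" "b \<otimes> t' = b' \<otimes> t"
      using that unfolding xy mem_fr[OF assms(1,2)] mem_fr[OF assms(3,4)] by auto
    note c = assms(1,3) *(1,4) S_carr[OF assms(2)] S_carr[OF assms(4)] S_carr[OF *(2)] S_carr[OF *(5)]
    have "(a' \<otimes> t' \<oplus> b' \<otimes> s') \<otimes> (s \<otimes> t) = (a' \<otimes> s) \<otimes> (t \<otimes> t') \<oplus> (b' \<otimes> t) \<otimes> (s \<otimes> s')" using c by algebra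
    also have "\<dots> = (a \<otimes> s') \<otimes> (t \<otimes> t') \<oplus> (b \<otimes> t') \<otimes> (s \<otimes> s')" using * by simp
    also have "\<dots> = (a \<otimes> t \<oplus> b \<otimes> s) \<otimes> (s' \<otimes> t')" using c by algebra
    finally show ?thesis unfolding xy using c * assms S_mult by (simp add: fr_eq_iff)
  qed
  moreover have "(a, s) \<in> fr a s" "(b, t) \<in> fr b t"
    unfolding mem_fr[OF assms(1,2)] mem_fr[OF assms(3,4)] using assms by auto
  ultimately have "(\<Union>x\<in>fr a s. \<Union>y\<in>fr b t. fr (fst x \<otimes> snd y \<oplus> fst y \<otimes> snd x) (snd x \<otimes> snd y)) = fr (a \<otimes> t \<oplus> b \<otimes> s) (s \<otimes> t)"
    by blast
  then show ?thesis by (simp add: localization_def)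
qed

lemma one_L: "\<one>\<^bsub>L\<^esub> = fr \<one> \<one>" and zero_L: "\<zero>\<^bsub>L\<^esub> = fr \<zero> \<one>"
  by (simp_all add: localization_def)

lemma L_cases:
  assumes "x \<in> carrier L" obtains a s where "x = fr a s" "a \<in> carrier R" "s \<in> S" "s \<in> carrier R"
  using assms S_carr unfolding carrier_L by blast

lemma cring_L: "cring L"
proof (rule cringI)
  show "abelian_group L"
  proof (rule abelian_groupI)
    fix x y assume xy: "x \<in> carrier L" "y \<in> carrier L"
    obtain a s where 1: "x = fr a s" "a \<in> carrier R" "s \<in> S" "s \<in> carrier R" using xy(1) by (rule L_cases)
    obtain b t where 2: "y = fr b t" "b \<in> carrier R" "t \<in> S" "t \<in> carrier R" using xy(2) by (rule L_cases)
    note * = 1 2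
    show "x \<oplus>\<^bsub>L\<^esub> y \<in> carrier L" using * S_mult by (simp add: add_L fr_closed)
    show "x \<oplus>\<^bsub>L\<^esub> y = y \<oplus>\<^bsub>L\<^esub> x" using * by (simp add: add_L m_comm a_comm)
  next
    show "\<zero>\<^bsub>L\<^esub> \<in> carrier L" by (simp add: zero_L fr_closed S_one)
  next
    fix x y z assume xyz: "x \<in> carrier L" "y \<in> carrier L" "z \<in> carrier L"
    obtain a s where 1: "x = fr a s" "a \<in> carrier R" "s \<in> S" "s \<in> carrier R" using xyz(1) by (rule L_cases)
    obtain b t where 2: "y = fr b t" "b \<in> carrier R" "t \<in> S" "t \<in> carrier R" using xyz(2) by (rule L_cases)
    obtain c u where 3: "z = fr c u" "c \<in> carrier R" "u \<in> S" "u \<in> carrier R" using xyz(3) by (rule L_cases)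
    note * = 1 2 3
    have "(a \<otimes> t \<oplus> b \<otimes> s) \<otimes> u \<oplus> c \<otimes> (s \<otimes> t) = a \<otimes> (t \<otimes> u) \<oplus> (b \<otimes> u \<oplus> c \<otimes> t) \<otimes> s"
      using * by algebra
    then show "x \<oplus>\<^bsub>L\<^esub> y \<oplus>\<^bsub>L\<^esub> z = x \<oplus>\<^bsub>L\<^esub> (y \<oplus>\<^bsub>L\<^esub> z)"
      using * S_mult by (simp add: add_L m_assoc)
  next
    fix x assume "x \<in> carrier L"
    then obtain a s where *: "x = fr a s" "a \<in> carrier R" "s \<in> S" "s \<in> carrier R" by (rule L_cases)
    show "\<zero>\<^bsub>L\<^esub> \<oplus>\<^bsub>L\<^esub> x = x" using * S_one by (simp add: zero_L add_L)
    have "fr (\<ominus> a) s \<oplus>\<^bsub>L\<^esub> x = fr ((\<ominus> a) \<otimes> s \<oplus> a \<otimes> s) (s \<otimes> s)" using * by (simp add: add_L)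
    also have "(\<ominus> a) \<otimes> s \<oplus> a \<otimes> s = \<zero>" using * by algebra
    also have "fr \<zero> (s \<otimes> s) = \<zero>\<^bsub>L\<^esub>" unfolding zero_L using * S_mult S_one by (simp add: fr_eq_iff)
    finally have "fr (\<ominus> a) s \<oplus>\<^bsub>L\<^esub> x = \<zero>\<^bsub>L\<^esub>" .
    moreover have "fr (\<ominus> a) s \<in> carrier L" using * by (simp add: fr_closed)
    ultimately show "\<exists>y\<in>carrier L. y \<oplus>\<^bsub>L\<^esub> x = \<zero>\<^bsub>L\<^esub>" by (rule bexI)
  qed
  show "comm_monoid L"
  proof (rule comm_monoidI)
    fix x y assume xy: "x \<in> carrier L" "y \<in> carrier L"
    obtain a s where 1: "x = fr a s" "a \<in> carrier R" "s \<in> S" "s \<in> carrier R" using xy(1) by (rule L_cases)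
    obtain b t where 2: "y = fr b t" "b \<in> carrier R" "t \<in> S" "t \<in> carrier R" using xy(2) by (rule L_cases)
    note * = 1 2
    show "x \<otimes>\<^bsub>L\<^esub> y \<in> carrier L" using * S_mult by (simp add: mult_L fr_closed)
    show "x \<otimes>\<^bsub>L\<^esub> y = y \<otimes>\<^bsub>L\<^esub> x" using * by (simp add: mult_L m_comm)
  next
    show "\<one>\<^bsub>L\<^esub> \<in> carrier L" by (simp add: one_L fr_closed S_one)
  next
    fix x y z assume xyz: "x \<in> carrier L" "y \<in> carrier L" "z \<in> carrier L"
    obtain a s where 1: "x = fr a s" "a \<in> carrier R" "s \<in> S" "s \<in> carrier R" using xyz(1) by (rule L_cases)
    obtain b t where 2: "y = fr b t" "b \<in> carrier R" "t \<in> S" "t \<in> carrier R" using xyz(2) by (rule L_cases)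
    obtain c u where 3: "z = fr c u" "c \<in> carrier R" "u \<in> S" "u \<in> carrier R" using xyz(3) by (rule L_cases)
    note * = 1 2 3
    show "x \<otimes>\<^bsub>L\<^esub> y \<otimes>\<^bsub>L\<^esub> z = x \<otimes>\<^bsub>L\<^esub> (y \<otimes>\<^bsub>L\<^esub> z)"
      using * S_mult by (simp add: mult_L m_assoc)
  next
    fix x assume "x \<in> carrier L"
    then obtain a s where *: "x = fr a s" "a \<in> carrier R" "s \<in> S" "s \<in> carrier R" by (rule L_cases)
    show "\<one>\<^bsub>L\<^esub> \<otimes>\<^bsub>L\<^esub> x = x" using * S_one by (simp add: one_L mult_L)
  qed
  fix x y z assume xyz: "x \<in> carrier L" "y \<in> carrier L" "z \<in> carrier L"
  obtain a s where 1: "x = fr a s" "a \<in> carrier R" "s \<in> S" "s \<in> carrier R" using xyz(1) by (rule L_cases)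
  obtain b t where 2: "y = fr b t" "b \<in> carrier R" "t \<in> S" "t \<in> carrier R" using xyz(2) by (rule L_cases)
  obtain c u where 3: "z = fr c u" "c \<in> carrier R" "u \<in> S" "u \<in> carrier R" using xyz(3) by (rule L_cases)
  note * = 1 2 3
  have "(a \<otimes> t \<oplus> b \<otimes> s) \<otimes> c \<otimes> (s \<otimes> u \<otimes> (t \<otimes> u)) = (a \<otimes> c \<otimes> (t \<otimes> u) \<oplus> b \<otimes> c \<otimes> (s \<otimes> u)) \<otimes> (s \<otimes> t \<otimes> u)"
    using * by algebra
  then show "(x \<oplus>\<^bsub>L\<^esub> y) \<otimes>\<^bsub>L\<^esub> z = x \<otimes>\<^bsub>L\<^esub> z \<oplus>\<^bsub>L\<^esub> y \<otimes>\<^bsub>L\<^esub> z"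
    using * S_mult by (simp add: add_L mult_L fr_eq_iff)
qed

lemma fr_one_mult: "a \<in> carrier R \<Longrightarrow> b \<in> carrier R \<Longrightarrow> fr (a \<otimes> b) \<one> = fr a \<one> \<otimes>\<^bsub>L\<^esub> fr b \<one>"
  using S_one by (simp add: mult_L)

lemma fr_one_add: "a \<in> carrier R \<Longrightarrow> b \<in> carrier R \<Longrightarrow> fr (a \<oplus> b) \<one> = fr a \<one> \<oplus>\<^bsub>L\<^esub> fr b \<one>"
  using S_one by (simp add: add_L)

lemma fr_one_eq_zero: "a \<in> carrier R \<Longrightarrow> fr a \<one> = \<zero>\<^bsub>L\<^esub> \<longleftrightarrow> a = \<zero>"
  using S_one by (simp add: zero_L fr_eq_iff)

lemma fr_one_Units:
  assumes "s \<in> S" shows "fr s \<one> \<in> Units L"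
proof -
  have "fr \<one> s \<otimes>\<^bsub>L\<^esub> fr s \<one> = \<one>\<^bsub>L\<^esub>" "fr s \<one> \<otimes>\<^bsub>L\<^esub> fr \<one> s = \<one>\<^bsub>L\<^esub>"
    using assms S_one S_carr[OF assms] by (simp_all add: one_L mult_L fr_eq_iff)
  then show ?thesis using fr_closed assms S_one S_carr[OF assms] unfolding Units_def by blast
qed

lemma fr_one_surj:
  assumes "y \<in> carrier L"
  shows "\<exists>a\<in>carrier R. \<exists>s\<in>S. fr s \<one> \<otimes>\<^bsub>L\<^esub> y = fr a \<one>"
proof -
  obtain a s where *: "y = fr a s" "a \<in> carrier R" "s \<in> S" "s \<in> carrier R" using assms by (rule L_cases)
  have "fr s \<one> \<otimes>\<^bsub>L\<^esub> y = fr a \<one>" using * S_one by (simp add: mult_L fr_eq_iff m_comm)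
  then show ?thesis using * by blast
qed

end

section \<open>Localizations of quotients of a commutative ring type\<close>

text \<open>A ring homomorphism from the polynomial type to a ring given by a carrier, with kernel
  I. The projection onto A and its composites with localizations are both of this kind, so that
  ideals are studied through their preimages.\<close>

locale type_hom = cring L for L :: "('b, 'c) ring_scheme" (structure) +
  fixes \<theta> :: "'a::comm_ring_1 \<Rightarrow> 'b" and I :: "'a set"
  assumes hom_closed: "\<And>x. \<theta> x \<in> carrier L"
    and hom_add: "\<And>x y. \<theta> (x + y) = \<theta> x \<oplus> \<theta> y"
    and hom_mult: "\<And>x y. \<theta> (x * y) = \<theta> x \<otimes> \<theta> y"
    and hom_one: "\<theta> 1 = \<one>"
    and hom_kernel: "\<And>x. \<theta> x = \<zero> \<longleftrightarrow> x \<in> I"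
begin

lemma hom_zero: "\<theta> 0 = \<zero>"
proof -
  have "\<theta> 0 \<oplus> \<theta> 0 = \<theta> 0 \<oplus> \<zero>" using hom_add[of 0 0] hom_closed[of 0] by simp
  then show ?thesis using hom_closed zero_closed by (metis add.l_cancel)
qed

lemma hom_uminus: "\<theta> (- x) = \<ominus> \<theta> x"
proof -
  have "\<theta> (- x) \<oplus> \<theta> x = \<zero>" using hom_add[of "- x" x] hom_zero by simp
  then show ?thesis using hom_closed by (metis minus_equality)
qed

lemma hom_diff: "\<theta> (x - y) = \<theta> x \<ominus> \<theta> y"
  using hom_add[of x "- y"] by (simp add: hom_uminus a_minus_def)

lemma hom_eq_iff: "\<theta> x = \<theta> y \<longleftrightarrow> x - y \<in> I"
  unfolding hom_kernel[symmetric] hom_diff using hom_closed by (metis r_right_minus_eq)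

lemma hom_sum: "finite A \<Longrightarrow> \<theta> (sum g A) = (\<Oplus>i\<in>A. \<theta> (g i))"
  by (induction A rule: finite_induct) (auto simp: hom_zero hom_add hom_closed)

lemma hom_prod: "finite A \<Longrightarrow> \<theta> (prod g A) = (\<Otimes>i\<in>A. \<theta> (g i))"
  by (induction A rule: finite_induct) (auto simp: hom_one hom_mult hom_closed)

lemma ideal_vimage:
  assumes "ideal K L" shows "is_ideal {x. \<theta> x \<in> K}" "I \<subseteq> {x. \<theta> x \<in> K}"
proof -
  interpret K: ideal K L by fact
  show "is_ideal {x. \<theta> x \<in> K}"
    unfolding is_ideal_def by (auto simp: hom_zero hom_add hom_mult hom_closed K.I_l_closed)
  show "I \<subseteq> {x. \<theta> x \<in> K}" using hom_kernel K.zero_closed by (metis (mono_tags, lifting) mem_Collect_eq subsetI)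
qed

lemma primeideal_vimage:
  assumes "primeideal K L" shows "is_prime {x. \<theta> x \<in> K}"
proof -
  interpret K: primeideal K L by fact
  have "\<one> \<notin> K" using K.one_imp_carrier K.I_notcarr by auto
  then show ?thesis
    using ideal_vimage(1)[OF K.is_ideal] K.I_prime hom_closed
    unfolding is_prime_def by (auto simp: hom_one hom_mult)
qed

end

text \<open>Characterizes L as the localization at P of the ring modulo I: elements outside P become
  units, and every element of L is a fraction of images. The field of fractions of A is the case in
  which P is I.\<close>

locale localization_model = type_hom L \<theta> I
  for L :: "('b, 'c) ring_scheme" (structure) and \<theta> :: "'a::comm_ring_1 \<Rightarrow> 'b" and I +
  fixes P :: "'a set"
  assumes prime_I: "is_prime I" and prime_P: "is_prime P" and I_sub_P: "I \<subseteq> P"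
    and hom_Units: "\<And>s. s \<notin> P \<Longrightarrow> \<theta> s \<in> Units L"
    and hom_frac: "\<And>y. y \<in> carrier L \<Longrightarrow> \<exists>a s. s \<notin> P \<and> \<theta> s \<otimes> y = \<theta> a"
begin

lemma ideal_cancel:
  assumes "ideal K L" "s \<notin> P" "y \<in> carrier L" "\<theta> s \<otimes> y \<in> K"
  shows "y \<in> K"
proof -
  interpret K: ideal K L by fact
  have u: "\<theta> s \<in> Units L" by (rule hom_Units[OF assms(2)])
  have "inv (\<theta> s) \<otimes> (\<theta> s \<otimes> y) \<in> K" using assms(4) u by (rule K.I_l_closed[OF _ Units_inv_closed])
  also have "inv (\<theta> s) \<otimes> (\<theta> s \<otimes> y) = y"
    using u assms(3) hom_closed by (metis Units_inv_closed Units_l_inv l_one m_assoc)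
  finally show ?thesis .
qed

text \<open>Denominators are units, so an ideal of the localization is determined by its
  preimage.\<close>

lemma ideal_subset_of_vimage:
  assumes "ideal K L" "ideal K' L" "\<And>x. \<theta> x \<in> K \<Longrightarrow> \<theta> x \<in> K'"
  shows "K \<subseteq> K'"
proof
  fix y assume y: "y \<in> K"
  then have yc: "y \<in> carrier L" using assms(1) by (meson ideal.Icarr)
  obtain a s where as: "s \<notin> P" "\<theta> s \<otimes> y = \<theta> a" using hom_frac[OF yc] by blast
  have "\<theta> a \<in> K" using as(2) y assms(1) hom_closed by (metis ideal.I_l_closed)
  then have "\<theta> s \<otimes> y \<in> K'" using as assms(3) by simp
  then show "y \<in> K'" using ideal_cancel[OF assms(2) as(1) yc] by simp
qed

text \<open>For an ideal J this is the ideal of L generated by the image of J, written out as the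
  set of fractions with numerator in J.\<close>

definition extension where
  "extension J = {y \<in> carrier L. \<exists>a\<in>J. \<exists>s. s \<notin> P \<and> \<theta> s \<otimes> y = \<theta> a}"

lemma extension_ideal:
  assumes J: "is_ideal J" shows "ideal (extension J) L"
proof (rule idealI[OF ring_axioms])
  have mul: "x \<otimes> y \<in> extension J" if y: "y \<in> extension J" and x: "x \<in> carrier L" for x y
  proof -
    obtain a s where as: "a \<in> J" "s \<notin> P" "\<theta> s \<otimes> y = \<theta> a" "y \<in> carrier L" using y by (auto simp: extension_def)
    obtain b t where bt: "t \<notin> P" "\<theta> t \<otimes> x = \<theta> b" using hom_frac[OF x] by blast
    have "\<theta> (t * s) \<otimes> (x \<otimes> y) = (\<theta> t \<otimes> x) \<otimes> (\<theta> s \<otimes> y)"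
      using x as(4) hom_closed[of t] hom_closed[of s] unfolding hom_mult by algebra
    also have "\<dots> = \<theta> (b * a)" using as bt by (simp add: hom_mult)
    finally show ?thesis
      using as bt x ideal_mult[OF J as(1), of b] prime_mult[OF prime_P, of t s] unfolding extension_def by auto
  qed
  then show "\<And>a x. a \<in> extension J \<Longrightarrow> x \<in> carrier L \<Longrightarrow> x \<otimes> a \<in> extension J" .
  show "a \<otimes> x \<in> extension J" if "a \<in> extension J" "x \<in> carrier L" for a x
    using mul[OF that] that m_comm[of a x] by (simp add: extension_def)
  show "subgroup (extension J) (add_monoid L)"
  proof (rule add.subgroupI)
    show "extension J \<subseteq> carrier L" by (auto simp: extension_def)
    have "\<theta> 1 \<otimes> \<zero> = \<theta> 0" by (simp add: hom_zero hom_closed)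
    then have "\<zero> \<in> extension J" using ideal_0[OF J] prime_1[OF prime_P] unfolding extension_def by auto
    then show "extension J \<noteq> {}" by blast
    show "\<ominus> y \<in> extension J" if "y \<in> extension J" for y
      using mul[OF that, of "\<ominus> \<one>"] that by (simp add: extension_def l_minus)
    show "x \<oplus> y \<in> extension J" if xy: "x \<in> extension J" "y \<in> extension J" for x y
    proof -
      obtain a s b t where as: "a \<in> J" "s \<notin> P" "\<theta> s \<otimes> x = \<theta> a" "x \<in> carrier L"
        "b \<in> J" "t \<notin> P" "\<theta> t \<otimes> y = \<theta> b" "y \<in> carrier L" using xy by (auto simp: extension_def)
      have "\<theta> (s * t) \<otimes> (x \<oplus> y) = \<theta> t \<otimes> (\<theta> s \<otimes> x) \<oplus> \<theta> s \<otimes> (\<theta> t \<otimes> y)"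
        using as(4,8) hom_closed[of t] hom_closed[of s] unfolding hom_mult by algebra
      also have "\<dots> = \<theta> (t * a + s * b)" using as by (simp add: hom_mult hom_add)
      finally have "\<theta> (s * t) \<otimes> (x \<oplus> y) = \<theta> (t * a + s * b)" .
      moreover have "t * a + s * b \<in> J" using as by (intro ideal_add[OF J] ideal_mult[OF J])
      moreover have "s * t \<notin> P" using as by (simp add: prime_mult[OF prime_P])
      ultimately show ?thesis using as(4,8) unfolding extension_def by blast
    qed
  qed
qed

lemma hom_in_extension:
  assumes J: "is_prime J" "I \<subseteq> J" "J \<subseteq> P"
  shows "\<theta> x \<in> extension J \<longleftrightarrow> x \<in> J"
proof
  assume "x \<in> J"
  moreover have "\<theta> 1 \<otimes> \<theta> x = \<theta> x" by (simp flip: hom_mult)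
  ultimately show "\<theta> x \<in> extension J" using hom_closed prime_1[OF prime_P] unfolding extension_def by blast
next
  assume "\<theta> x \<in> extension J"
  then obtain a s where as: "a \<in> J" "s \<notin> P" "\<theta> (s * x) = \<theta> a" by (auto simp: extension_def hom_mult)
  then have "s * x - a \<in> J" using hom_eq_iff J(2) by blast
  then have "s * x \<in> J" using as(1) ideal_cong[OF is_prime_is_ideal[OF J(1)]] by blast
  then show "x \<in> J" using as J by (auto simp: prime_mult[OF J(1)])
qed

lemma extension_primeideal:
  assumes J: "is_prime J" "I \<subseteq> J" "J \<subseteq> P"
  shows "primeideal (extension J) L"
proof (rule primeidealI[OF extension_ideal is_cring])
  show "is_ideal J" using J is_prime_is_ideal by auto
  have "\<one> \<notin> extension J" using hom_in_extension[OF J, of 1] prime_1[OF J(1)] by (simp add: hom_one)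
  then show "carrier L \<noteq> extension J" by auto
  fix x y assume xy: "x \<in> carrier L" "y \<in> carrier L" "x \<otimes> y \<in> extension J"
  note id = extension_ideal[OF is_prime_is_ideal[OF J(1)]]
  obtain a s where as: "s \<notin> P" "\<theta> s \<otimes> x = \<theta> a" using hom_frac xy by blast
  obtain b t where bt: "t \<notin> P" "\<theta> t \<otimes> y = \<theta> b" using hom_frac xy by blast
  have "\<theta> (a * b) = \<theta> (s * t) \<otimes> (x \<otimes> y)"
    using xy hom_closed[of t] hom_closed[of s] unfolding hom_mult as(2)[symmetric] bt(2)[symmetric] by algebra
  also have "\<dots> \<in> extension J" using xy id hom_closed by (metis ideal.I_l_closed)
  finally have "a \<in> J \<or> b \<in> J" unfolding hom_in_extension[OF J] by (simp add: prime_mult[OF J(1)])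
  then show "x \<in> extension J \<or> y \<in> extension J" using as bt xy unfolding extension_def by auto
qed

lemma vimage_subset_P:
  assumes K: "ideal K L" "K \<noteq> carrier L" shows "{x. \<theta> x \<in> K} \<subseteq> P"
proof (rule ccontr)
  assume "\<not> ?thesis"
  then obtain s where s: "\<theta> s \<in> K" "s \<notin> P" by auto
  then have "\<one> \<in> K" using ideal_cancel[OF K(1) s(2), of \<one>] hom_closed by simp
  then show False using K ideal.one_imp_carrier by auto
qed

lemma extension_P_maximal:
  shows "maximalideal (extension P) L" "\<And>M. maximalideal M L \<Longrightarrow> M = extension P"
proof -
  note idP = extension_ideal[OF is_prime_is_ideal[OF prime_P]]
  have nc: "extension P \<noteq> carrier L"
    using primeideal.I_notcarr[OF extension_primeideal[OF prime_P I_sub_P order_refl]] by blast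
  have sub: "K \<subseteq> extension P" if "ideal K L" "K \<noteq> carrier L" for K
    by (rule ideal_subset_of_vimage[OF that(1) idP])
      (use vimage_subset_P[OF that] hom_in_extension[OF prime_P I_sub_P order_refl] in auto)
  show "maximalideal (extension P) L"
    by (rule maximalidealI[OF idP]) (use nc sub in blast)+
  fix M assume "maximalideal M L"
  then interpret M: maximalideal M L .
  have "M \<subseteq> extension P" using sub M.is_ideal M.I_notcarr by auto
  then show "M = extension P" using M.I_maximal[OF idP] nc idP by (auto dest: ideal.Icarr)
qed

text \<open>Chains are carried over by preimages in one direction and by extensions in the other;
  both keep inclusions strict, and the primes met lie between I and P.\<close>

lemma krull_dim_eq:
  "krull_dim L = Sup {enat k |k. \<exists>p. (\<forall>i\<le>k. is_prime (p i) \<and> I \<subseteq> p i \<and> p i \<subseteq> P) \<and> (\<forall>i<k. p i \<subset> p (Suc i))}"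
proof -
  have "(\<exists>p. (\<forall>i\<le>k. primeideal (p i) L) \<and> (\<forall>i<k. p i \<subset> p (Suc i))) \<longleftrightarrow>
    (\<exists>p. (\<forall>i\<le>k. is_prime (p i) \<and> I \<subseteq> p i \<and> p i \<subseteq> P) \<and> (\<forall>i<k. p i \<subset> p (Suc i)))" for k :: nat
  proof
    assume "\<exists>p. (\<forall>i\<le>k. primeideal (p i) L) \<and> (\<forall>i<k. p i \<subset> p (Suc i))"
    then obtain p where p: "\<And>i. i \<le> k \<Longrightarrow> primeideal (p i) L" "\<And>i. i < k \<Longrightarrow> p i \<subset> p (Suc i)" by blast
    let ?q = "\<lambda>i. {x. \<theta> x \<in> p i}"
    have id: "ideal (p i) L" "p i \<noteq> carrier L" if "i \<le> k" for i
      using primeideal.I_notcarr[OF p(1)[OF that]] primeideal.axioms(1)[OF p(1)[OF that]] by auto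
    show "\<exists>p. (\<forall>i\<le>k. is_prime (p i) \<and> I \<subseteq> p i \<and> p i \<subseteq> P) \<and> (\<forall>i<k. p i \<subset> p (Suc i))"
    proof (intro exI[of _ ?q] conjI allI impI)
      fix i assume i: "i \<le> k"
      show "is_prime (?q i)" by (rule primeideal_vimage[OF p(1)[OF i]])
      show "I \<subseteq> ?q i" by (rule ideal_vimage(2)[OF id(1)[OF i]])
      show "?q i \<subseteq> P" by (rule vimage_subset_P[OF id[OF i]])
    next
      fix i assume i: "i < k"
      have "\<not> ?q (Suc i) \<subseteq> ?q i"
      proof
        assume "?q (Suc i) \<subseteq> ?q i"
        then have "p (Suc i) \<subseteq> p i" using i by (intro ideal_subset_of_vimage id(1)) auto
        then show False using p(2)[OF i] by auto
      qed
      then show "?q i \<subset> ?q (Suc i)" using p(2)[OF i] by auto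
    qed
  next
    assume "\<exists>p. (\<forall>i\<le>k. is_prime (p i) \<and> I \<subseteq> p i \<and> p i \<subseteq> P) \<and> (\<forall>i<k. p i \<subset> p (Suc i))"
    then obtain p where p: "\<And>i. i \<le> k \<Longrightarrow> is_prime (p i)" "\<And>i. i \<le> k \<Longrightarrow> I \<subseteq> p i" "\<And>i. i \<le> k \<Longrightarrow> p i \<subseteq> P"
      "\<And>i. i < k \<Longrightarrow> p i \<subset> p (Suc i)" by blast
    show "\<exists>p. (\<forall>i\<le>k. primeideal (p i) L) \<and> (\<forall>i<k. p i \<subset> p (Suc i))"
    proof (intro exI[of _ "\<lambda>i. extension (p i)"] conjI allI impI)
      fix i assume "i \<le> k"
      then show "primeideal (extension (p i)) L" using p by (intro extension_primeideal)
    next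
      fix i assume i: "i < k"
      obtain x where x: "x \<in> p (Suc i)" "x \<notin> p i" using p(4)[OF i] by auto
      have "\<theta> x \<in> extension (p (Suc i))" "\<theta> x \<notin> extension (p i)"
        using x i hom_in_extension[OF p(1-3)[of "Suc i"]] hom_in_extension[OF p(1-3)[of i]] by auto
      moreover have "extension (p i) \<subseteq> extension (p (Suc i))" using p(4)[OF i] by (auto simp: extension_def)
      ultimately show "extension (p i) \<subset> extension (p (Suc i))" by blast
    qed
  qed
  then show ?thesis unfolding krull_dim_def by simp
qed

lemma noetherian_L:
  assumes fg: "\<And>J. is_ideal J \<Longrightarrow> I \<subseteq> J \<Longrightarrow>
     \<exists>G. finite G \<and> G \<subseteq> J \<and> (\<forall>J'. is_ideal J' \<longrightarrow> I \<subseteq> J' \<longrightarrow> G \<subseteq> J' \<longrightarrow> J \<subseteq> J')"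
  shows "noetherian_ring L"
proof (intro noetherian_ring.intro noetherian_ring_axioms.intro ring_axioms)
  fix K assume K: "ideal K L"
  obtain G where G: "finite G" "G \<subseteq> {x. \<theta> x \<in> K}"
    "\<And>J'. is_ideal J' \<Longrightarrow> I \<subseteq> J' \<Longrightarrow> G \<subseteq> J' \<Longrightarrow> {x. \<theta> x \<in> K} \<subseteq> J'"
    using fg[OF ideal_vimage[OF K]] by blast
  have c: "\<theta> ` G \<subseteq> carrier L" using hom_closed by auto
  note id = genideal_ideal[OF c]
  have "K = Idl (\<theta> ` G)"
  proof
    show "Idl (\<theta> ` G) \<subseteq> K" using G(2) by (intro genideal_minimal[OF K]) auto
    have "G \<subseteq> {x. \<theta> x \<in> Idl (\<theta> ` G)}" using genideal_self[OF c] by auto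
    from G(3)[OF ideal_vimage[OF id] this] show "K \<subseteq> Idl (\<theta> ` G)"
      by (intro ideal_subset_of_vimage[OF K id]) auto
  qed
  then show "\<exists>A\<subseteq>carrier L. finite A \<and> K = Idl A" using c G(1) by (intro exI[of _ "\<theta> ` G"]) auto
qed

end

section \<open>Regularity of the localizations\<close>

context affine_presentation
begin

lemma ideal_finitely_generated:
  assumes J: "is_ideal J" "I \<subseteq> J"
  shows "\<exists>G. finite G \<and> G \<subseteq> J \<and> (\<forall>J'. is_ideal J' \<longrightarrow> I \<subseteq> J' \<longrightarrow> G \<subseteq> J' \<longrightarrow> J \<subseteq> J')"
proof -
  have kern: "\<forall>p. retr n p = 0 \<longrightarrow> p \<in> J'" if "I \<subseteq> J'" for J' using prime_over_retr_0[OF I] that by blast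
  have retr: "retr n p \<in> J" if "p \<in> J" for p
  proof -
    have "retr n (p - retr n p) = 0" by (simp add: retr_diff)
    then have "p - retr n p \<in> J" using kern[OF J(2)] by blast
    then show ?thesis using ideal_diff[OF J(1) that, of "p - retr n p"] by simp
  qed
  obtain G where G: "finite G" "G \<subseteq> J" and gen: "\<forall>J'. is_ideal J' \<longrightarrow> (\<forall>p. retr n p = 0 \<longrightarrow> p \<in> J') \<longrightarrow> G \<subseteq> J' \<longrightarrow>
     (\<forall>p\<in>J. retr n p \<in> J \<longrightarrow> p \<in> J')"
    using ideal_finitely_generated_over_retr[OF J(1), of n] by (elim exE conjE) (rule that)
  have "J \<subseteq> J'" if J': "is_ideal J'" "I \<subseteq> J'" "G \<subseteq> J'" for J'
  proof
    fix p assume p: "p \<in> J"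
    show "p \<in> J'" by (rule gen[rule_format, OF J'(1) _ J'(3) p retr[OF p]]) (use kern[OF J'(2)] in blast)
  qed
  then show ?thesis using G by (intro exI[of _ G]) blast
qed

text \<open>The only maximal ideal is the extension of P. Both directions compare the number of its
  generators with \<open>codim n P - r\<close>, an upper bound for the Krull dimension.\<close>

lemma regular_local_iff_jacobian_criterion:
  assumes "localization_model L \<theta> I P"
  shows "regular_local_ring L \<longleftrightarrow> jacobian_criterion P"
proof -
  interpret L: localization_model L \<theta> I P by fact
  note P = L.prime_P L.I_sub_P and idP = is_prime_is_ideal[OF L.prime_P]
  note max = L.extension_P_maximal
  have noeth: "noetherian_ring L" by (rule L.noetherian_L) (rule ideal_finitely_generated)
  have rP: "r \<le> codim n P"
    by (rule codim_mono[OF I prime_over_superset[OF P] P(2)])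
  have krull_le: "krull_dim L \<le> enat (codim n P - r)"
    unfolding L.krull_dim_eq
  proof (rule Sup_least)
    fix e assume "e \<in> {enat k |k. \<exists>p. (\<forall>i\<le>k. is_prime (p i) \<and> I \<subseteq> p i \<and> p i \<subseteq> P) \<and> (\<forall>i<k. p i \<subset> p (Suc i))}"
    then obtain k p where p: "e = enat k" "\<And>i. i \<le> k \<Longrightarrow> is_prime (p i) \<and> I \<subseteq> p i \<and> p i \<subseteq> P"
      "\<And>i. i < k \<Longrightarrow> p i \<subset> p (Suc i)" by blast
    have "r + k \<le> codim n P" using chain_length_le[of k p P] p(2,3) P(1) by blast
    then show "e \<le> enat (codim n P - r)" by (simp add: p(1))
  qed
  show ?thesis
  proof
    assume "regular_local_ring L"
    then obtain M S where M: "maximalideal M L" "S \<subseteq> carrier L" "finite S" "M = Idl\<^bsub>L\<^esub> S" "enat (card S) = krull_dim L"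
      unfolding regular_local_ring_def by blast
    have ME: "M = L.extension P" by (rule max(2)[OF M(1)])
    define d where "d = card S"
    \<comment> \<open>Regularity identifies \<open>d\<close> with the Krull dimension, whose upper
      bound becomes the smallness condition on the number of generators.\<close>
    have "enat d \<le> enat (codim n P - r)" unfolding d_def M(5) by (rule krull_le)
    then have d: "r + d \<le> codim n P" using rP by simp
    obtain e where e: "bij_betw e {..<d} S"
      using ex_bij_betw_nat_finite[OF M(3)] by (auto simp: d_def atLeast0LessThan)
    have eS: "e j \<in> S" if "j < d" for j using e that by (auto simp: bij_betw_def)
    have "S \<subseteq> L.extension P" using L.genideal_self[OF M(2)] M(4) ME by simp
    then have "\<exists>a s. a \<in> P \<and> s \<notin> P \<and> \<theta> s \<otimes>\<^bsub>L\<^esub> e j = \<theta> a" if "j < d" for j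
      using eS[OF that] unfolding L.extension_def by blast
    then obtain a s where as: "\<And>j. j < d \<Longrightarrow> a j \<in> P" "\<And>j. j < d \<Longrightarrow> s j \<notin> P"
      "\<And>j. j < d \<Longrightarrow> \<theta> (s j) \<otimes>\<^bsub>L\<^esub> e j = \<theta> (a j)" by metis
    \<comment> \<open>The elements that, multiplied by something outside P, are combinations of the
      numerators \<open>a j\<close> modulo I. The extension of this ideal contains S and hence the
      maximal ideal.\<close>
    define J where "J = {x. \<exists>c b. c \<notin> P \<and> c * x - (\<Sum>j<d. b j * a j) \<in> I}"
    have J: "is_ideal J" unfolding is_ideal_def
    proof (intro conjI ballI allI)
      have "1 * 0 - (\<Sum>j<d. 0 * a j) \<in> I" using ideal_0[OF I_ideal] by simp
      then show "0 \<in> J" unfolding J_def using prime_1[OF P(1)] by (intro CollectI exI[of _ 1] exI[of _ "\<lambda>_. 0"]) simp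
    next
      fix x y assume "x \<in> J" "y \<in> J"
      then obtain c b c' b' where cb: "c \<notin> P" "c * x - (\<Sum>j<d. b j * a j) \<in> I"
        "c' \<notin> P" "c' * y - (\<Sum>j<d. b' j * a j) \<in> I" by (auto simp: J_def)
      have "c * c' * (x + y) - (\<Sum>j<d. (c' * b j + c * b' j) * a j)
          = c' * (c * x - (\<Sum>j<d. b j * a j)) + c * (c' * y - (\<Sum>j<d. b' j * a j))"
        by (simp add: algebra_simps sum.distrib sum_distrib_left)
      also have "\<dots> \<in> I" using cb by (intro ideal_add[OF I_ideal] ideal_mult[OF I_ideal])
      finally have "c * c' * (x + y) - (\<Sum>j<d. (c' * b j + c * b' j) * a j) \<in> I" .
      moreover have "c * c' \<notin> P" using cb by (simp add: prime_mult[OF P(1)])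
      ultimately show "x + y \<in> J" unfolding J_def by (intro CollectI exI[of _ "c * c'"] exI[of _ "\<lambda>j. c' * b j + c * b' j"]) simp
    next
      fix u x assume "x \<in> J"
      then obtain c b where cb: "c \<notin> P" "c * x - (\<Sum>j<d. b j * a j) \<in> I" by (auto simp: J_def)
      have "c * (u * x) - (\<Sum>j<d. (u * b j) * a j) = u * (c * x - (\<Sum>j<d. b j * a j))"
        by (simp add: algebra_simps sum_distrib_left)
      also have "\<dots> \<in> I" using cb by (intro ideal_mult[OF I_ideal])
      finally show "u * x \<in> J" unfolding J_def using cb(1) by (intro CollectI exI[of _ c] exI[of _ "\<lambda>j. u * b j"]) simp
    qed
    have aJ: "a j \<in> J" if j: "j < d" for j
    proof -
      have "(\<Sum>i<d. (if i = j then 1 else 0) * a i) = a j"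
        using j by (simp add: if_distrib[of "\<lambda>x. x * _"] sum.delta cong: if_cong)
      then have "1 * a j - (\<Sum>i<d. (if i = j then 1 else 0) * a i) \<in> I" using ideal_0[OF I_ideal] by simp
      then show ?thesis unfolding J_def using prime_1[OF P(1)]
        by (intro CollectI exI[of _ 1] exI[of _ "\<lambda>i. if i = j then 1 else 0"]) simp
    qed
    have "S \<subseteq> L.extension J"
    proof
      fix y assume y: "y \<in> S"
      then obtain j where j: "j < d" "y = e j" using e by (auto simp: bij_betw_def)
      then show "y \<in> L.extension J" using aJ as M(2) y unfolding L.extension_def by blast
    qed
    then have ext: "L.extension P \<subseteq> L.extension J"
      using L.genideal_minimal[OF L.extension_ideal[OF J]] M(4) ME by simp
    have sgen: "\<exists>c b. c \<notin> P \<and> c * p - (\<Sum>j<d. b j * a j) \<in> I" if p: "p \<in> P" for p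
    proof -
      have "\<theta> p \<in> L.extension J"
        using ext L.hom_in_extension[OF P order_refl] p by blast
      then obtain x t where x: "x \<in> J" "t \<notin> P" "\<theta> (t * p) = \<theta> x" by (auto simp: L.extension_def L.hom_mult)
      then have tp: "t * p - x \<in> I" by (simp add: L.hom_eq_iff)
      obtain c b where cb: "c \<notin> P" "c * x - (\<Sum>j<d. b j * a j) \<in> I" using x(1) by (auto simp: J_def)
      have "c * t * p - (\<Sum>j<d. b j * a j) = c * (t * p - x) + (c * x - (\<Sum>j<d. b j * a j))"
        by (simp add: algebra_simps)
      also have "\<dots> \<in> I" using tp cb by (intro ideal_add[OF I_ideal] ideal_mult[OF I_ideal])
      finally show ?thesis using cb(1) x(2) prime_mult[OF P(1), of c t] by blast
    qed
    show "jacobian_criterion P"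
      by (rule jacobian_criterion_of_few_generators[where s = a and d = d, OF P as(1) sgen d])
  next
    assume crit: "jacobian_criterion P"
    obtain h Q where h: "\<forall>i<codim n P. h i \<in> P"
      "\<forall>p\<in>P. \<exists>c b. c \<notin> P \<and> c * p - (\<Sum>i\<in>{r..<codim n P}. b i * h i) \<in> I"
      "\<forall>i\<in>{r..<codim n P}. \<forall>j\<in>{r..<codim n P}. i \<noteq> j \<longrightarrow> h i - h j \<notin> I"
      and Q: "\<forall>k\<in>{r..codim n P}. is_prime (Q k) \<and> I \<subseteq> Q k \<and> Q k \<subseteq> P"
      "\<forall>k\<in>{r..<codim n P}. Q k \<subset> Q (Suc k)"
      using regular_parameters_and_chain[OF P crit] by blast
    define S where "S = (\<lambda>i. \<theta> (h i)) ` {r..<codim n P}"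
    have "inj_on (\<lambda>i. \<theta> (h i)) {r..<codim n P}"
      using h(3) unfolding inj_on_def L.hom_eq_iff by blast
    then have cS: "card S = codim n P - r" by (simp add: S_def card_image)
    have Sc: "S \<subseteq> carrier L" by (auto simp: S_def L.hom_closed)
    note idS = L.genideal_ideal[OF Sc]
    interpret IS: ideal "Idl\<^bsub>L\<^esub> S" L by (rule idS)
    have "L.extension P = Idl\<^bsub>L\<^esub> S"
    proof
      have "S \<subseteq> L.extension P"
        using h(1) L.hom_in_extension[OF P order_refl] by (auto simp: S_def)
      then show "Idl\<^bsub>L\<^esub> S \<subseteq> L.extension P" by (rule L.genideal_minimal[OF L.extension_ideal[OF idP]])
      show "L.extension P \<subseteq> Idl\<^bsub>L\<^esub> S"
      proof (rule L.ideal_subset_of_vimage[OF L.extension_ideal[OF idP] idS])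
        fix x assume "\<theta> x \<in> L.extension P"
        then have "x \<in> P" using L.hom_in_extension[OF P order_refl] by simp
        then obtain c b where cb: "c \<notin> P" "c * x - (\<Sum>i\<in>{r..<codim n P}. b i * h i) \<in> I" using h(2) by blast
        then have "\<theta> c \<otimes>\<^bsub>L\<^esub> \<theta> x = \<theta> (\<Sum>i\<in>{r..<codim n P}. b i * h i)"
          by (simp flip: L.hom_mult add: L.hom_eq_iff)
        also have "\<dots> \<in> Idl\<^bsub>L\<^esub> S"
        proof -
          have "is_ideal {x. \<theta> x \<in> Idl\<^bsub>L\<^esub> S}" by (rule L.ideal_vimage(1)[OF idS])
          moreover have "h i \<in> {x. \<theta> x \<in> Idl\<^bsub>L\<^esub> S}" if "i \<in> {r..<codim n P}" for i
            using that L.genideal_self[OF Sc] by (auto simp: S_def)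
          ultimately have "(\<Sum>i\<in>{r..<codim n P}. b i * h i) \<in> {x. \<theta> x \<in> Idl\<^bsub>L\<^esub> S}"
            by (intro ideal_sum ideal_mult)
          then show ?thesis by simp
        qed
        finally show "\<theta> x \<in> Idl\<^bsub>L\<^esub> S" by (rule L.ideal_cancel[OF idS cb(1) L.hom_closed])
      qed
    qed
    \<comment> \<open>The chain of primes is numbered from r and is shifted to start at 0; its
      length attains the upper bound.\<close>
    moreover have "krull_dim L = enat (codim n P - r)"
    proof (rule antisym[OF krull_le])
      show "enat (codim n P - r) \<le> krull_dim L"
        unfolding L.krull_dim_eq
        by (intro Sup_upper CollectI exI[of _ "codim n P - r"] exI[of _ "\<lambda>i. Q (r + i)"] conjI refl allI impI)
          (use Q rP in auto)
    qed
    moreover have "finite S" by (simp add: S_def)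
    ultimately have "\<exists>S\<subseteq>carrier L. finite S \<and> L.extension P = Idl\<^bsub>L\<^esub> S \<and> enat (card S) = krull_dim L"
      using Sc cS by (intro exI[of _ S] conjI) simp_all
    then show "regular_local_ring L"
      unfolding regular_local_ring_def using L.is_cring noeth max by blast
  qed
qed

end

section \<open>Algebras generated by multiplications and derivations\<close>

text \<open>Stated for any set of derivations of a commutative ring, so that it can be instantiated
  with the empty set, to have the ring of endomorphisms at hand, and afterwards with the natural
  derivations.\<close>

locale diff_ops = cring A for A (structure) +
  fixes K :: "'a set" and \<D> :: "('a \<Rightarrow> 'a) set"
  assumes K_sub: "K \<subseteq> carrier A" and one_not_zero: "\<one> \<noteq> \<zero>"
    and derivations: "\<D> \<subseteq> Der K A"
begin

abbreviation E where "E \<equiv> End_alg K A"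
abbreviation \<mu> where "\<mu> \<equiv> mult_op A"

definition ops where "ops = generated_subalgebra K A (\<mu> ` carrier A \<union> \<D>)"

definition ops_ring where "ops_ring = E\<lparr>carrier := ops\<rparr>"

definition ops_module :: "('a \<Rightarrow> 'a, 'a) module" where
  "ops_module = \<lparr>carrier = carrier A, monoid.mult = monoid.mult A, one = one A,
          ring.zero = ring.zero A, add = add A, module.smult = (\<lambda>\<phi> a. \<phi> a)\<rparr>"

definition stable_ideal :: "'a set \<Rightarrow> bool" where
  "stable_ideal N \<longleftrightarrow> ideal N A \<and> (\<forall>\<delta>\<in>\<D>. \<forall>x\<in>N. \<delta> x \<in> N)"

lemma End_mem: "\<phi> \<in> carrier E \<longleftrightarrow> \<phi> \<in> carrier A \<rightarrow>\<^sub>E carrier A \<and>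
    (\<forall>a\<in>carrier A. \<forall>b\<in>carrier A. \<phi> (a \<oplus> b) = \<phi> a \<oplus> \<phi> b) \<and>
    (\<forall>c\<in>K. \<forall>a\<in>carrier A. \<phi> (c \<otimes> a) = c \<otimes> \<phi> a)"
  by (simp add: End_alg_def)

lemma End_closed: "\<phi> \<in> carrier E \<Longrightarrow> a \<in> carrier A \<Longrightarrow> \<phi> a \<in> carrier A"
  and End_add: "\<phi> \<in> carrier E \<Longrightarrow> a \<in> carrier A \<Longrightarrow> b \<in> carrier A \<Longrightarrow> \<phi> (a \<oplus> b) = \<phi> a \<oplus> \<phi> b"
  and End_scalar: "\<phi> \<in> carrier E \<Longrightarrow> c \<in> K \<Longrightarrow> a \<in> carrier A \<Longrightarrow> \<phi> (c \<otimes> a) = c \<otimes> \<phi> a"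
  and End_ext: "\<phi> \<in> carrier E \<Longrightarrow> \<phi> \<in> extensional (carrier A)"
  by (auto simp: End_mem PiE_def Pi_def)

lemma End_eqI:
  "\<phi> \<in> carrier E \<Longrightarrow> \<psi> \<in> carrier E \<Longrightarrow> (\<And>a. a \<in> carrier A \<Longrightarrow> \<phi> a = \<psi> a) \<Longrightarrow> \<phi> = \<psi>"
  by (rule extensionalityI[OF End_ext End_ext])

lemma End_mult_app: "a \<in> carrier A \<Longrightarrow> (\<phi> \<otimes>\<^bsub>E\<^esub> \<psi>) a = \<phi> (\<psi> a)"
  and End_add_app: "a \<in> carrier A \<Longrightarrow> (\<phi> \<oplus>\<^bsub>E\<^esub> \<psi>) a = \<phi> a \<oplus> \<psi> a"
  and End_zero_app: "a \<in> carrier A \<Longrightarrow> \<zero>\<^bsub>E\<^esub> a = \<zero>"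
  and End_one_app: "a \<in> carrier A \<Longrightarrow> \<one>\<^bsub>E\<^esub> a = a"
  by (simp_all add: End_alg_def compose_eq)

lemma K_carr: "c \<in> K \<Longrightarrow> c \<in> carrier A" using K_sub by auto

lemma End_add_closed: "\<phi> \<in> carrier E \<Longrightarrow> \<psi> \<in> carrier E \<Longrightarrow> \<phi> \<oplus>\<^bsub>E\<^esub> \<psi> \<in> carrier E"
proof -
  assume *: "\<phi> \<in> carrier E" "\<psi> \<in> carrier E"
  have "\<phi> \<oplus>\<^bsub>E\<^esub> \<psi> = (\<lambda>a\<in>carrier A. \<phi> a \<oplus> \<psi> a)" by (simp add: End_alg_def)
  moreover have "(\<phi> a \<oplus> \<phi> b) \<oplus> (\<psi> a \<oplus> \<psi> b) = (\<phi> a \<oplus> \<psi> a) \<oplus> (\<phi> b \<oplus> \<psi> b)"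
    if "a \<in> carrier A" "b \<in> carrier A" for a b
    using End_closed[OF *(1)] End_closed[OF *(2)] that by (simp add: a_ac)
  ultimately show ?thesis
    unfolding End_mem using * K_carr
    by (auto simp: End_closed End_add End_scalar r_distr)
qed

lemma End_mult_closed: "\<phi> \<in> carrier E \<Longrightarrow> \<psi> \<in> carrier E \<Longrightarrow> \<phi> \<otimes>\<^bsub>E\<^esub> \<psi> \<in> carrier E"
proof -
  assume *: "\<phi> \<in> carrier E" "\<psi> \<in> carrier E"
  have "\<phi> \<otimes>\<^bsub>E\<^esub> \<psi> = (\<lambda>a\<in>carrier A. \<phi> (\<psi> a))" by (simp add: End_alg_def compose_def)
  then show ?thesis
    unfolding End_mem using * K_carr by (auto simp: End_closed End_add End_scalar)
qed

lemma End_zero_closed: "\<zero>\<^bsub>E\<^esub> \<in> carrier E"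
  unfolding End_mem using K_carr by (auto simp: End_alg_def)

lemma End_one_closed: "\<one>\<^bsub>E\<^esub> \<in> carrier E"
  unfolding End_mem using K_carr by (auto simp: End_alg_def)

lemma mult_op_closed: "a \<in> carrier A \<Longrightarrow> \<mu> a \<in> carrier E"
  unfolding End_mem mult_op_def using K_carr by (auto simp: r_distr m_lcomm)

lemma mult_op_app: "b \<in> carrier A \<Longrightarrow> \<mu> a b = a \<otimes> b"
  by (simp add: mult_op_def)

lemma End_ring: "ring E"
proof (rule ringI)
  show "abelian_group E"
  proof (rule abelian_groupI)
    fix \<phi> assume p: "\<phi> \<in> carrier E"
    have m: "\<mu> (\<ominus> \<one>) \<otimes>\<^bsub>E\<^esub> \<phi> \<in> carrier E" by (rule End_mult_closed) (auto simp: mult_op_closed p)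
    moreover have "\<mu> (\<ominus> \<one>) \<otimes>\<^bsub>E\<^esub> \<phi> \<oplus>\<^bsub>E\<^esub> \<phi> = \<zero>\<^bsub>E\<^esub>"
      by (rule End_eqI) (use p m in \<open>auto simp: End_add_closed End_zero_closed End_add_app End_mult_app
          End_zero_app mult_op_app End_closed l_minus l_neg\<close>)
    ultimately show "\<exists>\<psi>\<in>carrier E. \<psi> \<oplus>\<^bsub>E\<^esub> \<phi> = \<zero>\<^bsub>E\<^esub>" by blast
  qed (auto intro!: End_eqI simp: End_add_closed End_zero_closed End_add_app End_zero_app End_closed a_ac)
  show "monoid E"
    by (rule monoidI) (auto intro!: End_eqI simp: End_mult_closed End_one_closed End_mult_app End_one_app End_closed)
qed (auto intro!: End_eqI simp: End_mult_closed End_add_closed End_mult_app End_add_app End_closed End_add)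

sublocale E: ring E by (rule End_ring)

lemma Der_E: "\<delta> \<in> \<D> \<Longrightarrow> \<delta> \<in> carrier E"
  and Der_mult: "\<delta> \<in> \<D> \<Longrightarrow> a \<in> carrier A \<Longrightarrow> b \<in> carrier A \<Longrightarrow> \<delta> (a \<otimes> b) = \<delta> a \<otimes> b \<oplus> a \<otimes> \<delta> b"
  using derivations by (auto simp: Der_def)

text \<open>A subring containing all multiplications is automatically closed under scalars, because
  the scalars lie in A.\<close>

lemma ops_induct_set:
  assumes "subring B E" "\<And>a. a \<in> carrier A \<Longrightarrow> \<mu> a \<in> B" "\<D> \<subseteq> B"
  shows "ops \<subseteq> B"
proof -
  have "\<mu> c \<otimes>\<^bsub>E\<^esub> \<phi> \<in> B" if "c \<in> K" "\<phi> \<in> B" for c \<phi>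
    using subringE(6)[OF assms(1) assms(2)[OF K_carr[OF that(1)]] that(2)] .
  then show ?thesis unfolding ops_def generated_subalgebra_def using assms by blast
qed

lemma mult_op_ops: "a \<in> carrier A \<Longrightarrow> \<mu> a \<in> ops" and Der_ops: "\<delta> \<in> \<D> \<Longrightarrow> \<delta> \<in> ops"
  unfolding ops_def generated_subalgebra_def by auto

lemma ops_subring: "subring ops E"
  unfolding ops_def generated_subalgebra_def
proof (rule E.subring_Inter)
  have "carrier E \<in> {B. subring B E \<and> (\<forall>c\<in>K. \<forall>\<phi>\<in>B. \<mu> c \<otimes>\<^bsub>E\<^esub> \<phi> \<in> B) \<and> \<mu> ` carrier A \<union> \<D> \<subseteq> B}"
    using E.carrier_is_subring Der_E mult_op_closed K_carr by auto
  then show "{B. subring B E \<and> (\<forall>c\<in>K. \<forall>\<phi>\<in>B. \<mu> c \<otimes>\<^bsub>E\<^esub> \<phi> \<in> B) \<and> \<mu> ` carrier A \<union> \<D> \<subseteq> B} \<noteq> {}" by blast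
qed auto

lemma ops_E: "\<phi> \<in> ops \<Longrightarrow> \<phi> \<in> carrier E"
  using subringE(1)[OF ops_subring] by blast

lemma ops_ring: "ring ops_ring"
  unfolding ops_ring_def by (rule E.subring_is_ring[OF ops_subring])

sublocale D: ring ops_ring by (rule ops_ring)

lemma ops_ring_simps:
  "carrier ops_ring = ops" "x \<otimes>\<^bsub>ops_ring\<^esub> y = x \<otimes>\<^bsub>E\<^esub> y" "x \<oplus>\<^bsub>ops_ring\<^esub> y = x \<oplus>\<^bsub>E\<^esub> y"
  "\<one>\<^bsub>ops_ring\<^esub> = \<one>\<^bsub>E\<^esub>" "\<zero>\<^bsub>ops_ring\<^esub> = \<zero>\<^bsub>E\<^esub>"
  by (simp_all add: ops_ring_def)

lemma stabilizer_subring: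
  assumes N: "ideal N A" shows "subring {\<phi> \<in> carrier E. \<forall>x\<in>N. \<phi> x \<in> N} E"
proof (rule E.subringI)
  interpret N: ideal N A by fact
  fix \<phi> assume p: "\<phi> \<in> {\<phi> \<in> carrier E. \<forall>x\<in>N. \<phi> x \<in> N}"
  have "(\<ominus>\<^bsub>E\<^esub> \<phi>) x = \<ominus> (\<phi> x)" if "x \<in> carrier A" for x
  proof -
    have "(\<ominus>\<^bsub>E\<^esub> \<phi> \<oplus>\<^bsub>E\<^esub> \<phi>) x = \<zero>" using p that by (simp add: E.l_neg End_zero_app)
    then show ?thesis using p that by (simp add: End_add_app End_closed minus_equality)
  qed
  then show "\<ominus>\<^bsub>E\<^esub> \<phi> \<in> {\<phi> \<in> carrier E. \<forall>x\<in>N. \<phi> x \<in> N}" using p N.Icarr by auto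
next
  interpret N: ideal N A by fact
  fix \<phi> \<psi> assume p: "\<phi> \<in> {\<phi> \<in> carrier E. \<forall>x\<in>N. \<phi> x \<in> N}" "\<psi> \<in> {\<phi> \<in> carrier E. \<forall>x\<in>N. \<phi> x \<in> N}"
  show "\<phi> \<otimes>\<^bsub>E\<^esub> \<psi> \<in> {\<phi> \<in> carrier E. \<forall>x\<in>N. \<phi> x \<in> N}" "\<phi> \<oplus>\<^bsub>E\<^esub> \<psi> \<in> {\<phi> \<in> carrier E. \<forall>x\<in>N. \<phi> x \<in> N}"
    using p N.Icarr by (auto simp: End_mult_app End_add_app)
next
  interpret N: ideal N A by fact
  show "\<one>\<^bsub>E\<^esub> \<in> {\<phi> \<in> carrier E. \<forall>x\<in>N. \<phi> x \<in> N}" using N.Icarr by (auto simp: End_one_app)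
qed auto

lemma ops_stable:
  assumes "stable_ideal N" "\<phi> \<in> ops" "x \<in> N" shows "\<phi> x \<in> N"
proof -
  interpret N: ideal N A using assms by (simp add: stable_ideal_def)
  have "ops \<subseteq> {\<phi> \<in> carrier E. \<forall>x\<in>N. \<phi> x \<in> N}"
  proof (rule ops_induct_set[OF stabilizer_subring[OF N.is_ideal]])
    show "\<mu> a \<in> {\<phi> \<in> carrier E. \<forall>x\<in>N. \<phi> x \<in> N}" if "a \<in> carrier A" for a
      using that N.Icarr N.I_l_closed by (auto simp: mult_op_closed mult_op_app)
    show "\<D> \<subseteq> {\<phi> \<in> carrier E. \<forall>x\<in>N. \<phi> x \<in> N}"
      using assms(1) Der_E by (auto simp: stable_ideal_def)
  qed
  then show ?thesis using assms by blast
qed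

lemma ops_module_simps:
  "carrier ops_module = carrier A" "x \<oplus>\<^bsub>ops_module\<^esub> y = x \<oplus> y" "\<zero>\<^bsub>ops_module\<^esub> = \<zero>"
  "\<phi> \<odot>\<^bsub>ops_module\<^esub> x = \<phi> x"
  by (simp_all add: ops_module_def)

lemma subgroup_ops_module: "subgroup N (add_monoid ops_module) \<longleftrightarrow> subgroup N (add_monoid A)"
  by (simp add: subgroup_def m_inv_def ops_module_def)

text \<open>Multiplications are among the operators, so submodules are ideals; conversely, the
  operators preserving an ideal form a subring, which contains the generators when the ideal is
  stable.\<close>

lemma submodule_iff_stable_ideal: "submodule N ops_ring ops_module \<longleftrightarrow> stable_ideal N"
proof
  assume N: "submodule N ops_ring ops_module"
  have sub: "subgroup N (add_monoid A)" using submodule.axioms(1)[OF N] by (simp add: subgroup_ops_module)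
  have Nc: "N \<subseteq> carrier A" using subgroup.subset[OF sub] by simp
  have app: "\<phi> x \<in> N" if "\<phi> \<in> ops" "x \<in> N" for \<phi> x
    using submodule.smult_closed[OF N, of \<phi> x] that by (simp add: ops_ring_simps ops_module_simps)
  have l: "x \<otimes> a \<in> N" if "a \<in> N" "x \<in> carrier A" for a x
    using app[OF mult_op_ops[OF that(2)] that(1)] that Nc by (auto simp: mult_op_app)
  have "ideal N A"
    by (rule idealI[OF ring_axioms sub]) (use l m_comm Nc in \<open>auto simp: subset_iff\<close>)
  then show "stable_ideal N" unfolding stable_ideal_def using app Der_ops by blast
next
  assume N: "stable_ideal N"
  interpret N: ideal N A using N by (simp add: stable_ideal_def)
  show "submodule N ops_ring ops_module"
  proof (intro submodule.intro submodule_axioms.intro)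
    show "subgroup N (add_monoid ops_module)" unfolding subgroup_ops_module by (rule N.a_subgroup)
    show "\<phi> \<odot>\<^bsub>ops_module\<^esub> x \<in> N" if "\<phi> \<in> carrier ops_ring" "x \<in> N" for \<phi> x
      using ops_stable[OF N] that by (simp add: ops_ring_simps ops_module_simps)
  qed
qed

lemma left_module_ops: "left_module ops_ring ops_module"
proof -
  have "abelian_group ops_module"
    by (rule abelian_groupI) (use l_neg in \<open>auto simp: ops_module_simps a_ac intro!: bexI[of _ "\<ominus> _"]\<close>)
  then show ?thesis
    by (intro left_module.intro left_module_axioms.intro ops_ring)
      (auto simp: ops_ring_simps ops_module_simps End_closed ops_E End_add_app End_add End_mult_app End_one_app)
qed

lemma simple_left_module_iff:
  "simple_left_module ops_ring ops_module \<longleftrightarrow> (\<forall>N. stable_ideal N \<longrightarrow> N = {\<zero>} \<or> N = carrier A)"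
  unfolding simple_left_module_def submodule_iff_stable_ideal ops_module_simps
  using left_module_ops one_not_zero by auto

text \<open>The operators that map A into N form a two-sided ideal. It contains the multiplications
  by elements of N, and it contains the identity only if N is everything.\<close>

lemma trivial_stable_ideals_of_simple:
  assumes "simple_ring ops_ring" and N: "stable_ideal N"
  shows "N = {\<zero>} \<or> N = carrier A"
proof -
  interpret N: ideal N A using N by (simp add: stable_ideal_def)
  define J where "J = {\<phi> \<in> ops. \<forall>x\<in>carrier A. \<phi> x \<in> N}"
  have "ideal J ops_ring"
  proof (rule idealI[OF ops_ring])
    have "\<ominus>\<^bsub>ops_ring\<^esub> \<phi> \<in> J" if "\<phi> \<in> J" for \<phi>
    proof -
      have p: "\<phi> \<in> carrier ops_ring" using that by (simp add: J_def ops_ring_simps)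
      have "(\<ominus>\<^bsub>ops_ring\<^esub> \<phi>) x = \<ominus> (\<phi> x)" if "x \<in> carrier A" for x
      proof -
        have "(\<ominus>\<^bsub>ops_ring\<^esub> \<phi> \<oplus>\<^bsub>E\<^esub> \<phi>) x = \<zero>"
          using D.l_neg[OF p] that by (simp add: ops_ring_simps End_zero_app)
        then show ?thesis using p that D.a_inv_closed[OF p]
          by (simp add: End_add_app End_closed ops_E ops_ring_simps minus_equality)
      qed
      then show ?thesis using that D.a_inv_closed[OF p] by (auto simp: J_def ops_ring_simps)
    qed
    moreover have "\<zero>\<^bsub>E\<^esub> \<in> J" using D.zero_closed by (auto simp: J_def ops_ring_simps End_zero_app)
    moreover have "\<phi> \<oplus>\<^bsub>E\<^esub> \<psi> \<in> J" if "\<phi> \<in> J" "\<psi> \<in> J" for \<phi> \<psi>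
      using that D.a_closed[of \<phi> \<psi>] by (auto simp: J_def ops_ring_simps End_add_app)
    ultimately show "subgroup J (add_monoid ops_ring)"
      by (intro D.add.subgroupI) (auto simp: ops_ring_simps J_def a_inv_def)
  next
    fix \<phi> \<psi> assume *: "\<phi> \<in> J" "\<psi> \<in> carrier ops_ring"
    then show "\<psi> \<otimes>\<^bsub>ops_ring\<^esub> \<phi> \<in> J" "\<phi> \<otimes>\<^bsub>ops_ring\<^esub> \<psi> \<in> J"
      using D.m_closed[of \<phi> \<psi>] D.m_closed[of \<psi> \<phi>] ops_stable[OF N] ops_E End_closed
      by (auto simp: J_def ops_ring_simps End_mult_app)
  qed
  then have "J = {\<zero>\<^bsub>E\<^esub>} \<or> J = ops" using assms(1) by (simp add: simple_ring_def ops_ring_simps)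
  then show ?thesis
  proof
    assume J: "J = {\<zero>\<^bsub>E\<^esub>}"
    have "a = \<zero>" if a: "a \<in> N" for a
    proof -
      have "\<mu> a \<in> J" using a N.Icarr N.I_r_closed by (auto simp: J_def mult_op_ops mult_op_app)
      then have "\<mu> a \<one> = \<zero>" using J End_zero_app by auto
      then show ?thesis using a N.Icarr by (simp add: mult_op_app)
    qed
    then show ?thesis using N.zero_closed by auto
  next
    assume J: "J = ops"
    have "\<one>\<^bsub>E\<^esub> \<in> ops" using D.one_closed by (simp add: ops_ring_simps)
    then have "\<one>\<^bsub>E\<^esub> \<one> \<in> N" using J J_def by auto
    then show ?thesis using N.one_imp_carrier by (simp add: End_one_app)
  qed
qed

section \<open>Commutators with multiplications and the order of an operator\<close>

definition comm where "comm \<phi> a = \<phi> \<otimes>\<^bsub>E\<^esub> \<mu> a \<ominus>\<^bsub>E\<^esub> \<mu> a \<otimes>\<^bsub>E\<^esub> \<phi>"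

text \<open>Differential operators of order less than \<open>k\<close>, in Grothendieck's sense.\<close>

fun order_less :: "nat \<Rightarrow> ('a \<Rightarrow> 'a) set" where
  "order_less 0 = {\<zero>\<^bsub>E\<^esub>}"
| "order_less (Suc k) = {\<phi> \<in> carrier E. \<forall>a\<in>carrier A. comm \<phi> a \<in> order_less k}"

lemma order_less_E: "\<phi> \<in> order_less k \<Longrightarrow> \<phi> \<in> carrier E"
  by (cases k) auto

lemma comm_zero: "a \<in> carrier A \<Longrightarrow> comm \<zero>\<^bsub>E\<^esub> a = \<zero>\<^bsub>E\<^esub>"
  by (simp add: comm_def mult_op_closed E.minus_eq)

lemma order_less_zero: "\<zero>\<^bsub>E\<^esub> \<in> order_less k"
  by (induction k) (auto simp: comm_zero)

lemma order_less_Suc: "order_less k \<subseteq> order_less (Suc k)"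
proof (induction k)
  case 0
  then show ?case by (auto simp: comm_zero)
next
  case (Suc k)
  show ?case
  proof
    fix \<phi> assume p: "\<phi> \<in> order_less (Suc k)"
    then show "\<phi> \<in> order_less (Suc (Suc k))" using Suc by (auto simp del: order_less.simps(2) simp: order_less.simps(2)[of "Suc k"] order_less.simps(2)[of k, THEN eqset_imp_iff])
  qed
qed

lemma order_less_mono: "j \<le> k \<Longrightarrow> order_less j \<subseteq> order_less k"
  using order_less_Suc by (rule lift_Suc_mono_le)

lemma comm_add:
  assumes "\<phi> \<in> carrier E" "\<psi> \<in> carrier E" "a \<in> carrier A"
  shows "comm (\<phi> \<oplus>\<^bsub>E\<^esub> \<psi>) a = comm \<phi> a \<oplus>\<^bsub>E\<^esub> comm \<psi> a"
  using assms mult_op_closed[OF assms(3)] unfolding comm_def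
  by (simp add: E.minus_eq E.l_distr E.r_distr E.minus_add E.a_ac)

lemma comm_uminus:
  assumes "\<phi> \<in> carrier E" "a \<in> carrier A"
  shows "comm (\<ominus>\<^bsub>E\<^esub> \<phi>) a = \<ominus>\<^bsub>E\<^esub> comm \<phi> a"
  using assms mult_op_closed[OF assms(2)] unfolding comm_def
  by (simp add: E.minus_eq E.l_minus E.r_minus E.minus_add)

lemma comm_mult:
  assumes "\<phi> \<in> carrier E" "\<psi> \<in> carrier E" "a \<in> carrier A"
  shows "comm (\<phi> \<otimes>\<^bsub>E\<^esub> \<psi>) a = \<phi> \<otimes>\<^bsub>E\<^esub> comm \<psi> a \<oplus>\<^bsub>E\<^esub> comm \<phi> a \<otimes>\<^bsub>E\<^esub> \<psi>"
proof -
  note m = mult_op_closed[OF assms(3)]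
  have "\<phi> \<otimes>\<^bsub>E\<^esub> comm \<psi> a \<oplus>\<^bsub>E\<^esub> comm \<phi> a \<otimes>\<^bsub>E\<^esub> \<psi> =
    (\<phi> \<otimes>\<^bsub>E\<^esub> \<psi> \<otimes>\<^bsub>E\<^esub> \<mu> a \<oplus>\<^bsub>E\<^esub> \<ominus>\<^bsub>E\<^esub> (\<phi> \<otimes>\<^bsub>E\<^esub> \<mu> a \<otimes>\<^bsub>E\<^esub> \<psi>)) \<oplus>\<^bsub>E\<^esub>
    (\<phi> \<otimes>\<^bsub>E\<^esub> \<mu> a \<otimes>\<^bsub>E\<^esub> \<psi> \<oplus>\<^bsub>E\<^esub> \<ominus>\<^bsub>E\<^esub> (\<mu> a \<otimes>\<^bsub>E\<^esub> \<phi> \<otimes>\<^bsub>E\<^esub> \<psi>))"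
    unfolding comm_def using assms(1,2) m
    by (simp add: E.minus_eq E.l_distr E.r_distr E.l_minus E.r_minus E.m_assoc)
  also have "\<dots> = \<phi> \<otimes>\<^bsub>E\<^esub> \<psi> \<otimes>\<^bsub>E\<^esub> \<mu> a \<oplus>\<^bsub>E\<^esub> (\<ominus>\<^bsub>E\<^esub> (\<phi> \<otimes>\<^bsub>E\<^esub> \<mu> a \<otimes>\<^bsub>E\<^esub> \<psi>) \<oplus>\<^bsub>E\<^esub>
    \<phi> \<otimes>\<^bsub>E\<^esub> \<mu> a \<otimes>\<^bsub>E\<^esub> \<psi>) \<oplus>\<^bsub>E\<^esub> \<ominus>\<^bsub>E\<^esub> (\<mu> a \<otimes>\<^bsub>E\<^esub> \<phi> \<otimes>\<^bsub>E\<^esub> \<psi>)"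
    using assms(1,2) m by (simp add: E.a_assoc)
  also have "\<dots> = comm (\<phi> \<otimes>\<^bsub>E\<^esub> \<psi>) a"
    unfolding comm_def using assms(1,2) m by (simp add: E.l_neg E.minus_eq E.m_assoc)
  finally show ?thesis ..
qed

lemma order_less_add: "\<phi> \<in> order_less k \<Longrightarrow> \<psi> \<in> order_less k \<Longrightarrow> \<phi> \<oplus>\<^bsub>E\<^esub> \<psi> \<in> order_less k"
  by (induction k arbitrary: \<phi> \<psi>) (auto simp: comm_add)

lemma order_less_uminus: "\<phi> \<in> order_less k \<Longrightarrow> \<ominus>\<^bsub>E\<^esub> \<phi> \<in> order_less k"
  by (induction k arbitrary: \<phi>) (auto simp: comm_uminus)

text \<open>Commutation with a multiplication obeys the Leibniz rule, so an induction on the sum of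
  the two orders applies. The purpose is that orders stay finite under composition.\<close>

lemma order_less_mult: "\<phi> \<in> order_less j \<Longrightarrow> \<psi> \<in> order_less k \<Longrightarrow> \<phi> \<otimes>\<^bsub>E\<^esub> \<psi> \<in> order_less (j + k)"
proof (induction "j + k" arbitrary: j k \<phi> \<psi>)
  case 0
  then show ?case by simp
next
  case (Suc l)
  note c = order_less_E[OF Suc.prems(1)] order_less_E[OF Suc.prems(2)]
  show ?case
  proof (cases "j = 0 \<or> k = 0")
    case True
    then have "\<phi> \<otimes>\<^bsub>E\<^esub> \<psi> = \<zero>\<^bsub>E\<^esub>" using Suc.prems c by auto
    then show ?thesis using order_less_zero by simp
  next
    case False
    then obtain j' k' where jk: "j = Suc j'" "k = Suc k'" by (metis not0_implies_Suc)
    have "comm (\<phi> \<otimes>\<^bsub>E\<^esub> \<psi>) a \<in> order_less l" if a: "a \<in> carrier A" for a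
    proof -
      have "\<phi> \<otimes>\<^bsub>E\<^esub> comm \<psi> a \<in> order_less (j + k')"
        using Suc.prems a Suc.hyps(2) by (intro Suc.hyps(1)) (auto simp: jk)
      moreover have "comm \<phi> a \<otimes>\<^bsub>E\<^esub> \<psi> \<in> order_less (j' + k)"
        using Suc.prems a Suc.hyps(2) by (intro Suc.hyps(1)) (auto simp: jk)
      moreover have "j + k' = l" "j' + k = l" using Suc.hyps(2) jk by auto
      ultimately show ?thesis unfolding comm_mult[OF c a] using order_less_add by simp
    qed
    then show ?thesis using c by (simp flip: Suc.hyps(2))
  qed
qed

lemma order_less_subring: "subring (\<Union>k. order_less k) E"
proof (rule E.subringI)
  show "(\<Union>k. order_less k) \<subseteq> carrier E" using order_less_E by blast
  have "comm \<one>\<^bsub>E\<^esub> a = \<zero>\<^bsub>E\<^esub>" if "a \<in> carrier A" for a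
    using that mult_op_closed by (simp add: comm_def E.minus_eq E.r_neg)
  then have "\<one>\<^bsub>E\<^esub> \<in> order_less 1" by simp
  then show "\<one>\<^bsub>E\<^esub> \<in> (\<Union>k. order_less k)" by blast
  show "\<ominus>\<^bsub>E\<^esub> h \<in> (\<Union>k. order_less k)" if "h \<in> (\<Union>k. order_less k)" for h
    using that order_less_uminus by blast
  fix g h assume "g \<in> (\<Union>k. order_less k)" "h \<in> (\<Union>k. order_less k)"
  then obtain j k where gh: "g \<in> order_less j" "h \<in> order_less k" by blast
  show "g \<otimes>\<^bsub>E\<^esub> h \<in> (\<Union>k. order_less k)" using order_less_mult[OF gh] by blast
  have "g \<in> order_less (max j k)" "h \<in> order_less (max j k)"
    using gh order_less_mono[of j "max j k"] order_less_mono[of k "max j k"] by auto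
  then show "g \<oplus>\<^bsub>E\<^esub> h \<in> (\<Union>k. order_less k)" using order_less_add by blast
qed

lemma mult_op_commute: "a \<in> carrier A \<Longrightarrow> b \<in> carrier A \<Longrightarrow> \<mu> a \<otimes>\<^bsub>E\<^esub> \<mu> b = \<mu> b \<otimes>\<^bsub>E\<^esub> \<mu> a"
  by (rule End_eqI) (auto simp: mult_op_closed End_mult_closed End_mult_app mult_op_app m_lcomm)

lemma comm_Der:
  assumes d: "\<delta> \<in> \<D>" and a: "a \<in> carrier A"
  shows "comm \<delta> a = \<mu> (\<delta> a)"
proof -
  have da: "\<delta> a \<in> carrier A" using End_closed[OF Der_E[OF d] a] .
  have "\<delta> \<otimes>\<^bsub>E\<^esub> \<mu> a = \<mu> (\<delta> a) \<oplus>\<^bsub>E\<^esub> \<mu> a \<otimes>\<^bsub>E\<^esub> \<delta>"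
    by (rule End_eqI) (use d a da Der_E[OF d] in \<open>auto simp: mult_op_closed End_mult_closed End_add_closed End_mult_app
        End_add_app mult_op_app End_closed Der_mult\<close>)
  then have "comm \<delta> a = \<mu> (\<delta> a) \<oplus>\<^bsub>E\<^esub> (\<mu> a \<otimes>\<^bsub>E\<^esub> \<delta> \<oplus>\<^bsub>E\<^esub> \<ominus>\<^bsub>E\<^esub> (\<mu> a \<otimes>\<^bsub>E\<^esub> \<delta>))"
    using a da Der_E[OF d] by (simp add: comm_def E.minus_eq mult_op_closed E.a_assoc)
  also have "\<dots> = \<mu> (\<delta> a)" using a da Der_E[OF d] by (simp add: mult_op_closed E.r_neg)
  finally show ?thesis .
qed

text \<open>Multiplications commute with one another and so have order below 1; the commutator of a
  derivation with a multiplication is a multiplication, so derivations have order below 2.\<close>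

lemma ops_finite_order: "ops \<subseteq> (\<Union>k. order_less k)"
proof (rule ops_induct_set[OF order_less_subring])
  have mu: "\<mu> a \<in> order_less 1" if "a \<in> carrier A" for a
  proof -
    have "comm (\<mu> a) b = \<zero>\<^bsub>E\<^esub>" if "b \<in> carrier A" for b
      using \<open>a \<in> carrier A\<close> that mult_op_commute[of a b]
      by (simp add: comm_def E.minus_eq mult_op_closed E.r_neg)
    then show ?thesis using that mult_op_closed by simp
  qed
  then show "\<mu> a \<in> (\<Union>k. order_less k)" if "a \<in> carrier A" for a using that by blast
  show "\<D> \<subseteq> (\<Union>k. order_less k)"
  proof
    fix \<delta> assume d: "\<delta> \<in> \<D>"
    have "comm \<delta> a \<in> order_less 1" if "a \<in> carrier A" for a
      unfolding comm_Der[OF d that] by (rule mu[OF End_closed[OF Der_E[OF d] that]])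
    then have "\<delta> \<in> order_less (Suc 1)" using Der_E[OF d] unfolding order_less.simps(2)[of 1] by blast
    then show "\<delta> \<in> (\<Union>k. order_less k)" by blast
  qed
qed

text \<open>Commutators with multiplications lower the order, so a nonzero ideal contains a nonzero
  multiplication operator.\<close>

lemma simple_of_trivial_stable_ideals:
  assumes triv: "\<And>N. stable_ideal N \<Longrightarrow> N = {\<zero>} \<or> N = carrier A"
  shows "simple_ring ops_ring"
  unfolding simple_ring_def
proof (intro conjI allI impI ops_ring)
  have "\<one>\<^bsub>E\<^esub> \<noteq> \<zero>\<^bsub>E\<^esub>" using End_one_app[of \<one>] End_zero_app[of \<one>] one_not_zero by auto
  then show "carrier ops_ring \<noteq> {\<zero>\<^bsub>ops_ring\<^esub>}" using D.one_closed by (auto simp: ops_ring_simps)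
  fix J assume "ideal J ops_ring"
  then interpret J: ideal J ops_ring .
  have JE: "\<phi> \<in> carrier E" "\<phi> \<in> ops" if "\<phi> \<in> J" for \<phi> using J.Icarr[OF that] ops_E by (auto simp: ops_ring_simps)
  have Jl: "\<psi> \<otimes>\<^bsub>E\<^esub> \<phi> \<in> J" and Jr: "\<phi> \<otimes>\<^bsub>E\<^esub> \<psi> \<in> J" if "\<phi> \<in> J" "\<psi> \<in> ops" for \<phi> \<psi>
    using J.I_l_closed[of \<phi> \<psi>] J.I_r_closed[of \<phi> \<psi>] that by (auto simp: ops_ring_simps)
  have Ja: "\<phi> \<oplus>\<^bsub>E\<^esub> \<psi> \<in> J" if "\<phi> \<in> J" "\<psi> \<in> J" for \<phi> \<psi>
    using J.a_closed[of \<phi> \<psi>] that by (auto simp: ops_ring_simps)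
  have Jm: "\<ominus>\<^bsub>E\<^esub> \<phi> \<in> J" if "\<phi> \<in> J" for \<phi>
  proof -
    have "\<ominus>\<^bsub>E\<^esub> \<one>\<^bsub>E\<^esub> \<in> ops" using subringE(3,5)[OF ops_subring] by blast
    from Jl[OF that this] show ?thesis using JE(1)[OF that] by (simp add: E.l_minus)
  qed
  have Jc: "comm \<phi> a \<in> J" if "\<phi> \<in> J" "a \<in> carrier A" for \<phi> a
    unfolding comm_def E.minus_eq using that by (intro Ja Jm Jl Jr mult_op_ops)
  show "J = {\<zero>\<^bsub>ops_ring\<^esub>} \<or> J = carrier ops_ring"
  proof (cases "J = {\<zero>\<^bsub>E\<^esub>}")
    case False
    have "\<zero>\<^bsub>E\<^esub> \<in> J" using J.zero_closed by (simp add: ops_ring_simps)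
    then obtain \<phi>0 where "\<phi>0 \<in> J" "\<phi>0 \<noteq> \<zero>\<^bsub>E\<^esub>" using False by blast
    moreover from this have "\<exists>k. \<phi>0 \<in> order_less k" using JE ops_finite_order by blast
    ultimately have ex: "\<exists>k \<phi>. \<phi> \<in> J \<and> \<phi> \<noteq> \<zero>\<^bsub>E\<^esub> \<and> \<phi> \<in> order_less k" by blast
    define k where "k = (LEAST k. \<exists>\<phi>. \<phi> \<in> J \<and> \<phi> \<noteq> \<zero>\<^bsub>E\<^esub> \<and> \<phi> \<in> order_less k)"
    obtain \<phi> where p: "\<phi> \<in> J" "\<phi> \<noteq> \<zero>\<^bsub>E\<^esub>" "\<phi> \<in> order_less k"
      using LeastI_ex[OF ex] unfolding k_def by blast
    have least: "\<psi> = \<zero>\<^bsub>E\<^esub>" if "\<psi> \<in> J" "\<psi> \<in> order_less j" "j < k" for \<psi> j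
      using not_less_Least[of j "\<lambda>k. \<exists>\<phi>. \<phi> \<in> J \<and> \<phi> \<noteq> \<zero>\<^bsub>E\<^esub> \<and> \<phi> \<in> order_less k"] that unfolding k_def by blast
    have "k \<noteq> 0" using p by (metis order_less.simps(1) singletonD)
    then obtain k' where k: "k = Suc k'" by (metis not0_implies_Suc)
    \<comment> \<open>The commutators lie in J and have smaller order, so minimality makes them
      vanish. An operator commuting with all multiplications is A-linear, hence multiplication by
      its value at 1.\<close>
    have "comm \<phi> a = \<zero>\<^bsub>E\<^esub>" if "a \<in> carrier A" for a
      using least[OF Jc[OF p(1) that], of k'] p(3) that by (simp add: k)
    then have com: "\<phi> \<otimes>\<^bsub>E\<^esub> \<mu> a = \<mu> a \<otimes>\<^bsub>E\<^esub> \<phi>" if "a \<in> carrier A" for a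
      using that JE(1)[OF p(1)] by (simp add: comm_def mult_op_closed E.r_right_minus_eq)
    have p1: "\<phi> \<one> \<in> carrier A" using End_closed[OF JE(1)[OF p(1)]] by simp
    have phi: "\<phi> = \<mu> (\<phi> \<one>)"
    proof (rule End_eqI[OF JE(1)[OF p(1)] mult_op_closed[OF p1]])
      fix a assume a: "a \<in> carrier A"
      have "\<phi> a = (\<phi> \<otimes>\<^bsub>E\<^esub> \<mu> a) \<one>" using a by (simp add: End_mult_app mult_op_app)
      also have "\<dots> = a \<otimes> \<phi> \<one>" using a p1 by (simp add: com End_mult_app mult_op_app)
      finally show "\<phi> a = \<mu> (\<phi> \<one>) a" using a p1 by (simp add: mult_op_app m_comm)
    qed
    \<comment> \<open>The elements whose multiplications lie in J. The commutator of \<delta> with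
      multiplication by \<open>a\<close> is multiplication by \<open>\<delta> a\<close>, which makes
      N stable.\<close>
    define N where "N = {b \<in> carrier A. \<mu> b \<in> J}"
    have mu_add: "\<mu> (a \<oplus> b) = \<mu> a \<oplus>\<^bsub>E\<^esub> \<mu> b" if "a \<in> carrier A" "b \<in> carrier A" for a b
      by (rule End_eqI) (use that in \<open>auto simp: mult_op_closed End_add_closed End_add_app mult_op_app l_distr\<close>)
    have mu_mult: "\<mu> (a \<otimes> b) = \<mu> a \<otimes>\<^bsub>E\<^esub> \<mu> b" if "a \<in> carrier A" "b \<in> carrier A" for a b
      by (rule End_eqI) (use that in \<open>auto simp: mult_op_closed End_mult_closed End_mult_app mult_op_app m_assoc\<close>)
    have mu_zero: "\<mu> \<zero> = \<zero>\<^bsub>E\<^esub>"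
      by (rule End_eqI) (auto simp: mult_op_closed End_zero_closed End_zero_app mult_op_app)
    have mu_one: "\<mu> \<one> = \<one>\<^bsub>E\<^esub>"
      by (rule End_eqI) (auto simp: mult_op_closed End_one_closed End_one_app mult_op_app)
    have Nl: "x \<otimes> a \<in> N" if "a \<in> N" "x \<in> carrier A" for a x
      using that Jl[OF _ mult_op_ops] by (auto simp: N_def mu_mult)
    have "ideal N A"
    proof (rule idealI[OF ring_axioms])
      show "subgroup N (add_monoid A)"
      proof (rule add.subgroupI)
        show "N \<subseteq> carrier A" by (auto simp: N_def)
        show "N \<noteq> {}" using \<open>\<zero>\<^bsub>E\<^esub> \<in> J\<close> by (auto simp: N_def mu_zero[symmetric])
        show "\<ominus> a \<in> N" if "a \<in> N" for a
          using Nl[OF that, of "\<ominus> \<one>"] that by (simp add: N_def l_minus)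
        show "a \<oplus> b \<in> N" if "a \<in> N" "b \<in> N" for a b
          using that Ja by (auto simp: N_def mu_add)
      qed
      show "x \<otimes> a \<in> N" if "a \<in> N" "x \<in> carrier A" for a x using Nl[OF that] .
      show "a \<otimes> x \<in> N" if "a \<in> N" "x \<in> carrier A" for a x
        using Nl[OF that] that by (simp add: N_def m_comm)
    qed
    moreover have "\<delta> a \<in> N" if "\<delta> \<in> \<D>" "a \<in> N" for \<delta> a
    proof -
      have a: "a \<in> carrier A" "\<mu> a \<in> J" using that by (auto simp: N_def)
      have "comm \<delta> a \<in> J"
        unfolding comm_def E.minus_eq using a(2) Der_ops[OF that(1)] by (intro Ja Jm Jl Jr)
      then show ?thesis using comm_Der[OF that(1) a(1)] End_closed[OF Der_E[OF that(1)] a(1)] by (simp add: N_def)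
    qed
    ultimately have "stable_ideal N" by (simp add: stable_ideal_def)
    then have "N = {\<zero>} \<or> N = carrier A" by (rule triv)
    moreover have "\<phi> \<one> \<in> N" using p1 p(1) phi by (simp add: N_def)
    moreover have "\<phi> \<one> \<noteq> \<zero>" using p(2) phi mu_zero by auto
    ultimately have "\<one> \<in> N" by auto
    then have "\<one>\<^bsub>E\<^esub> \<in> J" by (simp add: N_def mu_one)
    then show ?thesis using J.one_imp_carrier by (simp add: ops_ring_simps)
  qed (simp add: ops_ring_simps)
qed

lemma simple_ring_iff:
  "simple_ring ops_ring \<longleftrightarrow> (\<forall>N. stable_ideal N \<longrightarrow> N = {\<zero>} \<or> N = carrier A)"
  using trivial_stable_ideals_of_simple simple_of_trivial_stable_ideals by blast

end

section \<open>The coordinate ring\<close>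

lemma finite_inc_tuples: "finite (inc_tuples k l)"
proof (rule finite_subset)
  show "inc_tuples k l \<subseteq> {xs. set xs \<subseteq> {..<l} \<and> length xs = k}" by (auto simp: inc_tuples_def tuples_def)
qed (rule finite_lists_length_eq, simp)

lemma (in type_hom) hom_add_pow_sign:
  assumes "s = 1 \<or> s = (-1 :: int)"
  shows "\<theta> (of_int s * x) = add_pow L s (\<theta> x)"
proof -
  have "add_pow L (1::int) (\<theta> x) = \<theta> x" 
    using add.nat_pow_eone[OF hom_closed, of x] by (simp add: add_pow_int_ge)
  moreover have "add_pow L (-1::int) (\<theta> x) = \<ominus> \<theta> x"
    using add.nat_pow_eone[OF hom_closed, of x] by (simp add: add_pow_int_lt)
  ultimately show ?thesis using assms by (auto simp: hom_uminus)
qed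

text \<open>Connects the determinants of matrices with \<open>ring_det\<close>: both are the Leibniz
  sum over permutations, and \<open>add_pow\<close> with a sign as exponent is the multiple by 1 or
  -1.\<close>

lemma (in type_hom) hom_minor:
  assumes "length js = k"
  shows "\<theta> (minor v k js) = ring_det L k (\<lambda>\<nu> \<mu>. \<theta> (v \<nu> (js ! \<mu>)))"
proof -
  have fin: "finite {\<sigma>. \<sigma> permutes {..<k}}" by (simp add: finite_permutations)
  have "minor v k js = (\<Sum>\<sigma> | \<sigma> permutes {..<k}. of_int (sign \<sigma>) * (\<Prod>i<k. v i (js ! \<sigma> i)))"
    unfolding minor_def det_def'[of _ k, OF mat_carrier] lessThan_atLeast0
  proof (intro sum.cong refl arg_cong2[of _ _ _ _ "(*)"] prod.cong)
    fix \<sigma> i assume "\<sigma> \<in> {\<sigma>. \<sigma> permutes {0..<k}}" "i \<in> {0..<k}"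
    then have "i < k" "\<sigma> i < k" using permutes_in_image[of \<sigma> "{0..<k}" i] by auto
    then show "mat k k (\<lambda>(i, j). v i (js ! j)) $$ (i, \<sigma> i) = v i (js ! \<sigma> i)" by simp
  qed
  then have "\<theta> (minor v k js) = (\<Oplus>\<sigma>\<in>{\<sigma>. \<sigma> permutes {..<k}}. \<theta> (of_int (sign \<sigma>) * (\<Prod>i<k. v i (js ! \<sigma> i))))"
    using hom_sum[OF fin] by simp
  also have "\<dots> = (\<Oplus>\<sigma>\<in>{\<sigma>. \<sigma> permutes {..<k}}. add_pow L (sign \<sigma>) (\<Otimes>i\<in>{..<k}. \<theta> (v i (js ! \<sigma> i))))"
  proof -
    have "\<theta> (of_int (sign \<sigma>) * (\<Prod>i<k. v i (js ! \<sigma> i))) = add_pow L (sign \<sigma>) (\<Otimes>i\<in>{..<k}. \<theta> (v i (js ! \<sigma> i)))" for \<sigma> :: "nat \<Rightarrow> nat"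
      by (subst hom_add_pow_sign) (simp_all add: sign_def hom_prod)
    then show ?thesis by simp
  qed
  finally show ?thesis by (simp add: ring_det_def)
qed

lemma (in type_hom) noetherian_of_surj:
  assumes surj: "\<And>y. y \<in> carrier L \<Longrightarrow> \<exists>x. \<theta> x = y"
    and fg: "\<And>J. is_ideal J \<Longrightarrow> I \<subseteq> J \<Longrightarrow>
     \<exists>G. finite G \<and> G \<subseteq> J \<and> (\<forall>J'. is_ideal J' \<longrightarrow> I \<subseteq> J' \<longrightarrow> G \<subseteq> J' \<longrightarrow> J \<subseteq> J')"
  shows "noetherian_ring L"
proof (intro noetherian_ring.intro noetherian_ring_axioms.intro ring_axioms)
  fix K assume K: "ideal K L"
  interpret K: ideal K L by fact
  obtain G where G: "finite G" "G \<subseteq> {x. \<theta> x \<in> K}"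
    "\<And>J'. is_ideal J' \<Longrightarrow> I \<subseteq> J' \<Longrightarrow> G \<subseteq> J' \<Longrightarrow> {x. \<theta> x \<in> K} \<subseteq> J'"
    using fg[OF ideal_vimage[OF K]] by blast
  have c: "\<theta> ` G \<subseteq> carrier L" using hom_closed by auto
  note id = genideal_ideal[OF c]
  have "G \<subseteq> {x. \<theta> x \<in> Idl (\<theta> ` G)}" using genideal_self[OF c] by auto
  then have "{x. \<theta> x \<in> K} \<subseteq> {x. \<theta> x \<in> Idl (\<theta> ` G)}" by (rule G(3)[OF ideal_vimage[OF id]])
  then have "K \<subseteq> Idl (\<theta> ` G)" 
    using surj K.Icarr by blast
  moreover have "Idl (\<theta> ` G) \<subseteq> K" using G(2) by (intro genideal_minimal[OF K]) auto
  ultimately show "\<exists>A\<subseteq>carrier L. finite A \<and> K = Idl A" using c G(1) by (intro exI[of _ "\<theta> ` G"]) auto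
qed

locale affine_domain =
  fixes n m :: nat and f :: "nat \<Rightarrow> 'k::field_char_0 mpoly"
  assumes f_carrier: "\<forall>i<m. f i \<in> carrier (mpoly_ring n)"
    and prime: "primeideal (rel_ideal n m f) (mpoly_ring n)"
begin

abbreviation R where "R \<equiv> mpoly_ring n :: 'k mpoly ring"
abbreviation A where "A \<equiv> coord_ring n m f"
abbreviation K where "K \<equiv> scalars n m f"

text \<open>Composing with \<open>retr\<close> extends the projection to all polynomials, whatever
  variables they contain.\<close>

definition \<pi> :: "'k mpoly \<Rightarrow> 'k mpoly set" where "\<pi> p = image_in_A n m f (retr n p)"

definition I :: "'k mpoly set" where "I = {p. retr n p \<in> rel_ideal n m f}"

lemma R_simps: "carrier R = polys_in {..<n}" "x \<otimes>\<^bsub>R\<^esub> y = x * y" "x \<oplus>\<^bsub>R\<^esub> y = x + y" "\<one>\<^bsub>R\<^esub> = 1" "\<zero>\<^bsub>R\<^esub> = 0"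
  by (simp_all add: carrier_mpoly_ring) (simp_all add: mpoly_ring_def)

sublocale Ip: primeideal "rel_ideal n m f" R by (rule prime)

sublocale A: domain A unfolding coord_ring_def by (rule Ip.quotient_is_domain)

lemma \<pi>_hom: "type_hom A \<pi> I"
proof (intro type_hom.intro type_hom_axioms.intro A.is_cring)
  have h: "(+>\<^bsub>R\<^esub>) (rel_ideal n m f) \<in> Ring.ring_hom R A"
    unfolding coord_ring_def by (rule Ip.rcos_ring_hom)
  have pi: "\<pi> p = rel_ideal n m f +>\<^bsub>R\<^esub> retr n p" for p by (simp add: \<pi>_def image_in_A_def)
  have rc: "retr n p \<in> carrier R" for p by (simp add: R_simps retr_in)
  show "\<pi> x \<in> carrier A" for x unfolding pi using ring_hom_closed[OF h rc] .
  show "\<pi> (x + y) = \<pi> x \<oplus>\<^bsub>A\<^esub> \<pi> y" for x y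
    unfolding pi retr_add using ring_hom_add[OF h rc rc, of x y] by (simp add: R_simps)
  show "\<pi> (x * y) = \<pi> x \<otimes>\<^bsub>A\<^esub> \<pi> y" for x y
    unfolding pi retr_mult using ring_hom_mult[OF h rc rc, of x y] by (simp add: R_simps)
  show "\<pi> 1 = \<one>\<^bsub>A\<^esub>" unfolding pi using ring_hom_one[OF h] by (simp add: R_simps)
  show "\<pi> x = \<zero>\<^bsub>A\<^esub> \<longleftrightarrow> x \<in> I" for x
  proof -
    have "\<zero>\<^bsub>A\<^esub> = rel_ideal n m f +>\<^bsub>R\<^esub> \<zero>\<^bsub>R\<^esub>"
      using Ip.a_subset by (simp add: coord_ring_def FactRing_def)
    then have "\<pi> x = \<zero>\<^bsub>A\<^esub> \<longleftrightarrow> retr n x \<ominus>\<^bsub>R\<^esub> \<zero>\<^bsub>R\<^esub> \<in> rel_ideal n m f"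
      unfolding pi using Ip.quotient_eq_iff_same_a_r_cos[OF Ip.is_ideal rc Ip.zero_closed, of x] by simp
    also have "retr n x \<ominus>\<^bsub>R\<^esub> \<zero>\<^bsub>R\<^esub> = retr n x" using rc by (simp add: Ip.minus_eq)
    finally show ?thesis by (simp add: I_def)
  qed
qed

sublocale \<pi>: type_hom A \<pi> I by (rule \<pi>_hom)

lemma \<pi>_surj: "y \<in> carrier A \<Longrightarrow> \<exists>x. \<pi> x = y"
proof -
  assume "y \<in> carrier A"
  then obtain x where "x \<in> carrier R" "y = rel_ideal n m f +>\<^bsub>R\<^esub> x"
    by (auto simp: coord_ring_def FactRing_def A_RCOSETS_def')
  then have "\<pi> x = y" by (simp add: \<pi>_def image_in_A_def retr_id R_simps)
  then show ?thesis ..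
qed

lemma \<pi>_retr: "p \<in> polys_in {..<n} \<Longrightarrow> image_in_A n m f p = \<pi> p"
  by (simp add: \<pi>_def retr_id)

lemma f_in_polys: "i < m \<Longrightarrow> f i \<in> polys_in {..<n}"
  using f_carrier by (simp add: R_simps)

lemma prime_I: "is_prime I"
proof -
  have "ideal {\<zero>\<^bsub>A\<^esub>} A" by (rule A.zeroideal)
  have "{x. \<pi> x \<in> {\<zero>\<^bsub>A\<^esub>}} = I" by (auto simp: \<pi>.hom_kernel)
  moreover have "primeideal {\<zero>\<^bsub>A\<^esub>} A" using A.zeroprimeideal .
  ultimately show ?thesis using \<pi>.primeideal_vimage by metis
qed

lemma affine_presentation: "affine_presentation n m f I"
proof
  show "prime_over n I" using prime_I
     additive_subgroup.zero_closed[OF Ip.is_additive_subgroup] by (auto simp: prime_over_def I_def R_simps)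
  have fsub: "f ` {..<m} \<subseteq> carrier R" using f_carrier by auto
  show fI: "f i \<in> I" if "i < m" for i
    using Ip.genideal_self[OF fsub] that f_in_polys[OF that] by (auto simp: I_def rel_ideal_def retr_id)
  \<comment> \<open>The explicit linear combinations of the \<open>f i\<close>. They form an ideal
    containing the \<open>f i\<close>, hence the generated ideal, and so furnish the coefficients
    that the presentation asks for.\<close>
  define J where "J = {x. \<exists>b. (\<forall>i<m. b i \<in> polys_in {..<n}) \<and> x = (\<Sum>i<m. b i * f i)}"
  have "ideal J R"
  proof (rule idealI[OF Ip.ring_axioms])
    have Jc: "J \<subseteq> carrier R" unfolding J_def R_simps
      by (auto intro!: polys_in_sum polys_in_mult simp: f_in_polys)
    have mul: "x * a \<in> J" if "a \<in> J" "x \<in> polys_in {..<n}" for a x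
    proof -
      obtain b where b: "\<forall>i<m. b i \<in> polys_in {..<n}" "a = (\<Sum>i<m. b i * f i)" using \<open>a \<in> J\<close> by (auto simp: J_def)
      from b(2) have "x * a = (\<Sum>i<m. (x * b i) * f i)" by (simp add: sum_distrib_left mult.assoc)
      moreover have "\<forall>i<m. x * b i \<in> polys_in {..<n}" using b(1) that(2) polys_in_mult by blast
      ultimately show ?thesis unfolding J_def by (intro CollectI exI[of _ "\<lambda>i. x * b i"]) simp
    qed
    show "x \<otimes>\<^bsub>R\<^esub> a \<in> J" if "a \<in> J" "x \<in> carrier R" for a x using mul that by (simp add: R_simps)
    show "a \<otimes>\<^bsub>R\<^esub> x \<in> J" if "a \<in> J" "x \<in> carrier R" for a x using mul[of a x] that by (simp add: R_simps mult.commute)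
    show "subgroup J (add_monoid R)"
    proof (rule Ip.add.subgroupI)
      show "J \<subseteq> carrier R" by (rule Jc)
      have "0 \<in> J" unfolding J_def by (intro CollectI exI[of _ "\<lambda>_. 0"]) simp
      then show "J \<noteq> {}" by blast
      show "\<ominus>\<^bsub>R\<^esub> a \<in> J" if "a \<in> J" for a
      proof -
        have ac: "a \<in> carrier R" using that Jc by blast
        have "(- 1 :: 'k mpoly) \<in> polys_in {..<n}" by (rule polys_in_uminus[OF polys_in_one])
        from mul[OF that this] have "- a \<in> J" by simp
        moreover have "\<ominus>\<^bsub>R\<^esub> a = - a"
          using ac polys_in_uminus[of a] by (intro Ip.minus_equality) (auto simp: R_simps)
        ultimately show ?thesis by simp
      qed
      show "a \<oplus>\<^bsub>R\<^esub> a' \<in> J" if aa: "a \<in> J" "a' \<in> J" for a a'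
      proof -
        obtain b b' where b: "\<forall>i<m. b i \<in> polys_in {..<n}" "a = (\<Sum>i<m. b i * f i)"
          "\<forall>i<m. b' i \<in> polys_in {..<n}" "a' = (\<Sum>i<m. b' i * f i)" using aa by (auto simp: J_def)
        then have "a + a' = (\<Sum>i<m. (b i + b' i) * f i)" by (simp add: distrib_right sum.distrib)
        moreover have "\<forall>i<m. b i + b' i \<in> polys_in {..<n}" using b polys_in_add by blast
        ultimately show ?thesis unfolding J_def R_simps by (intro CollectI exI[of _ "\<lambda>i. b i + b' i"]) simp
      qed
    qed
  qed
  moreover have "f ` {..<m} \<subseteq> J"
  proof
    fix x assume "x \<in> f ` {..<m}"
    then obtain j where j: "j < m" "x = f j" by auto
    have "x = (\<Sum>i<m. (if i = j then 1 else 0) * f i)"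
      using j by (simp add: if_distrib[of "\<lambda>x. x * _"] sum.delta cong: if_cong)
    then show "x \<in> J" unfolding J_def by (intro CollectI exI[of _ "\<lambda>i. if i = j then 1 else 0"]) simp
  qed
  ultimately have sub: "rel_ideal n m f \<subseteq> J" unfolding rel_ideal_def by (rule Ip.genideal_minimal)
  fix p assume "p \<in> I"
  then have "retr n p \<in> J" using sub by (auto simp: I_def)
  then obtain b where b: "\<forall>i<m. b i \<in> polys_in {..<n}" "retr n p = (\<Sum>i<m. b i * f i)" by (auto simp: J_def)
  have "retr n (\<Sum>i<m. b i * f i) = (\<Sum>i<m. b i * f i)"
    using b f_in_polys by (intro retr_id polys_in_sum polys_in_mult) auto
  then have "retr n (p - (\<Sum>i<m. b i * f i)) = 0" using b by (simp add: retr_diff)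
  then show "\<exists>b. retr n (p - (\<Sum>i<m. b i * f i)) = 0" by (rule exI[of _ b])
qed

sublocale P: affine_presentation n m f I by (rule affine_presentation)

lemma jacobi_eq: "i < m \<Longrightarrow> j < n \<Longrightarrow> jacobi n m f i j = \<pi> (pderiv_mpoly j (f i))"
  by (simp add: jacobi_def \<pi>_def retr_pd f_in_polys retr_id)

lemma localization_model:
  assumes p: "primeideal p A"
  shows "localization_model (localization A (carrier A - p)) (\<lambda>x. loc_frac A (carrier A - p) (\<pi> x) \<one>\<^bsub>A\<^esub>) I {x. \<pi> x \<in> p}"
proof -
  interpret p: primeideal p A by fact
  interpret S: multiplicative_subset A "carrier A - p"
  proof
    have "\<one>\<^bsub>A\<^esub> \<notin> p" using p.one_imp_carrier p.I_notcarr by auto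
    then show "\<one>\<^bsub>A\<^esub> \<in> carrier A - p" by simp
    show "\<zero>\<^bsub>A\<^esub> \<notin> carrier A - p" by simp
    show "s \<otimes>\<^bsub>A\<^esub> t \<in> carrier A - p" if "s \<in> carrier A - p" "t \<in> carrier A - p" for s t
      using that p.I_prime by auto
  qed auto
  show ?thesis
  proof (intro localization_model.intro type_hom.intro type_hom_axioms.intro localization_model_axioms.intro S.cring_L prime_I)
    show "is_prime {x. \<pi> x \<in> p}" by (rule \<pi>.primeideal_vimage[OF p])
    show "I \<subseteq> {x. \<pi> x \<in> p}" by (rule \<pi>.ideal_vimage(2)[OF p.is_ideal])
  next
    fix y assume "y \<in> carrier S.L"
    then obtain a s where as: "a \<in> carrier A" "s \<in> carrier A - p" "S.fr s \<one>\<^bsub>A\<^esub> \<otimes>\<^bsub>S.L\<^esub> y = S.fr a \<one>\<^bsub>A\<^esub>"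
      using S.fr_one_surj by blast
    obtain x z where xz: "\<pi> x = a" "\<pi> z = s" using \<pi>_surj as(1,2) by (metis DiffD1)
    have "z \<notin> {x. \<pi> x \<in> p}" using as(2) xz(2) by simp
    moreover have "S.fr (\<pi> z) \<one>\<^bsub>A\<^esub> \<otimes>\<^bsub>S.L\<^esub> y = S.fr (\<pi> x) \<one>\<^bsub>A\<^esub>" using as(3) xz by simp
    ultimately show "\<exists>a s. s \<notin> {x. \<pi> x \<in> p} \<and> S.fr (\<pi> s) \<one>\<^bsub>A\<^esub> \<otimes>\<^bsub>S.L\<^esub> y = S.fr (\<pi> a) \<one>\<^bsub>A\<^esub>"
      by blast
  qed (use S.S_one \<pi>.hom_closed in \<open>simp_all add: S.fr_closed S.fr_one_add S.fr_one_mult \<pi>.hom_add \<pi>.hom_mult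
      \<pi>.hom_one S.one_L S.fr_one_eq_zero \<pi>.hom_kernel S.fr_one_Units\<close>)
qed

lemma ideal_image:
  assumes J: "is_ideal J" "I \<subseteq> J"
  shows "ideal (\<pi> ` J) A" "\<And>x. \<pi> x \<in> \<pi> ` J \<longleftrightarrow> x \<in> J"
proof -
  have mul: "x \<otimes>\<^bsub>A\<^esub> a \<in> \<pi> ` J" if xa: "a \<in> \<pi> ` J" "x \<in> carrier A" for a x
  proof -
    obtain a' x' where "a = \<pi> a'" "a' \<in> J" "x = \<pi> x'" using xa \<pi>_surj by blast
    then show ?thesis using ideal_mult[OF J(1), of a' x'] by (auto simp flip: \<pi>.hom_mult)
  qed
  have sub: "\<pi> ` J \<subseteq> carrier A" using \<pi>.hom_closed by auto
  show "ideal (\<pi> ` J) A"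
  proof (rule idealI[OF A.ring_axioms])
    show "x \<otimes>\<^bsub>A\<^esub> a \<in> \<pi> ` J" if "a \<in> \<pi> ` J" "x \<in> carrier A" for a x using mul[OF that] .
    show "a \<otimes>\<^bsub>A\<^esub> x \<in> \<pi> ` J" if "a \<in> \<pi> ` J" "x \<in> carrier A" for a x
      using mul[OF that] A.m_comm[of a x] that sub by auto
    show "subgroup (\<pi> ` J) (add_monoid A)"
    proof (rule A.add.subgroupI[OF sub])
      show "\<pi> ` J \<noteq> {}" using ideal_0[OF J(1)] by auto
      show "\<ominus>\<^bsub>A\<^esub> a \<in> \<pi> ` J" if "a \<in> \<pi> ` J" for a
        using that ideal_uminus[OF J(1)] by (auto simp flip: \<pi>.hom_uminus)
      show "a \<oplus>\<^bsub>A\<^esub> b \<in> \<pi> ` J" if "a \<in> \<pi> ` J" "b \<in> \<pi> ` J" for a b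
        using that ideal_add[OF J(1)] by (auto simp flip: \<pi>.hom_add)
    qed
  qed
  show "\<pi> x \<in> \<pi> ` J \<longleftrightarrow> x \<in> J" for x
  proof
    assume "\<pi> x \<in> \<pi> ` J"
    then obtain y where "y \<in> J" "x - y \<in> I" by (auto simp: \<pi>.hom_eq_iff)
    then show "x \<in> J" using ideal_cong[OF J(1), of x y] J(2) by auto
  qed auto
qed

lemma primeideal_image:
  assumes P: "is_prime P" "I \<subseteq> P"
  shows "primeideal (\<pi> ` P) A"
proof (rule primeidealI)
  note im = ideal_image[OF is_prime_is_ideal[OF P(1)] P(2)]
  show "ideal (\<pi> ` P) A" by (rule im(1))
  show "cring A" by (rule A.is_cring)
  have "\<one>\<^bsub>A\<^esub> \<notin> \<pi> ` P" using im(2)[of 1] prime_1[OF P(1)] by (simp add: \<pi>.hom_one)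
  then show "carrier A \<noteq> \<pi> ` P" by auto
  fix a b assume ab: "a \<in> carrier A" "b \<in> carrier A" "a \<otimes>\<^bsub>A\<^esub> b \<in> \<pi> ` P"
  obtain x y where "a = \<pi> x" "b = \<pi> y" using \<pi>_surj ab by metis
  then show "a \<in> \<pi> ` P \<or> b \<in> \<pi> ` P" using ab(3) im(2) by (simp flip: \<pi>.hom_mult add: prime_mult[OF P(1)])
qed

text \<open>Preimages match the primes of A with the primes containing I, and
  \<open>localization_model\<close> makes the local criterion available at each of them.\<close>

lemma regular_iff_jacobian_criterion:
  "regular_ring A \<longleftrightarrow> (\<forall>P. is_prime P \<longrightarrow> I \<subseteq> P \<longrightarrow> P.jacobian_criterion P)"
proof -
  have noeth: "noetherian_ring A"
    by (rule \<pi>.noetherian_of_surj[OF \<pi>_surj]) (auto intro: P.ideal_finitely_generated)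
  have loc: "regular_local_ring (localization A (carrier A - p)) \<longleftrightarrow> P.jacobian_criterion {x. \<pi> x \<in> p}" if "primeideal p A" for p
    by (rule P.regular_local_iff_jacobian_criterion[OF localization_model[OF that]])
  show ?thesis
  proof
    assume reg: "regular_ring A"
    show "\<forall>P. is_prime P \<longrightarrow> I \<subseteq> P \<longrightarrow> P.jacobian_criterion P"
    proof (intro allI impI)
      fix P assume P: "is_prime P" "I \<subseteq> P"
      have "{x. \<pi> x \<in> \<pi> ` P} = P" using ideal_image(2)[OF is_prime_is_ideal[OF P(1)] P(2)] by auto
      then show "P.jacobian_criterion P"
        using loc[OF primeideal_image[OF P]] reg primeideal_image[OF P] by (simp add: regular_ring_def)
    qed
  next
    assume crit: "\<forall>P. is_prime P \<longrightarrow> I \<subseteq> P \<longrightarrow> P.jacobian_criterion P"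
    show "regular_ring A"
      unfolding regular_ring_def
    proof (intro conjI allI impI A.is_cring noeth)
      fix p assume p: "primeideal p A"
      show "regular_local_ring (localization A (carrier A - p))"
        unfolding loc[OF p] using crit \<pi>.primeideal_vimage[OF p] \<pi>.ideal_vimage(2)[OF primeideal.axioms(1)[OF p]] by blast
    qed
  qed
qed

text \<open>The field of fractions is the localization at the zero ideal, whose preimage is I.
  Independence of rows over it becomes independence modulo I after clearing denominators, and the
  maximal number of such rows is known from \<open>jacobian_rank\<close> and
  \<open>indep_grad_le_codim\<close>.\<close>

lemma jacobi_rank_eq: "jacobi_rank n m f = P.r"
proof -
  define F where "F = fraction_field A"
  define \<theta> where "\<theta> = (\<lambda>x. to_fraction_field A (\<pi> x))"
  have pz: "primeideal {\<zero>\<^bsub>A\<^esub>} A" by (rule A.zeroprimeideal)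
  have "{x. \<pi> x \<in> {\<zero>\<^bsub>A\<^esub>}} = I" by (auto simp: \<pi>.hom_kernel)
  then interpret F: localization_model F \<theta> I I
    using localization_model[OF pz] by (simp add: F_def \<theta>_def fraction_field_def to_fraction_field_def)
  have rank_def: "jacobi_rank n m f = Max {card S | S. S \<subseteq> {..<m} \<and>
       (\<forall>c \<in> S \<rightarrow> carrier F. (\<forall>j<n. (\<Oplus>\<^bsub>F\<^esub>i\<in>S. c i \<otimes>\<^bsub>F\<^esub> to_fraction_field A (jacobi n m f i j)) = \<zero>\<^bsub>F\<^esub>) \<longrightarrow> (\<forall>i\<in>S. c i = \<zero>\<^bsub>F\<^esub>))}"
    unfolding jacobi_rank_def matrix_rank_def F_def ..
  have cond: "(\<forall>c \<in> S \<rightarrow> carrier F. (\<forall>j<n. (\<Oplus>\<^bsub>F\<^esub>i\<in>S. c i \<otimes>\<^bsub>F\<^esub> to_fraction_field A (jacobi n m f i j)) = \<zero>\<^bsub>F\<^esub>) \<longrightarrow> (\<forall>i\<in>S. c i = \<zero>\<^bsub>F\<^esub>))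
     \<longleftrightarrow> (\<forall>a. (\<forall>j<n. (\<Sum>i\<in>S. a i * pderiv_mpoly j (f i)) \<in> I) \<longrightarrow> (\<forall>i\<in>S. a i \<in> I))" (is "?L \<longleftrightarrow> ?R")
    if S: "S \<subseteq> {..<m}" for S
  proof -
    have fS: "finite S" using S finite_subset by blast
    have jac: "to_fraction_field A (jacobi n m f i j) = \<theta> (pderiv_mpoly j (f i))" if "i \<in> S" "j < n" for i j
      using jacobi_eq[of i j] that S by (auto simp: \<theta>_def)
    have sum: "(\<Oplus>\<^bsub>F\<^esub>i\<in>S. \<theta> (a i) \<otimes>\<^bsub>F\<^esub> to_fraction_field A (jacobi n m f i j)) = \<theta> (\<Sum>i\<in>S. a i * pderiv_mpoly j (f i))"
      if "j < n" for a j
      unfolding F.hom_sum[OF fS] by (rule F.finsum_cong') (auto simp: jac that F.hom_mult F.hom_closed)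
    show ?thesis
    proof
      assume L: ?L
      show ?R
      proof (intro allI impI)
        fix a assume a: "\<forall>j<n. (\<Sum>i\<in>S. a i * pderiv_mpoly j (f i)) \<in> I"
        have "\<forall>i\<in>S. \<theta> (a i) = \<zero>\<^bsub>F\<^esub>"
          using L[rule_format, of "\<lambda>i. \<theta> (a i)"] sum a by (simp add: F.hom_closed F.hom_kernel)
        then show "\<forall>i\<in>S. a i \<in> I" by (simp add: F.hom_kernel)
      qed
    next
      assume R: ?R
      show ?L
      proof (intro ballI impI)
        fix c i assume c: "c \<in> S \<rightarrow> carrier F" and 0: "\<forall>j<n. (\<Oplus>\<^bsub>F\<^esub>i\<in>S. c i \<otimes>\<^bsub>F\<^esub> to_fraction_field A (jacobi n m f i j)) = \<zero>\<^bsub>F\<^esub>"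
          and i: "i \<in> S"
        have "\<exists>a s. s \<notin> I \<and> \<theta> s \<otimes>\<^bsub>F\<^esub> c i = \<theta> a" if "i \<in> S" for i using F.hom_frac[of "c i"] c that by blast
        then obtain a s where as: "\<And>i. i \<in> S \<Longrightarrow> s i \<notin> I" "\<And>i. i \<in> S \<Longrightarrow> \<theta> (s i) \<otimes>\<^bsub>F\<^esub> c i = \<theta> (a i)" by metis
        \<comment> \<open>A common denominator of the coefficients \<open>c i\<close>; multiplied by
          it they become the images of the polynomials \<open>b i\<close>.\<close>
        define t where "t = (\<Prod>i\<in>S. s i)"
        define b where "b = (\<lambda>i. (\<Prod>j\<in>S-{i}. s j) * a i)"
        have t: "t \<notin> I" unfolding t_def using as(1) by (simp add: prime_prod[OF prime_I fS])
        have tb: "\<theta> t \<otimes>\<^bsub>F\<^esub> c i = \<theta> (b i)" if "i \<in> S" for i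
        proof -
          have "t = (\<Prod>j\<in>S-{i}. s j) * s i" unfolding t_def using that fS by (subst prod.remove[of _ i]) (auto simp: mult.commute)
          then show ?thesis using as(2)[OF that] c that
            by (simp add: b_def F.hom_mult F.m_assoc F.hom_closed Pi_iff)
        qed
        have "(\<Sum>i\<in>S. b i * pderiv_mpoly j (f i)) \<in> I" if j: "j < n" for j
        proof -
          have "\<theta> (\<Sum>i\<in>S. b i * pderiv_mpoly j (f i)) = (\<Oplus>\<^bsub>F\<^esub>i\<in>S. \<theta> t \<otimes>\<^bsub>F\<^esub> (c i \<otimes>\<^bsub>F\<^esub> to_fraction_field A (jacobi n m f i j)))"
            unfolding sum[OF j, symmetric]
            by (rule F.finsum_cong') (use c in \<open>auto simp: jac j F.hom_closed F.m_assoc Pi_iff simp flip: tb\<close>)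
          also have "\<dots> = \<theta> t \<otimes>\<^bsub>F\<^esub> (\<Oplus>\<^bsub>F\<^esub>i\<in>S. c i \<otimes>\<^bsub>F\<^esub> to_fraction_field A (jacobi n m f i j))"
            by (rule F.finsum_rdistr[symmetric, OF fS]) (use c in \<open>auto simp: jac j F.hom_closed Pi_iff\<close>)
          also have "\<dots> = \<zero>\<^bsub>F\<^esub>" using 0 j by (simp add: F.hom_closed)
          finally show ?thesis by (simp add: F.hom_kernel)
        qed
        then have "\<theta> (b i) = \<zero>\<^bsub>F\<^esub>" using R i by (simp add: F.hom_kernel)
        then have "\<theta> t \<otimes>\<^bsub>F\<^esub> c i \<in> {\<zero>\<^bsub>F\<^esub>}" using tb[OF i] by simp
        then show "c i = \<zero>\<^bsub>F\<^esub>" using F.ideal_cancel[OF F.zeroideal t, of "c i"] c i by auto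
      qed
    qed
  qed
  have ind: "(\<forall>a. (\<forall>j<n. (\<Sum>i\<in>set ii. a i * pderiv_mpoly j (f i)) \<in> I) \<longrightarrow> (\<forall>i\<in>set ii. a i \<in> I))
      \<longleftrightarrow> indep_mod I {..<n} (length ii) (\<lambda>i. grad (f (ii ! i)))" if ii: "distinct ii" for ii
  proof -
    have bij: "bij_betw (\<lambda>i. ii ! i) {..<length ii} (set ii)"
      using bij_betw_nth[OF ii refl refl] .
    have sum: "(\<Sum>i\<in>set ii. a i * pderiv_mpoly j (f i)) = (\<Sum>i<length ii. a (ii ! i) * pderiv_mpoly j (f (ii ! i)))" for a j
      by (rule sum.reindex_bij_betw[OF bij, symmetric])
    show ?thesis unfolding indep_mod_def
    proof (intro iffI allI impI)
      fix a i assume L: "\<forall>a. (\<forall>j<n. (\<Sum>i\<in>set ii. a i * pderiv_mpoly j (f i)) \<in> I) \<longrightarrow> (\<forall>i\<in>set ii. a i \<in> I)"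
        and a: "\<forall>l\<in>{..<n}. (\<Sum>i<length ii. a i * pderiv_mpoly l (f (ii ! i))) \<in> I" and i: "i < length ii"
      define a' where "a' = a \<circ> the_inv_into {..<length ii} (\<lambda>i. ii ! i)"
      have a': "a' (ii ! i) = a i" if "i < length ii" for i
        using bij that by (simp add: a'_def the_inv_into_f_f bij_betw_def)
      have "\<forall>j<n. (\<Sum>i\<in>set ii. a' i * pderiv_mpoly j (f i)) \<in> I" unfolding sum using a by (simp add: a')
      then have "a' (ii ! i) \<in> I" using L i by (meson nth_mem)
      then show "a i \<in> I" by (simp add: a'[OF i])
    next
      fix a assume L: "\<forall>a. (\<forall>l\<in>{..<n}. (\<Sum>i<length ii. a i * pderiv_mpoly l (f (ii ! i))) \<in> I) \<longrightarrow> (\<forall>i<length ii. a i \<in> I)"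
        and a: "\<forall>j<n. (\<Sum>i\<in>set ii. a i * pderiv_mpoly j (f i)) \<in> I"
      have "\<forall>i<length ii. a (ii ! i) \<in> I" using L[rule_format, of "\<lambda>i. a (ii ! i)"] a unfolding sum by auto
      then show "\<forall>i\<in>set ii. a i \<in> I" by (metis in_set_conv_nth)
    qed
  qed
  let ?cond = "\<lambda>S. \<forall>a. (\<forall>j<n. (\<Sum>i\<in>S. a i * pderiv_mpoly j (f i)) \<in> I) \<longrightarrow> (\<forall>i\<in>S. a i \<in> I)"
  have "jacobi_rank n m f = Max {card S | S. S \<subseteq> {..<m} \<and> ?cond S}"
    unfolding rank_def by (intro arg_cong[where f = Max] Collect_cong ex_cong1 conj_cong refl cond)
  also have "\<dots> = P.r"
  proof (rule Max_eqI)
    show "finite {card S | S. S \<subseteq> {..<m} \<and> ?cond S}"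
      by (rule finite_subset[of _ "card ` Pow {..<m}"]) auto
  next
    fix y assume "y \<in> {card S | S. S \<subseteq> {..<m} \<and> ?cond S}"
    then obtain S where S: "y = card S" "S \<subseteq> {..<m}" "?cond S" by blast
    define ii where "ii = sorted_list_of_set S"
    have fS: "finite S" using S finite_subset by blast
    have ii: "distinct ii" "set ii = S" "length ii = card S" using fS by (simp_all add: ii_def)
    have "indep_mod I {..<n} (length ii) (\<lambda>i. grad (f (ii ! i)))" using ind[OF ii(1)] S(3) ii(2) by simp
    then have "length ii \<le> P.r"
    proof (rule indep_grad_le_codim[OF P.I])
      fix i assume "i < length ii"
      then have "ii ! i < m" using nth_mem[of i ii] ii(2) S(2) by auto
      then show "f (ii ! i) \<in> I" by (rule P.f_in)
    qed
    then show "y \<le> P.r" using S(1) ii(3) by simp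
  next
    obtain ii where ii: "ii\<in>inc_tuples P.r m" "indep_mod I {..<n} P.r (\<lambda>i. grad (f (ii ! i)))"
      using P.jacobian_rank by blast
    have *: "length ii = P.r" "set ii \<subseteq> {..<m}" "distinct ii"
      using ii(1) by (auto simp: inc_tuples_def tuples_def strict_sorted_iff)
    have "?cond (set ii)" using ind[OF *(3)] ii(2) *(1) by simp
    moreover have "card (set ii) = P.r" using * distinct_card by metis
    ultimately show "P.r \<in> {card S | S. S \<subseteq> {..<m} \<and> ?cond S}"
      using *(2) by (intro CollectI exI[of _ "set ii"] conjI) simp_all
  qed
  finally show ?thesis .
qed

lemma jacobi_minor_eq:
  assumes "ii \<in> tuples k m" "jj \<in> tuples k n"
  shows "jacobi_minor n m f ii jj = \<pi> (P.fminor ii jj)"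
proof -
  have len: "length ii = k" "length jj = k" using assms by (auto simp: tuples_def)
  have eq: "jacobi n m f (ii ! \<nu>) (jj ! \<mu>) = \<pi> (pderiv_mpoly (jj ! \<mu>) (f (ii ! \<nu>)))" if "\<nu> < k" "\<mu> < k" for \<nu> \<mu>
    using jacobi_eq nth_tuple assms that by blast
  have "ring_det A k (\<lambda>\<nu> \<mu>. jacobi n m f (ii ! \<nu>) (jj ! \<mu>)) = ring_det A k (\<lambda>\<nu> \<mu>. \<pi> (pderiv_mpoly (jj ! \<mu>) (f (ii ! \<nu>))))"
    unfolding ring_det_def
  proof (rule A.finsum_cong'[OF refl])
    have pr: "(\<Otimes>\<^bsub>A\<^esub>\<nu>\<in>{..<k}. \<pi> (pderiv_mpoly (jj ! \<sigma> \<nu>) (f (ii ! \<nu>)))) \<in> carrier A" for \<sigma>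
      by (rule A.finprod_closed) (auto simp: \<pi>.hom_closed)
    show "(\<lambda>\<sigma>. add_pow A (sign \<sigma>) (\<Otimes>\<^bsub>A\<^esub>\<nu>\<in>{..<k}. \<pi> (pderiv_mpoly (jj ! \<sigma> \<nu>) (f (ii ! \<nu>))))) \<in> {\<sigma>. \<sigma> permutes {..<k}} \<rightarrow> carrier A"
      using pr A.add.int_pow_closed by auto
    fix \<sigma> assume "\<sigma> \<in> {\<sigma>. \<sigma> permutes {..<k}}"
    then have "\<sigma> \<nu> < k" if "\<nu> < k" for \<nu> using permutes_in_image[of \<sigma> "{..<k}" \<nu>] that by auto
    then have "(\<Otimes>\<^bsub>A\<^esub>\<nu>\<in>{..<k}. jacobi n m f (ii ! \<nu>) (jj ! \<sigma> \<nu>)) = (\<Otimes>\<^bsub>A\<^esub>\<nu>\<in>{..<k}. \<pi> (pderiv_mpoly (jj ! \<sigma> \<nu>) (f (ii ! \<nu>))))"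
      by (intro A.finprod_cong') (auto simp: eq \<pi>.hom_closed)
    then show "add_pow A (sign \<sigma>) (\<Otimes>\<^bsub>A\<^esub>\<nu>\<in>{..<k}. jacobi n m f (ii ! \<nu>) (jj ! \<sigma> \<nu>)) =
        add_pow A (sign \<sigma>) (\<Otimes>\<^bsub>A\<^esub>\<nu>\<in>{..<k}. \<pi> (pderiv_mpoly (jj ! \<sigma> \<nu>) (f (ii ! \<nu>))))" by simp
  qed
  also have "\<dots> = \<pi> (P.fminor ii jj)"
    unfolding P.fminor_def len using \<pi>.hom_minor[OF len(2), of "\<lambda>i. grad (f (ii ! i))"] by simp
  finally show ?thesis by (simp add: jacobi_minor_def len)
qed

lemma jacobi_minor_eq_zero:
  "ii \<in> tuples k m \<Longrightarrow> jj \<in> tuples k n \<Longrightarrow> jacobi_minor n m f ii jj = \<zero>\<^bsub>A\<^esub> \<longleftrightarrow> P.fminor ii jj \<in> I"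
  by (simp only: jacobi_minor_eq \<pi>.hom_kernel)

lemma nonsing_rows_eq: "nonsing_rows n m f = P.rows"
proof -
  have "(\<exists>jj\<in>tuples P.r n. jacobi_minor n m f ii jj \<noteq> \<zero>\<^bsub>A\<^esub>) \<longleftrightarrow> (\<exists>jj\<in>tuples P.r n. P.fminor ii jj \<notin> I)"
    if "ii \<in> inc_tuples P.r m" for ii
    using jacobi_minor_eq_zero[OF P.inc_tuples_tuples[OF that]] by blast
  then show ?thesis unfolding nonsing_rows_def P.rows_def jacobi_rank_eq by blast
qed

lemma nonsing_cols_eq: "nonsing_cols n m f = P.cols"
proof -
  have "(\<exists>ii\<in>tuples P.r m. jacobi_minor n m f ii jj \<noteq> \<zero>\<^bsub>A\<^esub>) \<longleftrightarrow> (\<exists>ii\<in>tuples P.r m. P.fminor ii jj \<notin> I)"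
    if "jj \<in> inc_tuples P.r n" for jj
    using jacobi_minor_eq_zero[OF _ P.inc_tuples_tuples[OF that]] by blast
  then show ?thesis unfolding nonsing_cols_def P.cols_def jacobi_rank_eq by blast
qed

lemma nonsing_cols_Suc_eq: "nonsing_cols_Suc n m f = P.cols_Suc"
  unfolding nonsing_cols_Suc_def P.cols_Suc_def jacobi_rank_eq nonsing_cols_eq ..

section \<open>Natural derivations of the coordinate ring\<close>

lemma K_eq: "K = range (\<lambda>c. \<pi> (mpoly_const c))"
  by (simp add: scalars_def \<pi>_retr)

lemma K_carrier: "K \<subseteq> carrier A"
  unfolding K_eq using \<pi>.hom_closed by auto

text \<open>Taken with the empty set of derivations, to use the ring of endomorphisms before the
  natural derivations are known to be derivations.\<close>

sublocale E0: diff_ops A K "{}"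
  by unfold_locales (use K_carrier in auto)

text \<open>The map induced on A by a map of polynomials. The choice of representative is harmless
  when D is a derivation preserving I, and the restriction to the carrier makes the result
  extensional, as \<open>End_alg\<close> demands.\<close>

definition lift :: "('k mpoly \<Rightarrow> 'k mpoly) \<Rightarrow> 'k mpoly set \<Rightarrow> 'k mpoly set" where
  "lift D = (\<lambda>y\<in>carrier A. \<pi> (D (SOME x. \<pi> x = y)))"

lemma lift_app:
  assumes D: "is_derivation D" "\<And>x. x \<in> I \<Longrightarrow> D x \<in> I"
  shows "lift D (\<pi> x) = \<pi> (D x)"
proof -
  define x' where "x' = (SOME x'. \<pi> x' = \<pi> x)"
  have "\<pi> x' = \<pi> x" unfolding x'_def by (rule someI[of _ x]) simp
  then have "x' - x \<in> I" by (simp add: \<pi>.hom_eq_iff)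
  moreover have "D x' = D (x' - x) + D x" using derivation_add[OF D(1), of "x' - x" x] by simp
  ultimately have "\<pi> (D x') = \<pi> (D x)" using D(2)[of "x' - x"] by (simp add: \<pi>.hom_eq_iff)
  then show ?thesis using \<pi>.hom_closed by (simp add: lift_def x'_def)
qed

lemma lift_Der:
  assumes D: "is_derivation D" "\<And>x. x \<in> I \<Longrightarrow> D x \<in> I" and const: "\<And>c. D (mpoly_const c) = 0"
  shows "lift D \<in> Der K A"
proof -
  have app: "lift D (\<pi> x) = \<pi> (D x)" for x by (rule lift_app) (rule D, assumption?)+
  have add: "lift D (a \<oplus>\<^bsub>A\<^esub> b) = lift D a \<oplus>\<^bsub>A\<^esub> lift D b" if "a \<in> carrier A" "b \<in> carrier A" for a b
  proof -
    obtain x where x: "\<pi> x = a" using \<pi>_surj \<open>a \<in> carrier A\<close> by blast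
    obtain y where y: "\<pi> y = b" using \<pi>_surj \<open>b \<in> carrier A\<close> by blast
    have "lift D (\<pi> x \<oplus>\<^bsub>A\<^esub> \<pi> y) = \<pi> (D (x + y))"
      unfolding \<pi>.hom_add[symmetric] by (rule app)
    also have "\<dots> = lift D (\<pi> x) \<oplus>\<^bsub>A\<^esub> lift D (\<pi> y)"
      unfolding derivation_add[OF D(1)] \<pi>.hom_add app ..
    finally show ?thesis unfolding x y .
  qed
  have mult: "lift D (a \<otimes>\<^bsub>A\<^esub> b) = lift D a \<otimes>\<^bsub>A\<^esub> b \<oplus>\<^bsub>A\<^esub> a \<otimes>\<^bsub>A\<^esub> lift D b" if "a \<in> carrier A" "b \<in> carrier A" for a b
  proof -
    obtain x where x: "\<pi> x = a" using \<pi>_surj \<open>a \<in> carrier A\<close> by blast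
    obtain y where y: "\<pi> y = b" using \<pi>_surj \<open>b \<in> carrier A\<close> by blast
    have "lift D (\<pi> x \<otimes>\<^bsub>A\<^esub> \<pi> y) = \<pi> (D (x * y))"
      unfolding \<pi>.hom_mult[symmetric] by (rule app)
    also have "\<dots> = lift D (\<pi> x) \<otimes>\<^bsub>A\<^esub> \<pi> y \<oplus>\<^bsub>A\<^esub> \<pi> x \<otimes>\<^bsub>A\<^esub> lift D (\<pi> y)"
      unfolding derivation_mult[OF D(1)] \<pi>.hom_add \<pi>.hom_mult app ..
    finally show ?thesis unfolding x y .
  qed
  have closed: "lift D a \<in> carrier A" if "a \<in> carrier A" for a
    using that \<pi>.hom_closed by (simp add: lift_def)
  have scal: "lift D (c \<otimes>\<^bsub>A\<^esub> a) = c \<otimes>\<^bsub>A\<^esub> lift D a" if "c \<in> K" "a \<in> carrier A" for c a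
  proof -
    obtain c' where c': "c = \<pi> (mpoly_const c')" using \<open>c \<in> K\<close> by (auto simp: K_eq)
    have "lift D c = \<zero>\<^bsub>A\<^esub>" by (simp add: c' app const \<pi>.hom_zero)
    then show ?thesis using mult[of c a] that K_carrier closed[of a] by (simp add: subset_iff)
  qed
  have "lift D \<in> carrier A \<rightarrow>\<^sub>E carrier A"
    using closed by (auto simp: lift_def)
  then have "lift D \<in> carrier (End_alg K A)" using add scal by (simp add: E0.End_mem)
  then show ?thesis using mult by (simp add: Der_def)
qed

text \<open>A derivation in \<open>Der K A\<close> vanishes on constants, and sums and products of
  constants and variables exhaust A. This gives the uniqueness behind the definite description in
  \<open>natural_derivation\<close>.\<close>

lemma Der_eqI:
  assumes "\<delta> \<in> Der K A" "\<delta>' \<in> Der K A" "\<And>l. l < n \<Longrightarrow> \<delta> (\<pi> (mpoly_var l)) = \<delta>' (\<pi> (mpoly_var l))"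
  shows "\<delta> = \<delta>'"
proof -
  have E: "d \<in> carrier (End_alg K A)" and leibniz: "\<And>a b. a \<in> carrier A \<Longrightarrow> b \<in> carrier A \<Longrightarrow>
      d (a \<otimes>\<^bsub>A\<^esub> b) = d a \<otimes>\<^bsub>A\<^esub> b \<oplus>\<^bsub>A\<^esub> a \<otimes>\<^bsub>A\<^esub> d b" if "d \<in> Der K A" for d
    using that by (auto simp: Der_def)
  have Der_const: "d (\<pi> (mpoly_const c)) = \<zero>\<^bsub>A\<^esub>" if d: "d \<in> Der K A" for d c
  proof -
    have d1: "d \<one>\<^bsub>A\<^esub> \<in> carrier A" using E0.End_closed[OF E[OF d]] by simp
    then have "d \<one>\<^bsub>A\<^esub> = d \<one>\<^bsub>A\<^esub> \<oplus>\<^bsub>A\<^esub> d \<one>\<^bsub>A\<^esub>" using leibniz[OF d, of "\<one>\<^bsub>A\<^esub>" "\<one>\<^bsub>A\<^esub>"] by simp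
    then have "d \<one>\<^bsub>A\<^esub> = \<zero>\<^bsub>A\<^esub>" using d1 A.add.l_cancel_one' by metis
    moreover have "\<pi> (mpoly_const c) \<in> K" by (auto simp: K_eq)
    ultimately show ?thesis
      using E0.End_scalar[OF E[OF d], of "\<pi> (mpoly_const c)" "\<one>\<^bsub>A\<^esub>"] \<pi>.hom_closed by simp
  qed
  have "\<delta> (\<pi> p) = \<delta>' (\<pi> p)" if "p \<in> polys_in {..<n}" for p
    using that finite_lessThan
  proof (induction p rule: polys_in_induct)
    case (const c)
    then show ?case using Der_const[OF assms(1)] Der_const[OF assms(2)] by simp
  next
    case (var k)
    then show ?case using assms(3) by simp
  next
    case (add p q)
    then show ?case using E0.End_add[OF E[OF assms(1)]] E0.End_add[OF E[OF assms(2)]]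
      by (simp add: \<pi>.hom_add \<pi>.hom_closed)
  next
    case (mult p q)
    then show ?case using leibniz[OF assms(1)] leibniz[OF assms(2)]
      by (simp add: \<pi>.hom_mult \<pi>.hom_closed)
  qed
  then have "\<delta> (\<pi> (retr n p)) = \<delta>' (\<pi> (retr n p))" for p
    using retr_in by blast
  moreover have "\<pi> (retr n p) = \<pi> p" for p by (simp add: \<pi>_def)
  ultimately have eq: "\<delta> (\<pi> p) = \<delta>' (\<pi> p)" for p by simp
  show ?thesis
  proof (rule E0.End_eqI[OF E[OF assms(1)] E[OF assms(2)]])
    fix y assume "y \<in> carrier A"
    then obtain x where "\<pi> x = y" using \<pi>_surj by blast
    then show "\<delta> y = \<delta>' y" using eq[of x] by simp
  qed
qed

lemma natder_derivation:
  assumes "ii \<in> P.rows" "jj \<in> P.cols_Suc"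
  shows "is_derivation (P.natder ii jj)" "\<And>x. x \<in> I \<Longrightarrow> P.natder ii jj x \<in> I" "\<And>c. P.natder ii jj (mpoly_const c) = 0"
proof -
  note t = P.rows_cols_tuples(1)[OF assms(1)] P.rows_cols_tuples(2)[OF assms(2)]
  show "is_derivation (P.natder ii jj)"
    unfolding P.natder_def using t(2) by (intro is_derivation_nat_derivation) (simp add: tuples_def)
  show "\<And>x. x \<in> I \<Longrightarrow> P.natder ii jj x \<in> I" by (rule P.natder_I[OF t])
  show "P.natder ii jj (mpoly_const c) = 0" for c unfolding P.natder_expand[OF t] by simp
qed

lemma natder_lift_app:
  assumes "ii \<in> P.rows" "jj \<in> P.cols_Suc"
  shows "lift (P.natder ii jj) (\<pi> x) = \<pi> (P.natder ii jj x)"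
  by (rule lift_app) (rule natder_derivation[OF assms], assumption?)+

lemma natder_lift_Der:
  assumes "ii \<in> P.rows" "jj \<in> P.cols_Suc"
  shows "lift (P.natder ii jj) \<in> Der K A"
  by (rule lift_Der) (rule natder_derivation[OF assms], assumption?)+

text \<open>The lifted determinant has the prescribed values on the variables by its expansion along
  the last row, and by \<open>Der_eqI\<close> it is the only derivation that has them.\<close>

lemma natural_derivation_eq:
  assumes ij: "ii \<in> P.rows" "jj \<in> P.cols_Suc"
  shows "natural_derivation n m f ii jj = lift (P.natder ii jj)"
proof -
  note t = P.rows_cols_tuples(1)[OF ij(1)] P.rows_cols_tuples(2)[OF ij(2)]
  have inc: "jj \<in> inc_tuples (Suc P.r) n" using ij(2) by (simp add: P.cols_Suc_def)
  then have jj: "length jj = Suc P.r" "distinct jj" by (auto simp: inc_tuples_def tuples_def strict_sorted_iff)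
  have var: "image_in_A n m f (mpoly_var l) = \<pi> (mpoly_var l)" if "l < n" for l
    using that by (intro \<pi>_retr polys_in_var) simp
  have val: "lift (P.natder ii jj) (image_in_A n m f (mpoly_var (jj ! (k - 1)))) =
      add_pow A ((-1 :: int) ^ (P.r + 1 + k)) (jacobi_minor n m f ii (omit_nth (k - 1) jj))"
    if k: "k \<in> {1..P.r + 1}" for k
  proof -
    define q where "q = k - 1"
    have q: "q < Suc P.r" "k = Suc q" using k by (auto simp: q_def)
    have om: "omit_nth q jj \<in> tuples P.r n"
      using omit_nth_inc_tuples[OF inc q(1)] by (rule P.inc_tuples_tuples)
    have "P.natder ii jj (mpoly_var (jj ! q)) =
      (\<Sum>j<Suc P.r. (-1) ^ (P.r + j) * P.fminor ii (omit_nth j jj) * (if j = q then 1 else 0))"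
      unfolding P.natder_expand[OF t] pd_var
      by (intro sum.cong refl arg_cong2[of _ _ _ _ "(*)"] if_cong) (use jj q in \<open>auto simp: nth_eq_iff_index_eq\<close>)
    also have "\<dots> = (-1) ^ (P.r + q) * P.fminor ii (omit_nth q jj)"
      using q by (simp add: if_distrib sum.delta cong: if_cong)
    \<comment> \<open>Positions start at 0 here and at 1 in the definition:
      \<open>k = q + 1\<close>, so the two exponents differ by 2.\<close>
    also have "(-1) ^ (P.r + q) = (of_int ((-1) ^ (P.r + 1 + k)) :: 'k mpoly)" by (simp add: q(2))
    finally have "\<pi> (P.natder ii jj (mpoly_var (jj ! q))) =
      \<pi> (of_int ((-1) ^ (P.r + 1 + k)) * P.fminor ii (omit_nth q jj))" by (rule arg_cong)
    also have "\<dots> = add_pow A ((-1 :: int) ^ (P.r + 1 + k)) (\<pi> (P.fminor ii (omit_nth q jj)))"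
      by (rule \<pi>.hom_add_pow_sign) (metis power_minus1_even minus_one_power_iff)
    finally show ?thesis
      unfolding q_def[symmetric] jacobi_minor_eq[OF t(1) om]
      using var[OF nth_tuple[OF t(2) q(1)]] natder_lift_app[OF ij] by simp
  qed
  have zero: "lift (P.natder ii jj) (image_in_A n m f (mpoly_var l)) = \<zero>\<^bsub>A\<^esub>" if l: "l < n" "l \<notin> set jj" for l
  proof -
    have "P.natder ii jj (mpoly_var l) = 0"
      unfolding P.natder_expand[OF t] pd_var
      by (rule sum.neutral) (use l jj in \<open>auto simp: in_set_conv_nth\<close>)
    then show ?thesis using var[OF l(1)] natder_lift_app[OF ij] by (simp add: \<pi>.hom_zero)
  qed
  show ?thesis
    unfolding natural_derivation_def jacobi_rank_eq
  proof (rule the_equality)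
    show "lift (P.natder ii jj) \<in> Der K A \<and>
        (\<forall>k\<in>{1..P.r + 1}. lift (P.natder ii jj) (image_in_A n m f (mpoly_var (jj ! (k - 1)))) =
             add_pow A ((-1 :: int) ^ (P.r + 1 + k)) (jacobi_minor n m f ii (omit_nth (k - 1) jj))) \<and>
        (\<forall>l<n. l \<notin> set jj \<longrightarrow> lift (P.natder ii jj) (image_in_A n m f (mpoly_var l)) = \<zero>\<^bsub>A\<^esub>)"
      using natder_lift_Der[OF ij] val zero by blast
  next
    fix \<delta> assume d: "\<delta> \<in> Der K A \<and>
        (\<forall>k\<in>{1..P.r + 1}. \<delta> (image_in_A n m f (mpoly_var (jj ! (k - 1)))) =
             add_pow A ((-1 :: int) ^ (P.r + 1 + k)) (jacobi_minor n m f ii (omit_nth (k - 1) jj))) \<and>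
        (\<forall>l<n. l \<notin> set jj \<longrightarrow> \<delta> (image_in_A n m f (mpoly_var l)) = \<zero>\<^bsub>A\<^esub>)"
    show "\<delta> = lift (P.natder ii jj)"
    proof (rule Der_eqI[OF _ natder_lift_Der[OF ij]])
      show "\<delta> \<in> Der K A" using d by blast
      fix l assume l: "l < n"
      have "\<delta> (image_in_A n m f (mpoly_var l)) = lift (P.natder ii jj) (image_in_A n m f (mpoly_var l))"
      proof (cases "l \<in> set jj")
        case True
        then obtain q where q: "q < Suc P.r" "l = jj ! q" using jj(1) by (metis in_set_conv_nth)
        then have k: "Suc q \<in> {1..P.r + 1}" by simp
        have "\<delta> (image_in_A n m f (mpoly_var (jj ! (Suc q - 1)))) =
          add_pow A ((-1 :: int) ^ (P.r + 1 + Suc q)) (jacobi_minor n m f ii (omit_nth (Suc q - 1) jj))"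
          using d k by blast
        then show ?thesis using val[OF k] q(2) by simp
      next
        case False
        then show ?thesis using d zero l by simp
      qed
      then show "\<delta> (\<pi> (mpoly_var l)) = lift (P.natder ii jj) (\<pi> (mpoly_var l))" by (simp add: var[OF l])
    qed
  qed
qed

section \<open>The module of natural derivations and its stable ideals\<close>

abbreviation T where "T \<equiv> P.rows \<times> P.cols_Suc"

lemma finite_T: "finite T"
proof -
  have "finite P.rows" "finite P.cols_Suc"
    by (rule finite_subset[OF _ finite_inc_tuples], auto simp: P.rows_def P.cols_Suc_def)+
  then show ?thesis by simp
qed

lemma natural_derivations_eq:
  "natural_derivations n m f =
    {(\<Oplus>\<^bsub>End_alg K A\<^esub>x\<in>T. mult_op A (a x) \<otimes>\<^bsub>End_alg K A\<^esub> lift (P.natder (fst x) (snd x))) | a. a \<in> T \<rightarrow> carrier A}"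
proof -
  have eq: "(\<Oplus>\<^bsub>End_alg K A\<^esub>x\<in>T. mult_op A (a x) \<otimes>\<^bsub>End_alg K A\<^esub> natural_derivation n m f (fst x) (snd x)) =
    (\<Oplus>\<^bsub>End_alg K A\<^esub>x\<in>T. mult_op A (a x) \<otimes>\<^bsub>End_alg K A\<^esub> lift (P.natder (fst x) (snd x)))" if a: "a \<in> T \<rightarrow> carrier A" for a
  proof (rule E0.E.finsum_cong'[OF refl])
    show "(\<lambda>x. mult_op A (a x) \<otimes>\<^bsub>End_alg K A\<^esub> lift (P.natder (fst x) (snd x))) \<in> T \<rightarrow> carrier (End_alg K A)"
      using a natder_lift_Der by (auto intro!: E0.End_mult_closed E0.mult_op_closed simp: Der_def)
  qed (auto simp: natural_derivation_eq)
  show ?thesis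
    unfolding natural_derivations_def Let_def nonsing_rows_eq nonsing_cols_Suc_eq
    by (rule Collect_cong, rule ex_cong1, rule rev_conj_cong, rule refl, simp only: eq)
qed

lemma finsum_in:
  assumes "finite S" "g \<in> S \<rightarrow> B" "B \<subseteq> carrier (End_alg K A)" "\<zero>\<^bsub>End_alg K A\<^esub> \<in> B"
    "\<And>x y. x \<in> B \<Longrightarrow> y \<in> B \<Longrightarrow> x \<oplus>\<^bsub>End_alg K A\<^esub> y \<in> B"
  shows "(\<Oplus>\<^bsub>End_alg K A\<^esub>x\<in>S. g x) \<in> B"
  using assms(1,2)
proof (induction S rule: finite_induct)
  case (insert x S)
  have "g \<in> S \<rightarrow> carrier (End_alg K A)" "g x \<in> carrier (End_alg K A)" using insert.prems assms(3) by auto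
  then show ?case using insert assms(5) by (simp add: E0.E.finsum_insert)
qed (simp add: assms(4))

lemma Der_add: "\<delta> \<in> Der K A \<Longrightarrow> \<delta>' \<in> Der K A \<Longrightarrow> \<delta> \<oplus>\<^bsub>End_alg K A\<^esub> \<delta>' \<in> Der K A"
proof -
  assume d: "\<delta> \<in> Der K A" "\<delta>' \<in> Der K A"
  then have E: "\<delta> \<in> carrier (End_alg K A)" "\<delta>' \<in> carrier (End_alg K A)" by (auto simp: Der_def)
  have "(\<delta> \<oplus>\<^bsub>End_alg K A\<^esub> \<delta>') (a \<otimes>\<^bsub>A\<^esub> b) = (\<delta> \<oplus>\<^bsub>End_alg K A\<^esub> \<delta>') a \<otimes>\<^bsub>A\<^esub> b \<oplus>\<^bsub>A\<^esub> a \<otimes>\<^bsub>A\<^esub> (\<delta> \<oplus>\<^bsub>End_alg K A\<^esub> \<delta>') b"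
    if ab: "a \<in> carrier A" "b \<in> carrier A" for a b
  proof -
    have "\<delta> (a \<otimes>\<^bsub>A\<^esub> b) = \<delta> a \<otimes>\<^bsub>A\<^esub> b \<oplus>\<^bsub>A\<^esub> a \<otimes>\<^bsub>A\<^esub> \<delta> b" "\<delta>' (a \<otimes>\<^bsub>A\<^esub> b) = \<delta>' a \<otimes>\<^bsub>A\<^esub> b \<oplus>\<^bsub>A\<^esub> a \<otimes>\<^bsub>A\<^esub> \<delta>' b"
      using d ab by (auto simp: Der_def)
    then show ?thesis
      using ab E0.End_closed[OF E(1)] E0.End_closed[OF E(2)]
      by (simp add: E0.End_add_app A.l_distr A.r_distr A.a_ac)
  qed
  then show ?thesis using E0.End_add_closed[OF E] by (simp add: Der_def)
qed

lemma Der_smult: "\<delta> \<in> Der K A \<Longrightarrow> c \<in> carrier A \<Longrightarrow> mult_op A c \<otimes>\<^bsub>End_alg K A\<^esub> \<delta> \<in> Der K A"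
proof -
  assume d: "\<delta> \<in> Der K A" and c: "c \<in> carrier A"
  then have E: "\<delta> \<in> carrier (End_alg K A)" by (auto simp: Der_def)
  have "(mult_op A c \<otimes>\<^bsub>End_alg K A\<^esub> \<delta>) (a \<otimes>\<^bsub>A\<^esub> b) =
      (mult_op A c \<otimes>\<^bsub>End_alg K A\<^esub> \<delta>) a \<otimes>\<^bsub>A\<^esub> b \<oplus>\<^bsub>A\<^esub> a \<otimes>\<^bsub>A\<^esub> (mult_op A c \<otimes>\<^bsub>End_alg K A\<^esub> \<delta>) b"
    if ab: "a \<in> carrier A" "b \<in> carrier A" for a b
  proof -
    have "\<delta> (a \<otimes>\<^bsub>A\<^esub> b) = \<delta> a \<otimes>\<^bsub>A\<^esub> b \<oplus>\<^bsub>A\<^esub> a \<otimes>\<^bsub>A\<^esub> \<delta> b" using d ab by (auto simp: Der_def)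
    then show ?thesis
      using ab c E0.End_closed[OF E]
      by (simp add: E0.End_mult_app E0.mult_op_app A.r_distr A.m_assoc A.m_lcomm)
  qed
  then show ?thesis using E0.End_mult_closed[OF E0.mult_op_closed[OF c] E] by (simp add: Der_def)
qed

lemma Der_zero: "\<zero>\<^bsub>End_alg K A\<^esub> \<in> Der K A"
  using E0.End_zero_closed by (simp add: Der_def E0.End_zero_app)

lemma natural_derivations_Der: "natural_derivations n m f \<subseteq> Der K A"
proof
  fix \<delta> assume "\<delta> \<in> natural_derivations n m f"
  then obtain a where a: "a \<in> T \<rightarrow> carrier A"
    "\<delta> = (\<Oplus>\<^bsub>End_alg K A\<^esub>x\<in>T. mult_op A (a x) \<otimes>\<^bsub>End_alg K A\<^esub> lift (P.natder (fst x) (snd x)))"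
    unfolding natural_derivations_eq by blast
  show "\<delta> \<in> Der K A"
    unfolding a(2)
  proof (rule finsum_in[OF finite_T])
    show "(\<lambda>x. mult_op A (a x) \<otimes>\<^bsub>End_alg K A\<^esub> lift (P.natder (fst x) (snd x))) \<in> T \<rightarrow> Der K A"
      using a(1) natder_lift_Der by (auto intro!: Der_smult)
    show "Der K A \<subseteq> carrier (End_alg K A)" by (auto simp: Der_def)
  qed (use Der_zero Der_add in auto)
qed

lemma lift_natder_natural:
  assumes "ii \<in> P.rows" "jj \<in> P.cols_Suc"
  shows "lift (P.natder ii jj) \<in> natural_derivations n m f"
proof -
  define a where "a = (\<lambda>x. if (ii, jj) = x then \<one>\<^bsub>A\<^esub> else \<zero>\<^bsub>A\<^esub>)"
  have E: "lift (P.natder i j) \<in> carrier (End_alg K A)" if "i \<in> P.rows" "j \<in> P.cols_Suc" for i j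
    using natder_lift_Der[OF that] by (simp add: Der_def)
  have m: "mult_op A (a x) \<otimes>\<^bsub>End_alg K A\<^esub> lift (P.natder (fst x) (snd x)) =
      (if (ii, jj) = x then lift (P.natder (fst x) (snd x)) else \<zero>\<^bsub>End_alg K A\<^esub>)" if "x \<in> T" for x
  proof (rule E0.End_eqI)
    have Ex: "lift (P.natder (fst x) (snd x)) \<in> carrier (End_alg K A)" using E that by auto
    show "mult_op A (a x) \<otimes>\<^bsub>End_alg K A\<^esub> lift (P.natder (fst x) (snd x)) \<in> carrier (End_alg K A)"
      using Ex by (intro E0.End_mult_closed E0.mult_op_closed) (simp_all add: a_def)
    show "(if (ii, jj) = x then lift (P.natder (fst x) (snd x)) else \<zero>\<^bsub>End_alg K A\<^esub>) \<in> carrier (End_alg K A)"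
      using Ex E0.End_zero_closed by simp
    fix b assume "b \<in> carrier A"
    then show "(mult_op A (a x) \<otimes>\<^bsub>End_alg K A\<^esub> lift (P.natder (fst x) (snd x))) b =
       (if (ii, jj) = x then lift (P.natder (fst x) (snd x)) else \<zero>\<^bsub>End_alg K A\<^esub>) b"
      using E0.End_closed[OF Ex] by (simp add: E0.End_mult_app E0.mult_op_app E0.End_zero_app a_def)
  qed
  have "(\<Oplus>\<^bsub>End_alg K A\<^esub>x\<in>T. mult_op A (a x) \<otimes>\<^bsub>End_alg K A\<^esub> lift (P.natder (fst x) (snd x))) =
     (\<Oplus>\<^bsub>End_alg K A\<^esub>x\<in>T. if (ii, jj) = x then lift (P.natder (fst x) (snd x)) else \<zero>\<^bsub>End_alg K A\<^esub>)"
    by (rule E0.E.finsum_cong'[OF refl]) (use m E E0.End_zero_closed in auto)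
  also have "\<dots> = lift (P.natder (fst (ii, jj)) (snd (ii, jj)))"
    by (rule E0.E.finsum_singleton) (use assms finite_T E in auto)
  finally have "lift (P.natder ii jj) = (\<Oplus>\<^bsub>End_alg K A\<^esub>x\<in>T. mult_op A (a x) \<otimes>\<^bsub>End_alg K A\<^esub> lift (P.natder (fst x) (snd x)))"
    by simp
  moreover have "a \<in> T \<rightarrow> carrier A" by (auto simp: a_def)
  ultimately show ?thesis unfolding natural_derivations_eq by blast
qed

sublocale N: diff_ops A K "natural_derivations n m f"
proof unfold_locales
  show "K \<subseteq> carrier A" by (rule K_carrier)
  show "natural_derivations n m f \<subseteq> Der K A" by (rule natural_derivations_Der)
qed simp_all

text \<open>The endomorphisms preserving an ideal form a subring containing all multiplications, so
  stability passes from the generators to their A-linear combinations.\<close>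

lemma stable_ideal_iff:
  "N.stable_ideal N \<longleftrightarrow> ideal N A \<and> (\<forall>ii\<in>P.rows. \<forall>jj\<in>P.cols_Suc. \<forall>y\<in>N. lift (P.natder ii jj) y \<in> N)"
proof
  assume "N.stable_ideal N"
  then show "ideal N A \<and> (\<forall>ii\<in>P.rows. \<forall>jj\<in>P.cols_Suc. \<forall>y\<in>N. lift (P.natder ii jj) y \<in> N)"
    using lift_natder_natural by (simp add: N.stable_ideal_def)
next
  assume N: "ideal N A \<and> (\<forall>ii\<in>P.rows. \<forall>jj\<in>P.cols_Suc. \<forall>y\<in>N. lift (P.natder ii jj) y \<in> N)"
  then interpret N: ideal N A by blast
  let ?B = "{\<phi> \<in> carrier (End_alg K A). \<forall>x\<in>N. \<phi> x \<in> N}"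
  have B: "subring ?B (End_alg K A)" by (rule E0.stabilizer_subring[OF N.is_ideal])
  have "\<delta> \<in> ?B" if "\<delta> \<in> natural_derivations n m f" for \<delta>
  proof -
    obtain a where a: "a \<in> T \<rightarrow> carrier A"
      "\<delta> = (\<Oplus>\<^bsub>End_alg K A\<^esub>x\<in>T. mult_op A (a x) \<otimes>\<^bsub>End_alg K A\<^esub> lift (P.natder (fst x) (snd x)))"
      using \<open>\<delta> \<in> natural_derivations n m f\<close> unfolding natural_derivations_eq by blast
    have mB: "mult_op A c \<in> ?B" if "c \<in> carrier A" for c
      using that N.Icarr N.I_l_closed by (auto simp: E0.mult_op_closed E0.mult_op_app)
    have lB: "lift (P.natder i j) \<in> ?B" if "i \<in> P.rows" "j \<in> P.cols_Suc" for i j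
      using N that natder_lift_Der[OF that] by (simp add: Der_def)
    show ?thesis
      unfolding a(2)
    proof (rule finsum_in[OF finite_T _ subringE(1)[OF B] subringE(2)[OF B]])
      show "(\<lambda>x. mult_op A (a x) \<otimes>\<^bsub>End_alg K A\<^esub> lift (P.natder (fst x) (snd x))) \<in> T \<rightarrow> ?B"
      proof
        fix x assume x: "x \<in> T"
        then have "a x \<in> carrier A" using a(1) by blast
        then show "mult_op A (a x) \<otimes>\<^bsub>End_alg K A\<^esub> lift (P.natder (fst x) (snd x)) \<in> ?B"
          using x by (intro subringE(6)[OF B] mB lB) auto
      qed
      show "x \<oplus>\<^bsub>End_alg K A\<^esub> y \<in> ?B" if "x \<in> ?B" "y \<in> ?B" for x y
        using subringE(7)[OF B that] .
    qed
  qed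
  then show "N.stable_ideal N" using N by (simp add: N.stable_ideal_def)
qed

text \<open>Image and preimage under the projection match ideals of A with ideals containing I, and
  lifting commutes with the projection, so stability means the same on both sides.\<close>

lemma trivial_stable_ideals_iff:
  "(\<forall>N. N.stable_ideal N \<longrightarrow> N = {\<zero>\<^bsub>A\<^esub>} \<or> N = carrier A) \<longleftrightarrow>
   (\<forall>J. is_ideal J \<longrightarrow> I \<subseteq> J \<longrightarrow> P.stable J \<longrightarrow> J = I \<or> J = UNIV)"
proof (intro iffI allI impI)
  fix J assume triv: "\<forall>N. N.stable_ideal N \<longrightarrow> N = {\<zero>\<^bsub>A\<^esub>} \<or> N = carrier A"
    and J: "is_ideal J" "I \<subseteq> J" "P.stable J"
  note im = ideal_image[OF J(1,2)]
  have "N.stable_ideal (\<pi> ` J)"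
    unfolding stable_ideal_iff using im(1) J(3) natder_lift_app by (auto simp: P.stable_def)
  then have "\<pi> ` J = {\<zero>\<^bsub>A\<^esub>} \<or> \<pi> ` J = carrier A" using triv by blast
  then show "J = I \<or> J = UNIV"
  proof
    assume "\<pi> ` J = {\<zero>\<^bsub>A\<^esub>}"
    then have "J \<subseteq> I" by (auto simp flip: \<pi>.hom_kernel)
    then show ?thesis using J(2) by blast
  next
    assume "\<pi> ` J = carrier A"
    then have "x \<in> J" for x using im(2)[of x] \<pi>.hom_closed[of x] by simp
    then show ?thesis by blast
  qed
next
  fix N assume triv: "\<forall>J. is_ideal J \<longrightarrow> I \<subseteq> J \<longrightarrow> P.stable J \<longrightarrow> J = I \<or> J = UNIV"
    and N: "N.stable_ideal N"
  then interpret N: ideal N A by (simp add: N.stable_ideal_def)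
  let ?J = "{x. \<pi> x \<in> N}"
  have "P.stable ?J"
    using N unfolding stable_ideal_iff P.stable_def by (auto simp flip: natder_lift_app)
  then have "?J = I \<or> ?J = UNIV" using triv \<pi>.ideal_vimage[OF N.is_ideal] by blast
  then show "N = {\<zero>\<^bsub>A\<^esub>} \<or> N = carrier A"
  proof
    assume J: "?J = I"
    have "y = \<zero>\<^bsub>A\<^esub>" if y: "y \<in> N" for y
    proof -
      obtain x where "\<pi> x = y" using \<pi>_surj N.Icarr[OF y] by blast
      then show ?thesis using J y \<pi>.hom_kernel[of x] by blast
    qed
    then show ?thesis using additive_subgroup.zero_closed[OF N.is_additive_subgroup] by blast
  next
    assume J: "?J = UNIV"
    have "y \<in> N" if y: "y \<in> carrier A" for y
    proof -
      obtain x where "\<pi> x = y" using \<pi>_surj y by blast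
      then show ?thesis using J by blast
    qed
    then show ?thesis using N.Icarr by blast
  qed
qed

lemma regular_iff_trivial_stable_ideals:
  "regular_ring A \<longleftrightarrow> (\<forall>N. N.stable_ideal N \<longrightarrow> N = {\<zero>\<^bsub>A\<^esub>} \<or> N = carrier A)"
  unfolding regular_iff_jacobian_criterion trivial_stable_ideals_iff
proof (intro iffI allI impI)
  fix J assume crit: "\<forall>P. is_prime P \<longrightarrow> I \<subseteq> P \<longrightarrow> P.jacobian_criterion P"
    and J: "is_ideal J" "I \<subseteq> J" "P.stable J"
  show "J = I \<or> J = UNIV"
    by (rule P.stable_ideal_trivial[OF _ J]) (rule crit[rule_format])
next
  fix P assume triv: "\<forall>J. is_ideal J \<longrightarrow> I \<subseteq> J \<longrightarrow> P.stable J \<longrightarrow> J = I \<or> J = UNIV"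
    and P: "is_prime P" "I \<subseteq> P"
  show "P.jacobian_criterion P"
    by (rule P.jacobian_criterion_of_no_stable_ideal[OF _ P]) (rule triv[rule_format])
qed

lemma natural_diff_ops_eq: "natural_diff_ops n m f = N.ops_ring"
  unfolding natural_diff_ops_def Let_def N.ops_ring_def N.ops_def ..

lemma coord_module_eq: "coord_module n m f = N.ops_module"
  unfolding coord_module_def Let_def N.ops_module_def ..

end

theorem theorem1p4:
  fixes n m :: nat
    and f :: "nat \<Rightarrow> 'k::field_char_0 mpoly"
  assumes "\<forall>i<m. f i \<in> carrier (mpoly_ring n)"
    and "primeideal (rel_ideal n m f) (mpoly_ring n)"
    and "\<not> maximalideal (rel_ideal n m f) (mpoly_ring n)"
  shows "(regular_ring (coord_ring n m f) \<longleftrightarrow> simple_ring (natural_diff_ops n m f)) \<and>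
         (simple_ring (natural_diff_ops n m f) \<longleftrightarrow>
            simple_left_module (natural_diff_ops n m f) (coord_module n m f))"
proof -
  interpret affine_domain n m f using assms by (simp add: affine_domain_def)
  show ?thesis
    unfolding natural_diff_ops_eq coord_module_eq N.simple_ring_iff N.simple_left_module_iff
      regular_iff_trivial_stable_ideals by (rule conjI[OF refl refl])
qed

end
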